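(* Let $F$ be a non-archimedean local field, let $S$ be a torus defined over $F$ that splits over a tamely ramified extension of $F$, with complex dual torus $\widehat S$, and let $\theta:S(F)\to\mathbb C^\times$ be a continuous character with Langlands parameter $\varphi\in H^1(W_F,\widehat S)$. The restriction $\theta|_{S(F)_b}$ is trivial if and only if $\varphi$ belongs to the image of the inflation map $H^1(W_F/I_F,\widehat S^{I_F,\circ})\to H^1(W_F,\widehat S)$.
   Context: $W_F$ is the Weil group, $I_F$ the inertia group; all cohomology is continuous. $S(F)_b$ is the unique maximal bounded (equivalently maximal compact) subgroup of $S(F)$. $\widehat S^{I_F,\circ}$ is the identity component of the group of $I_F$-fixed points of $\widehat S$; the "inflation map" is inflation followed by the map induced by the inclusion $\widehat S^{I_F,\circ}\subset\widehat S$. The local Langlands correspondence for tori is the canonical isomorphism $H^1_{\mathrm{cts}}(W_F,\widehat S)\to\mathrm{Hom}_{\mathrm{cts}}(S(F),\mathbb C^\times)$. *)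

theory Defs
  imports
    "HOL-Analysis.Analysis"
    "HOL-Algebra.Algebra"
    "HOL-Algebra.Algebraic_Closure_Type"
begin

unbundle no fps_syntax

section \<open>Local fields inside a separable closure\<close>

text \<open>
  The ambient type \<open>'a\<close> plays the role of a fixed separable closure of the base field \<open>F\<close>,
  and \<open>F\<close> and its algebraic extensions are subfields of \<open>'a\<close>.
\<close>

abbreviation field_of_type :: "'a::field ring"
  where "field_of_type \<equiv> ring_of_type_algebra"

definition mult_group :: "'a::field set \<Rightarrow> 'a monoid"
  where "mult_group K = mult_of (field_of_type\<lparr>carrier := K\<rparr>)"

definition finite_extension :: "'a::field set \<Rightarrow> 'a set \<Rightarrow> bool"
  where "finite_extension K L \<longleftrightarrow>
    subfield K field_of_type \<and> subfield L field_of_type \<and> K \<subseteq> L \<and>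
    ring.finite_dimension field_of_type K L"

text \<open>A polynomial is separable iff it is coprime to its derivative.\<close>

definition is_separable_closure_of :: "'a::field itself \<Rightarrow> 'a set \<Rightarrow> bool"
  where "is_separable_closure_of T F \<longleftrightarrow>
    subfield F field_of_type \<and>
    (\<forall>x::'a. \<exists>p. p \<noteq> 0 \<and> (\<forall>i. Polynomial.coeff p i \<in> F) \<and> coprime p (pderiv p) \<and> poly p x = 0) \<and>
    (\<forall>p::'a poly. Polynomial.degree p > 0 \<and> coprime p (pderiv p) \<longrightarrow> (\<exists>x. poly p x = 0))"

definition nonarch_abs :: "('a::field \<Rightarrow> real) \<Rightarrow> bool"
  where "nonarch_abs v \<longleftrightarrow>
    (\<forall>x. 0 \<le> v x) \<and> (\<forall>x. v x = 0 \<longleftrightarrow> x = 0) \<and>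
    (\<forall>x y. v (x * y) = v x * v y) \<and> (\<forall>x y. v (x + y) \<le> max (v x) (v y))"

definition uniformizer :: "'a::field set \<Rightarrow> ('a \<Rightarrow> real) \<Rightarrow> 'a \<Rightarrow> bool"
  where "uniformizer K v p \<longleftrightarrow>
    p \<in> K \<and> 0 < v p \<and> v p < 1 \<and> (\<forall>x\<in>K. v x < 1 \<longrightarrow> v x \<le> v p)"

definition residue_field :: "'a::field set \<Rightarrow> ('a \<Rightarrow> real) \<Rightarrow> 'a set set"
  where "residue_field K v =
    {x \<in> K. v x \<le> 1} // {(x, y). x \<in> K \<and> y \<in> K \<and> v x \<le> 1 \<and> v y \<le> 1 \<and> v (x - y) < 1}"

abbreviation residue_card :: "'a::field set \<Rightarrow> ('a \<Rightarrow> real) \<Rightarrow> nat"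
  where "residue_card K v \<equiv> card (residue_field K v)"

text \<open>
  The absolute value \<open>v\<close> is given on the whole separable closure; as \<open>F\<close> is complete, it is the
  unique extension of its restriction to \<open>F\<close>. The existence of a uniformizer says that this
  restriction is discrete and non-trivial.
\<close>

definition nonarch_local_field :: "'a::field set \<Rightarrow> ('a \<Rightarrow> real) \<Rightarrow> bool"
  where "nonarch_local_field F v \<longleftrightarrow>
    subfield F field_of_type \<and> nonarch_abs v \<and>
    (\<exists>p. uniformizer F v p) \<and>
    Metric_space.mcomplete F (\<lambda>x y. v (x - y)) \<and>
    finite (residue_field F v)"

text \<open>
  The residue fields being finite, residue extensions are separable; and \<open>e\<close> is prime to the
  residue characteristic iff it is prime to the residue cardinality.
\<close>

definition tamely_ramified :: "'a::field set \<Rightarrow> 'a set \<Rightarrow> ('a \<Rightarrow> real) \<Rightarrow> bool"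
  where "tamely_ramified F E v \<longleftrightarrow>
    (\<exists>p p' e. uniformizer F v p \<and> uniformizer E v p' \<and> v p = v p' ^ e \<and>
       coprime e (residue_card F v))"

section \<open>Galois and Weil groups\<close>

definition galois_set :: "'a::field set \<Rightarrow> ('a \<Rightarrow> 'a) set"
  where "galois_set K = {\<sigma>. bij \<sigma> \<and> (\<forall>x y. \<sigma> (x + y) = \<sigma> x + \<sigma> y) \<and>
    (\<forall>x y. \<sigma> (x * y) = \<sigma> x * \<sigma> y) \<and> (\<forall>x\<in>K. \<sigma> x = x)}"

definition finite_galois_extension :: "'a::field set \<Rightarrow> 'a set \<Rightarrow> bool"
  where "finite_galois_extension F E \<longleftrightarrow>
    finite_extension F E \<and> (\<forall>\<sigma>\<in>galois_set F. \<sigma> ` E = E)"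

text \<open>\<open>\<sigma>\<close> acts on the residue field of the separable closure as \<open>x \<mapsto> x ^ (q ^ n)\<close>,
  where \<open>q\<close> is the cardinality of the residue field of \<open>K\<close>.\<close>

definition frobenius_power :: "'a::field set \<Rightarrow> ('a \<Rightarrow> real) \<Rightarrow> ('a \<Rightarrow> 'a) \<Rightarrow> int \<Rightarrow> bool"
  where "frobenius_power K v \<sigma> n \<longleftrightarrow>
    (\<forall>x. v x \<le> 1 \<longrightarrow>
      (if n \<ge> 0 then v (\<sigma> x - x ^ (residue_card K v ^ nat n)) < 1
       else v (\<sigma> x ^ (residue_card K v ^ nat (- n)) - x) < 1))"

definition weil_set :: "'a::field set \<Rightarrow> ('a \<Rightarrow> real) \<Rightarrow> ('a \<Rightarrow> 'a) set"
  where "weil_set K v = {\<sigma> \<in> galois_set K. \<exists>n. frobenius_power K v \<sigma> n}"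

definition inertia :: "'a::field set \<Rightarrow> ('a \<Rightarrow> real) \<Rightarrow> ('a \<Rightarrow> 'a) set"
  where "inertia K v = {\<sigma> \<in> galois_set K. \<forall>x. v x \<le> 1 \<longrightarrow> v (\<sigma> x - x) < 1}"

definition weil_group :: "'a::field set \<Rightarrow> ('a \<Rightarrow> real) \<Rightarrow> ('a \<Rightarrow> 'a) monoid"
  where "weil_group K v = \<lparr>carrier = weil_set K v, mult = (\<circ>), one = id\<rparr>"

text \<open>The inertia group is open and carries its profinite (Krull) topology.\<close>

definition weil_topology :: "'a::field set \<Rightarrow> ('a \<Rightarrow> real) \<Rightarrow> ('a \<Rightarrow> 'a) topology"
  where "weil_topology K v = topology_generated_by
    {(\<lambda>u. w \<circ> u) ` (inertia K v \<inter> galois_set L) |w L. w \<in> weil_set K v \<and> finite_extension K L}"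

definition weil_ab :: "'a::field set \<Rightarrow> ('a \<Rightarrow> real) \<Rightarrow> ('a \<Rightarrow> 'a) set monoid"
  where "weil_ab K v = weil_group K v Mod
    (weil_topology K v closure_of derived (weil_group K v) (weil_set K v))"

section \<open>The local reciprocity maps\<close>

text \<open>The product is over the \<open>K\<close>-embeddings of \<open>L\<close> into the separable closure.\<close>

definition field_norm :: "'a::field set \<Rightarrow> 'a set \<Rightarrow> 'a \<Rightarrow> 'a"
  where "field_norm K L a = (\<Prod>s\<in>(\<lambda>\<sigma>. restrict \<sigma> L) ` galois_set K. s a)"

text \<open>
  The reciprocity isomorphisms \<open>rec K\<close> of local class field theory, for the finite extensions
  \<open>K\<close> of \<open>F\<close>. The family is determined by the normalization (uniformizers correspond to
  arithmetic Frobenius elements) and norm functoriality; the values of \<open>rec K\<close> are cosets.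
\<close>

definition local_reciprocity ::
    "'a::field set \<Rightarrow> ('a \<Rightarrow> real) \<Rightarrow> ('a set \<Rightarrow> 'a \<Rightarrow> ('a \<Rightarrow> 'a) set) \<Rightarrow> bool"
  where "local_reciprocity F v rec \<longleftrightarrow>
    (\<forall>K. finite_extension F K \<longrightarrow>
       rec K \<in> iso (mult_group K) (weil_ab K v) \<and>
       (\<forall>p. uniformizer K v p \<longrightarrow> (\<forall>w\<in>rec K p. frobenius_power K v w 1)) \<and>
       (\<forall>L. finite_extension K L \<longrightarrow>
          (\<forall>a\<in>L - {0}. rec L a \<subseteq> rec K (field_norm K L a))) \<and>
       (\<forall>\<sigma>\<in>galois_set F. \<forall>a\<in>K - {0}.
          rec (\<sigma> ` K) (\<sigma> a) = (\<lambda>w. \<sigma> \<circ> w \<circ> inv_into UNIV \<sigma>) ` rec K a))"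

section \<open>Tori\<close>

text \<open>The algebra of functions generated by \<open>G\<close> over \<open>K\<close>.\<close>

inductive_set function_algebra :: "'a::field set \<Rightarrow> ('x \<Rightarrow> 'a) set \<Rightarrow> ('x \<Rightarrow> 'a) set"
  for K G where
    const: "c \<in> K \<Longrightarrow> (\<lambda>_. c) \<in> function_algebra K G"
  | gen: "g \<in> G \<Longrightarrow> g \<in> function_algebra K G"
  | add: "f \<in> function_algebra K G \<Longrightarrow> g \<in> function_algebra K G \<Longrightarrow>
      (\<lambda>x. f x + g x) \<in> function_algebra K G"
  | mult: "f \<in> function_algebra K G \<Longrightarrow> g \<in> function_algebra K G \<Longrightarrow>
      (\<lambda>x. f x * g x) \<in> function_algebra K G"

definition regular_on_GL :: "'a::field set \<Rightarrow> ('a^'n^'n \<Rightarrow> 'a) set"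
  where "regular_on_GL K =
    function_algebra K ({\<lambda>A. A $ i $ j |i j. True} \<union> {\<lambda>A. inverse (det A)})"

text \<open>Points of the \<open>r\<close>-dimensional split torus; coordinates beyond \<open>r\<close> are set to \<open>1\<close>.\<close>

definition Gm_pow :: "nat \<Rightarrow> (nat \<Rightarrow> 'a::field) set"
  where "Gm_pow r = {t. (\<forall>i<r. t i \<noteq> 0) \<and> (\<forall>i\<ge>r. t i = 1)}"

definition regular_on_Gm_pow :: "'a::field set \<Rightarrow> nat \<Rightarrow> ((nat \<Rightarrow> 'a) \<Rightarrow> 'a) set"
  where "regular_on_Gm_pow K r =
    function_algebra K ({\<lambda>t. t i |i. i < r} \<union> {\<lambda>t. inverse (t i) |i. i < r})"

text \<open>\<open>S\<close> is a subgroup of the general linear group which is isomorphic, as an algebraic group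
  over \<open>K\<close>, to a power of the multiplicative group: \<open>f\<close> is an isomorphism of groups, and it and
  its inverse are given by regular functions with coefficients in \<open>K\<close>.\<close>

definition splits_over :: "('a::field^'n^'n) set \<Rightarrow> 'a set \<Rightarrow> bool"
  where "splits_over S K \<longleftrightarrow>
    S \<subseteq> {A. invertible A} \<and>
    (\<exists>r f. bij_betw f (Gm_pow r) S \<and>
      (\<forall>s\<in>Gm_pow r. \<forall>t\<in>Gm_pow r. f (\<lambda>i. s i * t i) = f s ** f t) \<and>
      (\<forall>i j. \<exists>h\<in>regular_on_Gm_pow K r. \<forall>t\<in>Gm_pow r. f t $ i $ j = h t) \<and>
      (\<forall>k<r. \<exists>h\<in>regular_on_GL K. \<forall>t\<in>Gm_pow r. h (f t) = t k))"

text \<open>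
  A torus over \<open>F\<close>, viewed as a linear algebraic group and identified with its group of points
  over the separable closure. The image of the closed immersion in \<open>splits_over\<close> is Zariski
  closed, and stability under the Galois group means that it is defined over \<open>F\<close>.
\<close>

definition torus_over :: "'a::field set \<Rightarrow> ('a^'n^'n) set \<Rightarrow> bool"
  where "torus_over F S \<longleftrightarrow>
    splits_over S UNIV \<and> (\<forall>\<sigma>\<in>galois_set F. \<forall>A\<in>S. map_matrix \<sigma> A \<in> S)"

definition torus_points :: "('a::field^'n^'n) set \<Rightarrow> 'a set \<Rightarrow> ('a^'n^'n) monoid"
  where "torus_points S K =
    \<lparr>carrier = {A \<in> S. \<forall>i j. A $ i $ j \<in> K}, mult = (**), one = mat 1\<rparr>"

definition matrix_dist :: "('a::field \<Rightarrow> real) \<Rightarrow> 'a^'n^'n \<Rightarrow> 'a^'n^'n \<Rightarrow> real"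
  where "matrix_dist v A B = Max {v (A $ i $ j - B $ i $ j) |i j. True}"

definition torus_topology ::
    "('a::field \<Rightarrow> real) \<Rightarrow> ('a^'n^'n) set \<Rightarrow> 'a set \<Rightarrow> ('a^'n^'n) topology"
  where "torus_topology v S K = Metric_space.mtopology (carrier (torus_points S K)) (matrix_dist v)"

text \<open>For a subgroup, boundedness of the matrix entries also bounds the entries of the inverses.\<close>

definition maximal_bounded_subgroup ::
    "('a::field \<Rightarrow> real) \<Rightarrow> ('a^'n^'n) set \<Rightarrow> 'a set \<Rightarrow> ('a^'n^'n) set"
  where "maximal_bounded_subgroup v S K =
    (GREATEST B. subgroup B (torus_points S K) \<and>
       Metric_space.mbounded (carrier (torus_points S K)) (matrix_dist v) B)"

definition hom_group ::
    "('x, 'r) monoid_scheme \<Rightarrow> ('y, 's) monoid_scheme \<Rightarrow> ('x \<Rightarrow> 'y) monoid"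
  where "hom_group G H =
    \<lparr>carrier = hom G H \<inter> extensional (carrier G),
     mult = (\<lambda>f g. \<lambda>x\<in>carrier G. f x \<otimes>\<^bsub>H\<^esub> g x),
     one = (\<lambda>x\<in>carrier G. \<one>\<^bsub>H\<^esub>)\<rparr>"

abbreviation complex_units :: "complex monoid"
  where "complex_units \<equiv> mult_group UNIV"

definition continuous_characters ::
    "('a::field \<Rightarrow> real) \<Rightarrow> ('a^'n^'n) set \<Rightarrow> 'a set \<Rightarrow> ('a^'n^'n \<Rightarrow> complex) monoid"
  where "continuous_characters v S K =
    (hom_group (torus_points S K) complex_units)
      \<lparr>carrier := {\<theta> \<in> carrier (hom_group (torus_points S K) complex_units).
         continuous_map (torus_topology v S K) euclidean \<theta>}\<rparr>"

section \<open>Cocharacters and the complex dual torus\<close>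

text \<open>Cocharacters over the separable closure, as functions on the non-zero elements.\<close>

definition cochar_group :: "('a::field^'n^'n) set \<Rightarrow> ('a \<Rightarrow> 'a^'n^'n) monoid"
  where "cochar_group S =
    \<lparr>carrier = {\<mu> \<in> (- {0}) \<rightarrow>\<^sub>E S.
       (\<forall>s t. s \<noteq> 0 \<and> t \<noteq> 0 \<longrightarrow> \<mu> (s * t) = \<mu> s ** \<mu> t) \<and>
       (\<forall>i j. \<exists>h\<in>function_algebra UNIV {id, inverse}. \<forall>t. t \<noteq> 0 \<longrightarrow> \<mu> t $ i $ j = h t)},
     mult = (\<lambda>\<mu> \<nu>. \<lambda>t\<in>- {0}. \<mu> t ** \<nu> t),
     one = (\<lambda>t\<in>- {0}. mat 1)\<rparr>"

definition cochar_act ::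
    "('a::field \<Rightarrow> 'a) \<Rightarrow> ('a \<Rightarrow> 'a^'n^'n) \<Rightarrow> ('a \<Rightarrow> 'a^'n^'n)"
  where "cochar_act \<sigma> \<mu> = (\<lambda>t\<in>- {0}. map_matrix \<sigma> (\<mu> (inv_into UNIV \<sigma> t)))"

text \<open>
  The complex torus with cocharacter lattice \<open>X\<^sup>*(S)\<close>: by the perfect pairing of the character and
  cocharacter lattices, \<open>X\<^sup>*(S) \<otimes> \<complex>\<^sup>\<times> = Hom (X\<^sub>*(S), \<complex>\<^sup>\<times>)\<close>.
\<close>

definition dual_torus ::
    "('a::field^'n^'n) set \<Rightarrow> (('a \<Rightarrow> 'a^'n^'n) \<Rightarrow> complex) monoid"
  where "dual_torus S = hom_group (cochar_group S) complex_units"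

definition dual_topology ::
    "('a::field^'n^'n) set \<Rightarrow> (('a \<Rightarrow> 'a^'n^'n) \<Rightarrow> complex) topology"
  where "dual_topology S =
    subtopology (product_topology (\<lambda>_. euclidean) (carrier (cochar_group S)))
      (carrier (dual_torus S))"

definition dual_act ::
    "('a::field^'n^'n) set \<Rightarrow> ('a \<Rightarrow> 'a) \<Rightarrow>
     (('a \<Rightarrow> 'a^'n^'n) \<Rightarrow> complex) \<Rightarrow> (('a \<Rightarrow> 'a^'n^'n) \<Rightarrow> complex)"
  where "dual_act S \<sigma> s = (\<lambda>\<mu>\<in>carrier (cochar_group S). s (cochar_act (inv_into UNIV \<sigma>) \<mu>))"

definition dual_inertia_fixed ::
    "'a::field set \<Rightarrow> ('a \<Rightarrow> real) \<Rightarrow> ('a^'n^'n) set \<Rightarrow> (('a \<Rightarrow> 'a^'n^'n) \<Rightarrow> complex) set"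
  where "dual_inertia_fixed F v S =
    {s \<in> carrier (dual_torus S). \<forall>\<sigma>\<in>inertia F v. dual_act S \<sigma> s = s}"

definition dual_inertia_fixed_component ::
    "'a::field set \<Rightarrow> ('a \<Rightarrow> real) \<Rightarrow> ('a^'n^'n) set \<Rightarrow> (('a \<Rightarrow> 'a^'n^'n) \<Rightarrow> complex) set"
  where "dual_inertia_fixed_component F v S =
    connected_component_of_set (subtopology (dual_topology S) (dual_inertia_fixed F v S))
      \<one>\<^bsub>dual_torus S\<^esub>"

section \<open>Continuous cohomology in degree one\<close>

definition cocycle_group ::
    "('g, 'r) monoid_scheme \<Rightarrow> 'g topology \<Rightarrow> ('m, 's) monoid_scheme \<Rightarrow> 'm topology \<Rightarrow>
     ('g \<Rightarrow> 'm \<Rightarrow> 'm) \<Rightarrow> ('g \<Rightarrow> 'm) monoid"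
  where "cocycle_group G T M U act =
    \<lparr>carrier = {z \<in> carrier G \<rightarrow>\<^sub>E carrier M. continuous_map T U z \<and>
       (\<forall>g\<in>carrier G. \<forall>h\<in>carrier G. z (g \<otimes>\<^bsub>G\<^esub> h) = z g \<otimes>\<^bsub>M\<^esub> act g (z h))},
     mult = (\<lambda>z z'. \<lambda>g\<in>carrier G. z g \<otimes>\<^bsub>M\<^esub> z' g),
     one = (\<lambda>g\<in>carrier G. \<one>\<^bsub>M\<^esub>)\<rparr>"

definition coboundaries ::
    "('g, 'r) monoid_scheme \<Rightarrow> ('m, 's) monoid_scheme \<Rightarrow> ('g \<Rightarrow> 'm \<Rightarrow> 'm) \<Rightarrow> ('g \<Rightarrow> 'm) set"
  where "coboundaries G M act =
    {(\<lambda>g\<in>carrier G. inv\<^bsub>M\<^esub> m \<otimes>\<^bsub>M\<^esub> act g m) |m. m \<in> carrier M}"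

definition H1 ::
    "('g, 'r) monoid_scheme \<Rightarrow> 'g topology \<Rightarrow> ('m, 's) monoid_scheme \<Rightarrow> 'm topology \<Rightarrow>
     ('g \<Rightarrow> 'm \<Rightarrow> 'm) \<Rightarrow> ('g \<Rightarrow> 'm) set monoid"
  where "H1 G T M U act = cocycle_group G T M U act Mod coboundaries G M act"

definition weil_cocycles ::
    "'a::field set \<Rightarrow> ('a \<Rightarrow> real) \<Rightarrow> ('a^'n^'n) set \<Rightarrow>
     (('a \<Rightarrow> 'a) \<Rightarrow> ('a \<Rightarrow> 'a^'n^'n) \<Rightarrow> complex) monoid"
  where "weil_cocycles F v S =
    cocycle_group (weil_group F v) (weil_topology F v) (dual_torus S) (dual_topology S) (dual_act S)"

definition weil_class ::
    "'a::field set \<Rightarrow> ('a \<Rightarrow> real) \<Rightarrow> ('a^'n^'n) set \<Rightarrow>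
     (('a \<Rightarrow> 'a) \<Rightarrow> ('a \<Rightarrow> 'a^'n^'n) \<Rightarrow> complex) \<Rightarrow>
     (('a \<Rightarrow> 'a) \<Rightarrow> ('a \<Rightarrow> 'a^'n^'n) \<Rightarrow> complex) set"
  where "weil_class F v S z =
    coboundaries (weil_group F v) (dual_torus S) (dual_act S) #>\<^bsub>weil_cocycles F v S\<^esub> z"

definition weil_H1 ::
    "'a::field set \<Rightarrow> ('a \<Rightarrow> real) \<Rightarrow> ('a^'n^'n) set \<Rightarrow>
     (('a \<Rightarrow> 'a) \<Rightarrow> ('a \<Rightarrow> 'a^'n^'n) \<Rightarrow> complex) set monoid"
  where "weil_H1 F v S =
    H1 (weil_group F v) (weil_topology F v) (dual_torus S) (dual_topology S) (dual_act S)"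

text \<open>
  The quotient of the Weil group by the open inertia subgroup is discrete, and it acts on
  inertia-fixed points through arbitrary representatives.
\<close>

definition unramified_H1 ::
    "'a::field set \<Rightarrow> ('a \<Rightarrow> real) \<Rightarrow> ('a^'n^'n) set \<Rightarrow>
     (('a \<Rightarrow> 'a) set \<Rightarrow> ('a \<Rightarrow> 'a^'n^'n) \<Rightarrow> complex) set monoid"
  where "unramified_H1 F v S =
    H1 (weil_group F v Mod inertia F v)
       (discrete_topology (carrier (weil_group F v Mod inertia F v)))
       ((dual_torus S)\<lparr>carrier := dual_inertia_fixed_component F v S\<rparr>)
       (subtopology (dual_topology S) (dual_inertia_fixed_component F v S))
       (\<lambda>C. dual_act S (SOME w. w \<in> C))"

text \<open>Inflation of classes; all cocycles \<open>z\<close> in the class \<open>c\<close> contribute the same class.\<close>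

definition inflation_map ::
    "'a::field set \<Rightarrow> ('a \<Rightarrow> real) \<Rightarrow> ('a^'n^'n) set \<Rightarrow>
     (('a \<Rightarrow> 'a) set \<Rightarrow> ('a \<Rightarrow> 'a^'n^'n) \<Rightarrow> complex) set \<Rightarrow>
     (('a \<Rightarrow> 'a) \<Rightarrow> ('a \<Rightarrow> 'a^'n^'n) \<Rightarrow> complex) set"
  where "inflation_map F v S c =
    (\<Union>z\<in>c. weil_class F v S (\<lambda>w\<in>weil_set F v. z (inertia F v #>\<^bsub>weil_group F v\<^esub> w)))"

section \<open>The local Langlands correspondence for tori\<close>

text \<open>
  Langlands' construction. A 1-cycle \<open>\<Sum>i<m. [w i] \<otimes> l i\<close> of the Weil group \<open>W\<^sub>F\<close> with values in
  \<open>X\<^sub>*(S)\<close> pairs with a cocycle \<open>z\<close> to \<open>\<Prod>i<m. z (w i) (l i)\<close>. If \<open>E\<close> is a finite Galois extension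
  splitting \<open>S\<close>, the transfer \<open>H\<^sub>1(W\<^sub>F, X\<^sub>*(S)) \<rightarrow> H\<^sub>1(W\<^sub>E, X\<^sub>*(S)) = W\<^sub>E\<^sup>a\<^sup>b \<otimes> X\<^sub>*(S)\<close> sends \<open>[w] \<otimes> l\<close>
  to the sum of \<open>[r w (r')\<inverse>] \<otimes> r l\<close> over a set \<open>R\<close> of representatives \<open>r\<close> of \<open>W\<^sub>E \ W\<^sub>F\<close>,
  where \<open>r'\<close> in \<open>R\<close> represents the coset of \<open>r w\<close>. Reciprocity for \<open>E\<close> identifies the target with
  \<open>E\<^sup>\<times> \<otimes> X\<^sub>*(S) = S(E)\<close>, and the transfer is an isomorphism onto \<open>S(F)\<close>. The correspondence is
  dual to it, and does not depend on \<open>E\<close> and \<open>R\<close>.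
\<close>

definition coset_representatives ::
    "'a::field set \<Rightarrow> 'a set \<Rightarrow> ('a \<Rightarrow> real) \<Rightarrow> ('a \<Rightarrow> 'a) set \<Rightarrow> bool"
  where "coset_representatives F E v R \<longleftrightarrow>
    R \<subseteq> weil_set F v \<and> (\<forall>g\<in>weil_set F v. \<exists>!r. r \<in> R \<and> g \<circ> inv_into UNIV r \<in> weil_set E v)"

definition transfer_part ::
    "'a::field set \<Rightarrow> ('a \<Rightarrow> real) \<Rightarrow> ('a \<Rightarrow> 'a) set \<Rightarrow> ('a \<Rightarrow> 'a) \<Rightarrow> ('a \<Rightarrow> 'a)"
  where "transfer_part E v R g =
    g \<circ> inv_into UNIV (THE r. r \<in> R \<and> g \<circ> inv_into UNIV r \<in> weil_set E v)"

definition one_cycle ::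
    "'a::field set \<Rightarrow> ('a \<Rightarrow> real) \<Rightarrow> ('a^'n^'n) set \<Rightarrow>
     nat \<Rightarrow> (nat \<Rightarrow> 'a \<Rightarrow> 'a) \<Rightarrow> (nat \<Rightarrow> 'a \<Rightarrow> 'a^'n^'n) \<Rightarrow> bool"
  where "one_cycle F v S m w l \<longleftrightarrow>
    (\<forall>i<m. w i \<in> weil_set F v \<and> l i \<in> carrier (cochar_group S)) \<and>
    finprod (cochar_group S)
      (\<lambda>i. cochar_act (inv_into UNIV (w i)) (l i) \<otimes>\<^bsub>cochar_group S\<^esub> inv\<^bsub>cochar_group S\<^esub> (l i))
      {..<m} = \<one>\<^bsub>cochar_group S\<^esub>"

definition langlands_correspondence ::
    "'a::field set \<Rightarrow> ('a \<Rightarrow> real) \<Rightarrow> ('a set \<Rightarrow> 'a \<Rightarrow> ('a \<Rightarrow> 'a) set) \<Rightarrow> ('a^'n^'n) set \<Rightarrow>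
     ((('a \<Rightarrow> 'a) \<Rightarrow> ('a \<Rightarrow> 'a^'n^'n) \<Rightarrow> complex) set \<Rightarrow> 'a^'n^'n \<Rightarrow> complex) \<Rightarrow> bool"
  where "langlands_correspondence F v rec S LLC \<longleftrightarrow>
    LLC \<in> iso (weil_H1 F v S) (continuous_characters v S F) \<and>
    (\<exists>E R. finite_galois_extension F E \<and> splits_over S E \<and> coset_representatives F E v R \<and>
      (\<forall>z\<in>carrier (weil_cocycles F v S). \<forall>m w l a.
         one_cycle F v S m w l \<and>
         (\<forall>i<m. \<forall>r\<in>R. a i r \<in> E - {0} \<and> transfer_part E v R (r \<circ> w i) \<in> rec E (a i r)) \<longrightarrow>
         LLC (weil_class F v S z)
           (finprod (torus_points S E) (\<lambda>i.
              finprod (torus_points S E) (\<lambda>r. cochar_act r (l i) (a i r)) R) {..<m}) =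
         (\<Prod>i<m. z (w i) (l i))))"

end

theory Submission
  imports Defs
begin

text \<open>
  Let \<open>X\<close> be the cocharacter lattice, \<open>Fr\<close> a Frobenius element, \<open>R\<close> representatives of \<open>W\<^sub>E \ W\<^sub>F\<close> for
  a splitting field \<open>E\<close>, and \<open>Nm x = \<Sum>r\<in>R. r x\<close>. Both conditions are equivalent to the class \<open>\<phi>\<close>
  containing an unramified cocycle \<open>w \<mapsto> exp (deg w * g (Nm x))\<close>, with \<open>g\<close> additive on \<open>X\<close>.

  A cocycle \<open>z\<close> is cohomologous to an unramified one as soon as the prescriptions \<open>w\<inverse>x - x \<mapsto> z w x\<close>
  for inertia elements \<open>w\<close>, and \<open>Fr\<inverse>x - x \<mapsto> z Fr x\<close> for \<open>Nm x = 0\<close>, are consistent: they then extend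
  to a character of \<open>X\<close>, as \<open>\<complex>\<^sup>\<times>\<close> is divisible, and after twisting by it \<open>z Fr\<close> factors through \<open>Nm\<close> and
  has a logarithm. If \<open>\<theta>\<close> is trivial on \<open>S(F)\<^sub>b\<close>, the prescriptions are consistent since a relation
  between them is a 1-cycle whose transfer has coordinates of absolute value 1. If \<open>\<phi>\<close> is inflated,
  \<open>z\<close> is trivial on inertia and \<open>z Fr\<close> lies in the identity component of the inertia-fixed points,
  so \<open>z Fr\<close> is trivial on the elements that are torsion modulo the inertia augmentation, among them
  the \<open>x\<close> with \<open>Nm x = 0\<close> and \<open>Fr\<inverse>x - x\<close> in it.

  Conversely, an unramified cocycle takes values in the identity component, along the path
  \<open>exp (t * g (Nm x))\<close>. If \<open>s\<close> is bounded, \<open>s\<close> to the power \<open>card R\<close> is the transfer of a cycle of inertia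
  elements, on which unramified cocycles are trivial; as every unramified cocycle has an unramified
  \<open>card R\<close>-th root, its character is trivial on \<open>s\<close> itself.
\<close>

section \<open>Complex characters of abelian groups\<close>

text \<open>The correspondence is known only by its values on transfers of 1-cycles. No step may
  invert the transfer, and not even its landing in \<open>S(F)\<close> is at hand; this shapes both
  directions. To exploit triviality on bounded elements, one needs cycles with bounded transfer.
  Reciprocity turns degrees of Weil elements into valuations, so the coordinates are units once a
  weighted sum of degrees vanishes. That sum collapses to the terms
  \<open>deg (w i) * Nm (l i)\<close>, which is why exactly two kinds of terms are used: inertia
  elements, and elements killed by \<open>Nm\<close>. Conversely, the one cycle that can be written
  down for a given bounded \<open>s\<close> has as transfer the norm of \<open>s\<close>, which is a
  power of \<open>s\<close> and not \<open>s\<close>. The power is removed on the dual side, where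
  the logarithm \<open>g\<close> can be divided by an integer. The same logarithm gives the path to
  the trivial character, whereas torsion in the inertia coinvariants of the lattice is what tells
  other components of the fixed points from the identity component. The homological part is done for
  an abstract group with a degree map acting on a lattice.\<close>

lemma mult_group_simps [simp]:
  "carrier (mult_group K) = K - {0}"
  "x \<otimes>\<^bsub>mult_group K\<^esub> y = x * y"
  "\<one>\<^bsub>mult_group K\<^esub> = 1"
  by (auto simp: mult_group_def Ring_Divisibility.mult_of_def Multiplicative_Group.mult_of_def
      ring_of_type_algebra_def)

lemma comm_group_mult_group_UNIV: "comm_group (mult_group (UNIV :: 'a::field set))"
proof (rule comm_groupI)
  fix x :: 'a assume "x \<in> carrier (mult_group UNIV)"
  then show "\<exists>y\<in>carrier (mult_group UNIV). y \<otimes>\<^bsub>mult_group UNIV\<^esub> x = \<one>\<^bsub>mult_group UNIV\<^esub>"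
    by (intro bexI[of _ "inverse x"]) auto
qed auto

interpretation units: comm_group "mult_group (UNIV :: 'a::field set)"
  by (rule comm_group_mult_group_UNIV)

lemma inv_mult_group_UNIV [simp]:
  "(x::'a::field) \<noteq> 0 \<Longrightarrow> inv\<^bsub>mult_group UNIV\<^esub> x = inverse x"
  by (intro units.inv_equality) auto

lemma int_pow_mult_group_UNIV [simp]:
  assumes "(x::'a::field) \<noteq> 0"
  shows "x [^]\<^bsub>mult_group UNIV\<^esub> (k::int) = x powi k"
proof -
  have n: "x [^]\<^bsub>mult_group UNIV\<^esub> (n::nat) = x ^ n" for n
    by (induction n) auto
  show ?thesis using assms by (auto simp: int_pow_def2 power_int_def n power_inverse)
qed

lemma complex_root_exists:
  assumes "(b::complex) \<noteq> 0" "n > 0" shows "\<exists>c. c \<noteq> 0 \<and> c ^ n = b"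
  using assms by (intro exI[of _ "exp (ln b / of_nat n)"]) (simp flip: exp_of_nat_mult)

text \<open>A homomorphism to the complex units defined on a subgroup, here given by its graph,
  extends to the whole group because the complex units are divisible.\<close>

lemma (in comm_group) character_extension:
  assumes \<Gamma>: "subgroup \<Gamma> (G \<times>\<times> complex_units)" and triv: "\<And>c. (\<one>, c) \<in> \<Gamma> \<Longrightarrow> c = 1"
  shows "\<exists>h\<in>hom G complex_units. \<forall>(x, c)\<in>\<Gamma>. h x = c"
proof -
  let ?P = "G \<times>\<times> complex_units"
  interpret P: group ?P by (intro DirProd_group is_group units.is_group)
  \<comment> \<open>A subgroup of the product is the graph of a partial character as soon as 1 is
    the only value over the identity. So \<open>A\<close> consists of the partial characters
    extending \<open>\<Gamma>\<close>.\<close>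
  define A where "A = {\<Delta>. \<Gamma> \<subseteq> \<Delta> \<and> subgroup \<Delta> ?P \<and> (\<forall>c. (\<one>, c) \<in> \<Delta> \<longrightarrow> c = 1)}"
  have "\<exists>M\<in>A. (\<forall>\<Delta>\<in>A. M \<subseteq> \<Delta> \<longrightarrow> \<Delta> = M)"
  proof (rule subset_Zorn_nonempty)
    show "A \<noteq> {}" using \<Gamma> triv by (auto simp: A_def)
    fix C assume C: "C \<noteq> {}" "subset.chain A C"
    then have CA: "C \<subseteq> A" and tot: "\<And>\<Delta> \<Delta>'. \<Delta> \<in> C \<Longrightarrow> \<Delta>' \<in> C \<Longrightarrow> \<Delta> \<subseteq> \<Delta>' \<or> \<Delta>' \<subseteq> \<Delta>"
      by (auto simp: subset_chain_def)
    have sub: "subgroup \<Delta> ?P" if "\<Delta> \<in> C" for \<Delta> using CA that by (auto simp: A_def)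
    have "subgroup (\<Union>C) ?P"
    proof (rule P.subgroupI)
      show "\<Union>C \<subseteq> carrier ?P" using sub subgroup.subset by blast
      show "\<Union>C \<noteq> {}" using C sub subgroup.one_closed by blast
      show "inv\<^bsub>?P\<^esub> a \<in> \<Union>C" if "a \<in> \<Union>C" for a
        using that sub subgroup.m_inv_closed by (metis UnionE UnionI)
      show "a \<otimes>\<^bsub>?P\<^esub> b \<in> \<Union>C" if ab: "a \<in> \<Union>C" "b \<in> \<Union>C" for a b
      proof -
        obtain \<Delta> \<Delta>' where "\<Delta> \<in> C" "a \<in> \<Delta>" "\<Delta>' \<in> C" "b \<in> \<Delta>'" using ab by blast
        then have "a \<in> \<Delta> \<and> b \<in> \<Delta> \<or> a \<in> \<Delta>' \<and> b \<in> \<Delta>'" using tot by blast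
        then show ?thesis
          using sub[OF \<open>\<Delta> \<in> C\<close>] sub[OF \<open>\<Delta>' \<in> C\<close>] \<open>\<Delta> \<in> C\<close> \<open>\<Delta>' \<in> C\<close>
          by (meson UnionI subgroup.m_closed)
      qed
    qed
    then show "\<Union>C \<in> A" using C CA by (auto simp: A_def)
  qed
  then obtain M where M: "M \<in> A" and max: "\<And>\<Delta>. \<Delta> \<in> A \<Longrightarrow> M \<subseteq> \<Delta> \<Longrightarrow> \<Delta> = M" by blast
  then have GM: "\<Gamma> \<subseteq> M" and sM: "subgroup M ?P" and tM: "\<And>c. (\<one>, c) \<in> M \<Longrightarrow> c = 1"
    by (auto simp: A_def)
  have Mc: "x \<in> carrier G \<and> c \<noteq> 0" if "(x, c) \<in> M" for x c
    using subgroup.subset[OF sM] that by auto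
  have Mm: "(x \<otimes> y, c * d) \<in> M" if "(x, c) \<in> M" "(y, d) \<in> M" for x y c d
    using subgroup.m_closed[OF sM that] by simp
  have Mi: "(inv x, inverse c) \<in> M" if "(x, c) \<in> M" for x c
    using subgroup.m_inv_closed[OF sM that] Mc[OF that] by (simp add: inv_DirProd units.is_group)
  have Mp: "(x [^] k, c powi k) \<in> M" if "(x, c) \<in> M" for x c and k :: int
  proof -
    have n: "(x [^] n, c ^ n) \<in> M" for n :: nat
    proof (induction n)
      case 0 show ?case using subgroup.one_closed[OF sM] by simp
    next
      case (Suc n) then show ?case using Mm[OF Suc that] by (simp add: mult.commute)
    qed
    show ?thesis
    proof (cases "k < 0")
      case False
      have 1: "x [^] k = x [^] nat k" unfolding int_pow_def2[of G x k] using False by simp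
      have 2: "c powi k = c ^ nat k" using False by (simp add: power_int_def)
      show ?thesis unfolding 1 2 by (rule n)
    next
      case True
      have 1: "x [^] k = inv (x [^] nat (- k))" unfolding int_pow_def2[of G x k] using True by (rule if_P)
      have 2: "c powi k = inverse (c ^ nat (- k))" using True by (simp add: power_int_def power_inverse)
      show ?thesis unfolding 1 2 by (rule Mi[OF n])
    qed
  qed
  have Mu: "c = d" if "(x, c) \<in> M" "(x, d) \<in> M" for x c d
    using tM[of "c * inverse d"] Mm[OF that(1) Mi[OF that(2)]] Mc[OF that(1)] Mc[OF that(2)]
    by (auto simp: field_simps)
  have dom: "\<exists>c. (x, c) \<in> M" if x: "x \<in> carrier G" for x
  proof -
    \<comment> \<open>A value at \<open>x\<close> must agree with \<open>M\<close> on every power of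
      \<open>x\<close> in its domain. If no positive power occurs, 1 will do. Otherwise the least
      positive exponent \<open>n\<close> divides all exponents that occur, and an
      \<open>n\<close>-th root of the value there works.\<close>
    have "\<exists>c. c \<noteq> 0 \<and> (\<forall>k::int. \<forall>b. (x [^] k, b) \<in> M \<longrightarrow> b = c powi k)"
    proof (cases "\<exists>n::nat>0. \<exists>b. (x [^] n, b) \<in> M")
      case False
      have "b = 1" if "(x [^] k, b) \<in> M" for k :: int and b
      proof -
        have "k = 0"
        proof (rule ccontr)
          assume "k \<noteq> 0"
          then have "nat \<bar>k\<bar> > 0" by simp
          moreover have "\<exists>b. (x [^] nat \<bar>k\<bar>, b) \<in> M"
          proof (cases "k < 0")
            case True
            have "x [^] k = inv (x [^] nat (- k))" unfolding int_pow_def2[of G x k] using True by (rule if_P)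
            then have "x [^] nat \<bar>k\<bar> = inv (x [^] k)" using True x by simp
            then show ?thesis using Mi[OF that] by metis
          next
            case False
            have "x [^] k = x [^] nat k" unfolding int_pow_def2[of G x k] using False by simp
            then show ?thesis using that False by auto
          qed
          ultimately show False using False by blast
        qed
        then show ?thesis using that tM by simp
      qed
      then show ?thesis by (intro exI[of _ 1]) auto
    next
      case True
      define n where "n = (LEAST n::nat. n > 0 \<and> (\<exists>b. (x [^] n, b) \<in> M))"
      have n: "n > 0" "\<exists>b. (x [^] n, b) \<in> M"
        using LeastI_ex[OF True[unfolded Bex_def]] True unfolding n_def by (metis (mono_tags, lifting) LeastI)+
      have least: "m = 0" if "m < n" "(x [^] m, b) \<in> M" for m b
        using that not_less_Least[of m "\<lambda>n::nat. n > 0 \<and> (\<exists>b. (x [^] n, b) \<in> M)"]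
        unfolding n_def by (cases "m = 0") auto
      obtain b0 where b0: "(x [^] n, b0) \<in> M" using n by blast
      obtain c where c: "c \<noteq> 0" "c ^ n = b0" using complex_root_exists[OF _ n(1)] Mc[OF b0] by blast
      have "b = c powi k" if b: "(x [^] k, b) \<in> M" for k :: int and b
      proof -
        define q s where "q = k div int n" and "s = k mod int n"
        have k: "k = int n * q + s" by (simp add: q_def s_def)
        have s: "0 \<le> s" "s < int n" using n(1) by (auto simp: s_def)
        have "(x [^] n) [^] q = x [^] (int n * q)"
          using x by (simp add: int_pow_pow flip: int_pow_int)
        then have p: "(x [^] (int n * q), c powi (int n * q)) \<in> M"
          using Mp[OF b0, of q] c by (simp add: power_int_mult flip: power_int_of_nat)
        have "x [^] k = x [^] s \<otimes> x [^] (int n * q)"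
          using int_pow_mult[OF x] k by (metis add.commute)
        then have e1: "x [^] k \<otimes> inv (x [^] (int n * q)) = x [^] s"
          using inv_solve_right int_pow_closed[OF x] by metis
        have e2: "x [^] s = x [^] nat s" unfolding int_pow_def2[of G x s] using s by simp
        have "(x [^] nat s, b * inverse (c powi (int n * q))) \<in> M"
          using Mm[OF b Mi[OF p]] unfolding e1 e2 .
        then have "nat s = 0" using least s by (metis nat_less_iff)
        then have "s = 0" using s by simp
        then have "x [^] k = x [^] (int n * q)" using k by simp
        then have "b = c powi (int n * q)" using Mu b p by metis
        then show ?thesis using k \<open>s = 0\<close> by simp
      qed
      then show ?thesis using c by blast
    qed
    then obtain c where c: "c \<noteq> 0" and cb: "\<And>k::int. \<And>b. (x [^] k, b) \<in> M \<Longrightarrow> b = c powi k" by blast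
    \<comment> \<open>\<open>M'\<close> adjoins the value \<open>c\<close> at \<open>x\<close>.
      Maximality forces \<open>M' = M\<close>, so \<open>x\<close> was in the domain all
      along.\<close>
    define M' where "M' = {(g \<otimes> x [^] k, b * c powi k) | g b k::int. (g, b) \<in> M} "
    have memI: "(g \<otimes> x [^] k, b * c powi k) \<in> M'" if "(g, b) \<in> M" for g b and k :: int
      using that by (auto simp: M'_def)
    have one: "(\<one>, 1) \<in> M" using subgroup.one_closed[OF sM] by simp
    have "subgroup M' ?P"
    proof (rule P.subgroupI)
      show "M' \<subseteq> carrier ?P" using Mc x c by (auto simp: M'_def)
      show "M' \<noteq> {}" using memI one by blast
      fix p assume "p \<in> M'"
      then obtain g b and k :: int where p: "p = (g \<otimes> x [^] k, b * c powi k)" "(g, b) \<in> M"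
        by (auto simp: M'_def)
      have gc: "g \<in> carrier G" "b \<noteq> 0" using Mc[OF p(2)] by auto
      have e: "inv\<^bsub>?P\<^esub> p = (inv g \<otimes> x [^] (- k), inverse b * c powi (- k))"
        using gc x c by (simp add: p inv_DirProd units.is_group inv_mult int_pow_neg power_int_minus is_group)
      show "inv\<^bsub>?P\<^esub> p \<in> M'" unfolding e using Mi[OF p(2)] by (rule memI)
      fix p' assume "p' \<in> M'"
      then obtain g' b' and k' :: int where p': "p' = (g' \<otimes> x [^] k', b' * c powi k')" "(g', b') \<in> M"
        by (auto simp: M'_def)
      have gc': "g' \<in> carrier G" "b' \<noteq> 0" using Mc[OF p'(2)] by auto
      have e: "p \<otimes>\<^bsub>?P\<^esub> p' = ((g \<otimes> g') \<otimes> x [^] (k + k'), (b * b') * c powi (k + k'))"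
        using gc gc' x c by (simp add: p p' int_pow_mult power_int_add m_ac)
      show "p \<otimes>\<^bsub>?P\<^esub> p' \<in> M'" unfolding e using Mm[OF p(2) p'(2)] by (rule memI)
    qed
    moreover have "d = 1" if d: "(\<one>, d) \<in> M'" for d
    proof -
      obtain g b and k :: int where p: "\<one> = g \<otimes> x [^] k" "d = b * c powi k" "(g, b) \<in> M"
        using d by (auto simp: M'_def)
      have "x [^] k = inv g" using p(1) Mc[OF p(3)] x by (metis inv_equality int_pow_closed m_comm)
      then have "(x [^] k, inverse b) \<in> M" using Mi[OF p(3)] by simp
      then show "d = 1" using cb p(2) Mc[OF p(3)] by (metis right_inverse)
    qed
    moreover have MM': "M \<subseteq> M'"
    proof
      fix p assume "p \<in> M"
      then show "p \<in> M'" using memI[of "fst p" "snd p" 0] Mc[of "fst p" "snd p"] by (cases p) auto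
    qed
    ultimately have "M' = M" using max GM by (auto simp: A_def)
    moreover have "(x, c) \<in> M'" using memI[OF one, of 1] x by (simp add: int_pow_1)
    ultimately show ?thesis by blast
  qed
  define h where "h x = (THE c. (x, c) \<in> M)" for x
  have h: "h x = c" if "(x, c) \<in> M" for x c using that Mu by (auto simp: h_def)
  have "h \<in> hom G complex_units"
  proof (rule homI)
    show "h x \<in> carrier complex_units" if "x \<in> carrier G" for x
      using dom[OF that] h Mc by auto
    show "h (x \<otimes> y) = h x \<otimes>\<^bsub>complex_units\<^esub> h y" if "x \<in> carrier G" "y \<in> carrier G" for x y
      using dom[OF that(1)] dom[OF that(2)] h Mm by (metis mult_group_simps(2))
  qed
  then show ?thesis using h GM by blast
qed

section \<open>Homomorphisms and finite products in abelian groups\<close>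

lemma (in comm_group) inv_finprod:
  "f \<in> A \<rightarrow> carrier G \<Longrightarrow> inv (finprod G f A) = finprod G (\<lambda>x. inv f x) A"
proof (induction A rule: infinite_finite_induct)
  case (insert a A)
  then have "f \<in> A \<rightarrow> carrier G" "f a \<in> carrier G" by auto
  with insert show ?case by (simp add: inv_mult Pi_def)
qed auto

lemma comm_monoid_hom_finprod:
  assumes "comm_monoid G" "comm_monoid H" "h \<in> hom G H" "h \<one>\<^bsub>G\<^esub> = \<one>\<^bsub>H\<^esub>" "f \<in> A \<rightarrow> carrier G"
  shows "h (finprod G f A) = finprod H (\<lambda>x. h (f x)) A"
proof -
  interpret G: comm_monoid G by fact
  interpret H: comm_monoid H by fact
  show ?thesis using assms(5)
  proof (induction A rule: infinite_finite_induct)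
    case (insert a A)
    then have "f \<in> A \<rightarrow> carrier G" "f a \<in> carrier G" by auto
    with insert show ?case using assms(3) by (auto simp: hom_def Pi_def)
  qed (use assms in auto)
qed

lemma (in comm_group) additive_finprod:
  fixes h :: "'a \<Rightarrow> 'c::ab_group_add"
  assumes h: "\<And>x y. x \<in> carrier G \<Longrightarrow> y \<in> carrier G \<Longrightarrow> h (x \<otimes> y) = h x + h y"
    and "finite A" "f \<in> A \<rightarrow> carrier G"
  shows "h (finprod G f A) = (\<Sum>x\<in>A. h (f x))"
  using assms(2,3)
proof (induction A rule: finite_induct)
  case empty then show ?case using h[of \<one> \<one>] by simp
next
  case (insert a A)
  then have "f \<in> A \<rightarrow> carrier G" "f a \<in> carrier G" by auto
  with insert show ?case by (simp add: h)
qed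

lemma (in group) subgroup_finprod:
  assumes "comm_group G" "subgroup H G" "f \<in> A \<rightarrow> H" shows "finprod G f A \<in> H"
proof -
  interpret comm_group G by fact
  interpret H: subgroup H G by fact
  show ?thesis using assms(3)
  proof (induction A rule: infinite_finite_induct)
    case (insert a A)
    then have "f \<in> A \<rightarrow> carrier G" "f a \<in> carrier G" "finprod G f A \<in> H" "f a \<in> H"
      using H.subset by (auto simp: Pi_def)
    with insert show ?case by (simp add: H.m_closed)
  qed auto
qed

lemma finprod_complex_units:
  "(\<And>x. x \<in> A \<Longrightarrow> f x \<noteq> 0) \<Longrightarrow> finprod (mult_group UNIV) f A = (\<Prod>x\<in>A. f x :: 'a::field)"
proof (induction A rule: infinite_finite_induct)
  case (insert a A)
  then show ?case by (subst units.finprod_insert) (auto simp: Pi_def)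
qed auto

section \<open>Cycles and cocycles of a group acting on a lattice\<close>

text \<open>The model is the Weil group of \<open>F\<close> acting on cocharacters. The Weil group
  of the splitting field enters only through its cosets: \<open>rep g\<close> represents the coset
  of \<open>g\<close>, and \<open>act_rep\<close> encodes that this subgroup acts trivially.
  \<open>lift\<close> is what freeness of the lattice is used for.\<close>

locale lattice_with_degree = L: comm_group L + W: group W
  for L :: "('x, 'r) monoid_scheme" and W :: "('g, 's) monoid_scheme" +
  fixes act :: "'g \<Rightarrow> 'x \<Rightarrow> 'x" and deg :: "'g \<Rightarrow> int" and Fr :: 'g and R :: "'g set"
    and rep :: "'g \<Rightarrow> 'g"
  assumes act_hom: "g \<in> carrier W \<Longrightarrow> act g \<in> hom L L"
    and act_one: "x \<in> carrier L \<Longrightarrow> act \<one>\<^bsub>W\<^esub> x = x"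
    and act_mult: "g \<in> carrier W \<Longrightarrow> h \<in> carrier W \<Longrightarrow> x \<in> carrier L \<Longrightarrow>
      act (g \<otimes>\<^bsub>W\<^esub> h) x = act g (act h x)"
    and deg_mult: "g \<in> carrier W \<Longrightarrow> h \<in> carrier W \<Longrightarrow> deg (g \<otimes>\<^bsub>W\<^esub> h) = deg g + deg h"
    and Fr: "Fr \<in> carrier W" "deg Fr = 1"
    and R: "finite R" "R \<noteq> {}" "R \<subseteq> carrier W"
    and rep: "g \<in> carrier W \<Longrightarrow> rep g \<in> R"
    and act_rep: "g \<in> carrier W \<Longrightarrow> x \<in> carrier L \<Longrightarrow> act (rep g) x = act g x"
    and bij_rep: "w \<in> carrier W \<Longrightarrow> bij_betw (\<lambda>r. rep (r \<otimes>\<^bsub>W\<^esub> w)) R R"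
    and lift: "u \<in> hom L complex_units \<Longrightarrow>
      \<exists>f. (\<forall>x\<in>carrier L. \<forall>y\<in>carrier L. f (x \<otimes>\<^bsub>L\<^esub> y) = f x + f y) \<and> (\<forall>x\<in>carrier L. u x = exp (f x))"
begin

lemma act_closed [simp]: "g \<in> carrier W \<Longrightarrow> x \<in> carrier L \<Longrightarrow> act g x \<in> carrier L"
  using act_hom by (auto simp: hom_def)

lemma act_mult_L: "g \<in> carrier W \<Longrightarrow> x \<in> carrier L \<Longrightarrow> y \<in> carrier L \<Longrightarrow>
    act g (x \<otimes>\<^bsub>L\<^esub> y) = act g x \<otimes>\<^bsub>L\<^esub> act g y"
  using act_hom by (auto simp: hom_def)

lemma act_group_hom: "g \<in> carrier W \<Longrightarrow> group_hom L L (act g)"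
  by (simp add: group_hom_def group_hom_axioms_def L.is_group act_hom)

lemma act_inv_L: "g \<in> carrier W \<Longrightarrow> x \<in> carrier L \<Longrightarrow> act g (inv\<^bsub>L\<^esub> x) = inv\<^bsub>L\<^esub> act g x"
  using group_hom.hom_inv[OF act_group_hom] .

lemma act_one_L [simp]: "g \<in> carrier W \<Longrightarrow> act g \<one>\<^bsub>L\<^esub> = \<one>\<^bsub>L\<^esub>"
  using group_hom.hom_one[OF act_group_hom] .

lemma act_inv_act [simp]: "g \<in> carrier W \<Longrightarrow> x \<in> carrier L \<Longrightarrow> act g (act (inv\<^bsub>W\<^esub> g) x) = x"
  and act_act_inv [simp]: "g \<in> carrier W \<Longrightarrow> x \<in> carrier L \<Longrightarrow> act (inv\<^bsub>W\<^esub> g) (act g x) = x"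
  using act_mult[of g "inv\<^bsub>W\<^esub> g" x] act_mult[of "inv\<^bsub>W\<^esub> g" g x] act_one by auto

lemma deg_one [simp]: "deg \<one>\<^bsub>W\<^esub> = 0"
  using deg_mult[of "\<one>\<^bsub>W\<^esub>" "\<one>\<^bsub>W\<^esub>"] by simp

lemma deg_inv [simp]: "g \<in> carrier W \<Longrightarrow> deg (inv\<^bsub>W\<^esub> g) = - deg g"
  using deg_mult[of g "inv\<^bsub>W\<^esub> g"] by simp

text \<open>\<open>W\<close> is generated by \<open>Fr\<close> and the elements of degree 0. The
  Frobenius step is an equivalence because the induction over the integers runs upwards and
  downwards.\<close>

lemma degree_induct [consumes 1, case_names zero Fr]:
  assumes "g \<in> carrier W" and 0: "\<And>g. g \<in> carrier W \<Longrightarrow> deg g = 0 \<Longrightarrow> P g"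
    and Frob: "\<And>g. g \<in> carrier W \<Longrightarrow> P (Fr \<otimes>\<^bsub>W\<^esub> g) \<longleftrightarrow> P g"
  shows "P g"
proof -
  have "\<forall>g\<in>carrier W. deg g = n \<longrightarrow> P g" for n
  proof (induction n rule: int_induct[where k = 0])
    case base then show ?case using 0 by blast
  next
    case (step1 n)
    show ?case
    proof (intro ballI impI)
      fix g assume g: "g \<in> carrier W" "deg g = n + 1"
      define h where "h = inv\<^bsub>W\<^esub> Fr \<otimes>\<^bsub>W\<^esub> g"
      have h: "h \<in> carrier W" "deg h = n" "Fr \<otimes>\<^bsub>W\<^esub> h = g"
        using g Fr by (auto simp: h_def deg_mult simp flip: W.m_assoc)
      then show "P g" using Frob[of h] step1 by auto
    qed
  next
    case (step2 n)
    show ?case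
    proof (intro ballI impI)
      fix g assume g: "g \<in> carrier W" "deg g = n - 1"
      then have "P (Fr \<otimes>\<^bsub>W\<^esub> g)" using step2 Fr by (simp add: deg_mult)
      then show "P g" using Frob g by blast
    qed
  qed
  then show ?thesis using assms(1) by blast
qed

definition Nm :: "'x \<Rightarrow> 'x" where "Nm x = finprod L (\<lambda>r. act r x) R"

lemma Nm_closed [simp]: "x \<in> carrier L \<Longrightarrow> Nm x \<in> carrier L"
  unfolding Nm_def using R by (intro L.finprod_closed) auto

lemma Nm_mult: "x \<in> carrier L \<Longrightarrow> y \<in> carrier L \<Longrightarrow> Nm (x \<otimes>\<^bsub>L\<^esub> y) = Nm x \<otimes>\<^bsub>L\<^esub> Nm y"
proof -
  assume xy: "x \<in> carrier L" "y \<in> carrier L"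
  have "Nm (x \<otimes>\<^bsub>L\<^esub> y) = finprod L (\<lambda>r. act r x \<otimes>\<^bsub>L\<^esub> act r y) R"
    unfolding Nm_def using xy R by (intro L.finprod_cong') (auto simp: act_mult_L)
  also have "\<dots> = Nm x \<otimes>\<^bsub>L\<^esub> Nm y"
    unfolding Nm_def using xy R by (intro L.finprod_multf) auto
  finally show ?thesis .
qed

lemma Nm_hom: "Nm \<in> hom L L"
  by (auto simp: hom_def Nm_mult)

lemma Nm_group_hom: "group_hom L L Nm"
  by (simp add: group_hom_def group_hom_axioms_def L.is_group Nm_hom)

lemma Nm_one [simp]: "Nm \<one>\<^bsub>L\<^esub> = \<one>\<^bsub>L\<^esub>"
  using group_hom.hom_one[OF Nm_group_hom] .

lemma Nm_inv: "x \<in> carrier L \<Longrightarrow> Nm (inv\<^bsub>L\<^esub> x) = inv\<^bsub>L\<^esub> Nm x"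
  using group_hom.hom_inv[OF Nm_group_hom] .

text \<open>Right multiplication by \<open>w\<close> permutes the cosets represented by
  \<open>R\<close>, and the action of a group element sees only its coset; the product is merely
  reindexed.\<close>

lemma Nm_act [simp]:
  assumes w: "w \<in> carrier W" and x: "x \<in> carrier L" shows "Nm (act w x) = Nm x"
proof -
  have "Nm (act w x) = finprod L (\<lambda>r. act (rep (r \<otimes>\<^bsub>W\<^esub> w)) x) R"
    unfolding Nm_def using w x R by (intro L.finprod_cong') (auto simp: act_rep act_mult subset_iff)
  also have "\<dots> = finprod L (\<lambda>r. act r x) ((\<lambda>r. rep (r \<otimes>\<^bsub>W\<^esub> w)) ` R)"
    using bij_rep[OF w] x R by (intro L.finprod_reindex[symmetric]) (auto simp: bij_betw_def)
  also have "\<dots> = Nm x" using bij_rep[OF w] by (simp add: bij_betw_def Nm_def)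
  finally show ?thesis .
qed

text \<open>The boundary of the 1-chain \<open>[w] \<otimes> x\<close> in group homology, with the
  sign convention of \<open>one_cycle\<close>.\<close>

definition displacement :: "'g \<Rightarrow> 'x \<Rightarrow> 'x"
  where "displacement w x = act (inv\<^bsub>W\<^esub> w) x \<otimes>\<^bsub>L\<^esub> inv\<^bsub>L\<^esub> x"

lemma displacement_closed [simp]:
  "w \<in> carrier W \<Longrightarrow> x \<in> carrier L \<Longrightarrow> displacement w x \<in> carrier L"
  by (simp add: displacement_def)

lemma displacement_mult:
  "w \<in> carrier W \<Longrightarrow> x \<in> carrier L \<Longrightarrow> y \<in> carrier L \<Longrightarrow>
    displacement w (x \<otimes>\<^bsub>L\<^esub> y) = displacement w x \<otimes>\<^bsub>L\<^esub> displacement w y"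
  by (simp add: displacement_def act_mult_L L.inv_mult L.m_ac)

lemma displacement_inv:
  "w \<in> carrier W \<Longrightarrow> x \<in> carrier L \<Longrightarrow> displacement w (inv\<^bsub>L\<^esub> x) = inv\<^bsub>L\<^esub> displacement w x"
  by (simp add: displacement_def act_inv_L L.inv_mult)

lemma displacement_one [simp]: "w \<in> carrier W \<Longrightarrow> displacement w \<one>\<^bsub>L\<^esub> = \<one>\<^bsub>L\<^esub>"
  by (simp add: displacement_def)

text \<open>The degrees that the transfer of the cycle \<open>\<Sum>i<m. [w i] \<otimes> l i\<close> involves add up
  to \<open>\<Sum>i<m. deg (w i) * Nm (l i)\<close>, because all other terms cancel by the cycle condition.\<close>

lemma transfer_degree:
  fixes \<kappa> :: "'x \<Rightarrow> int"
  assumes \<kappa>: "\<And>x y. x \<in> carrier L \<Longrightarrow> y \<in> carrier L \<Longrightarrow> \<kappa> (x \<otimes>\<^bsub>L\<^esub> y) = \<kappa> x + \<kappa> y"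
    and wl: "\<And>i. i < m \<Longrightarrow> w i \<in> carrier W" "\<And>i. i < m \<Longrightarrow> l i \<in> carrier L"
    and cyc: "finprod L (\<lambda>i. displacement (w i) (l i)) {..<m::nat} = \<one>\<^bsub>L\<^esub>"
  shows "(\<Sum>i<m. \<Sum>r\<in>R. (deg (r \<otimes>\<^bsub>W\<^esub> w i) - deg (rep (r \<otimes>\<^bsub>W\<^esub> w i))) * \<kappa> (act r (l i))) =
    (\<Sum>i<m. deg (w i) * \<kappa> (Nm (l i)))"
proof -
  have \<kappa>1: "\<kappa> \<one>\<^bsub>L\<^esub> = 0" using \<kappa>[of "\<one>\<^bsub>L\<^esub>" "\<one>\<^bsub>L\<^esub>"] by simp
  have \<kappa>inv: "\<kappa> (inv\<^bsub>L\<^esub> x) = - \<kappa> x" if "x \<in> carrier L" for x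
    using \<kappa>[of x "inv\<^bsub>L\<^esub> x"] that \<kappa>1 by simp
  note \<kappa>fin = L.additive_finprod[where h = \<kappa>, OF \<kappa>]
  have RW: "r \<in> carrier W" if "r \<in> R" for r using R that by auto
  \<comment> \<open>Reindexing along the permutation of \<open>R\<close> replaces the degree of
    \<open>rep (r w)\<close> by that of \<open>r\<close>, at the price of moving \<open>l i\<close>
    to its image under the inverse of \<open>w i\<close>. Together with
    \<open>deg (r w) = deg r + deg w\<close> this makes a displacement appear.\<close>
  have shift: "(\<Sum>r\<in>R. deg (rep (r \<otimes>\<^bsub>W\<^esub> w i)) * \<kappa> (act r (l i))) =
      (\<Sum>r\<in>R. deg r * \<kappa> (act r (act (inv\<^bsub>W\<^esub> w i) (l i))))" if i: "i < m" for i
  proof -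
    have "\<kappa> (act r (l i)) = \<kappa> (act (rep (r \<otimes>\<^bsub>W\<^esub> w i)) (act (inv\<^bsub>W\<^esub> w i) (l i)))" if "r \<in> R" for r
      using wl[OF i] RW[OF that] by (simp add: act_rep act_mult)
    then have "(\<Sum>r\<in>R. deg (rep (r \<otimes>\<^bsub>W\<^esub> w i)) * \<kappa> (act r (l i))) =
      (\<Sum>r\<in>R. (\<lambda>r. deg r * \<kappa> (act r (act (inv\<^bsub>W\<^esub> w i) (l i)))) (rep (r \<otimes>\<^bsub>W\<^esub> w i)))"
      by simp
    also have "\<dots> = (\<Sum>r\<in>R. deg r * \<kappa> (act r (act (inv\<^bsub>W\<^esub> w i) (l i))))"
      by (rule sum.reindex_bij_betw[OF bij_rep]) (use wl i in auto)
    finally show ?thesis .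
  qed
  have inner: "(\<Sum>r\<in>R. (deg (r \<otimes>\<^bsub>W\<^esub> w i) - deg (rep (r \<otimes>\<^bsub>W\<^esub> w i))) * \<kappa> (act r (l i))) =
      deg (w i) * \<kappa> (Nm (l i)) - (\<Sum>r\<in>R. deg r * \<kappa> (act r (displacement (w i) (l i))))"
    if i: "i < m" for i
  proof -
    have "(\<Sum>r\<in>R. (deg (r \<otimes>\<^bsub>W\<^esub> w i) - deg (rep (r \<otimes>\<^bsub>W\<^esub> w i))) * \<kappa> (act r (l i))) =
      (\<Sum>r\<in>R. deg (w i) * \<kappa> (act r (l i))) + (\<Sum>r\<in>R. deg r * \<kappa> (act r (l i)))
       - (\<Sum>r\<in>R. deg (rep (r \<otimes>\<^bsub>W\<^esub> w i)) * \<kappa> (act r (l i)))"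
      using wl[OF i] RW by (simp add: deg_mult algebra_simps sum.distrib sum_subtractf cong: sum.cong)
    also have "(\<Sum>r\<in>R. deg (w i) * \<kappa> (act r (l i))) = deg (w i) * \<kappa> (Nm (l i))"
      unfolding Nm_def using R wl[OF i] by (subst \<kappa>fin) (auto simp: sum_distrib_left)
    also have "(\<Sum>r\<in>R. deg r * \<kappa> (act r (displacement (w i) (l i)))) =
       (\<Sum>r\<in>R. deg r * \<kappa> (act r (act (inv\<^bsub>W\<^esub> w i) (l i)))) - (\<Sum>r\<in>R. deg r * \<kappa> (act r (l i)))"
      using wl[OF i] RW
      by (simp add: displacement_def act_mult_L act_inv_L \<kappa> \<kappa>inv algebra_simps sum_subtractf sum_negf sum.distrib cong: sum.cong)
    ultimately show ?thesis using shift[OF i] by simp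
  qed
  \<comment> \<open>For fixed \<open>r\<close>, applying \<open>act r\<close> and then
    \<open>\<kappa>\<close> is additive, so the cycle condition kills the sum over \<open>i\<close>.
    The weights \<open>deg r\<close> do not depend on \<open>i\<close>, hence the swap of sums
    below.\<close>
  have "(\<Sum>i<m. \<kappa> (act r (displacement (w i) (l i)))) = 0" if r: "r \<in> R" for r
  proof -
    have "(\<Sum>i<m. \<kappa> (act r (displacement (w i) (l i)))) =
        \<kappa> (finprod L (\<lambda>i. act r (displacement (w i) (l i))) {..<m})"
      using wl RW[OF r] by (subst \<kappa>fin) auto
    also have "finprod L (\<lambda>i. act r (displacement (w i) (l i))) {..<m} =
        act r (finprod L (\<lambda>i. displacement (w i) (l i)) {..<m})"
      using wl RW[OF r] by (intro comm_monoid_hom_finprod[symmetric] L.comm_monoid_axioms act_hom) auto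
    also have "\<kappa> \<dots> = 0" using cyc RW[OF r] \<kappa>1 by simp
    finally show ?thesis .
  qed
  then have "(\<Sum>r\<in>R. \<Sum>i<m. deg r * \<kappa> (act r (displacement (w i) (l i)))) = 0"
    by (simp flip: sum_distrib_left)
  then have "(\<Sum>i<m. \<Sum>r\<in>R. deg r * \<kappa> (act r (displacement (w i) (l i)))) = 0"
    by (subst sum.swap)
  then show ?thesis using inner by (simp add: sum_subtractf)
qed

end

lemma (in comm_group) quotient_cancel:
  assumes "p \<in> carrier G" "q \<in> carrier G" "y \<in> carrier G"
  shows "p \<otimes> inv q \<otimes> inv (y \<otimes> inv q) = p \<otimes> inv y"
proof -
  have "inv q \<otimes> (q \<otimes> inv y) = inv y" using assms by (simp flip: m_assoc)
  moreover have "inv (y \<otimes> inv q) = q \<otimes> inv y" using assms by (simp add: inv_mult m_comm)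
  ultimately show ?thesis using assms by (simp add: m_assoc)
qed

section \<open>Cocycles that become unramified after a twist\<close>

context lattice_with_degree
begin

text \<open>The cocycle identity for the contragredient action on characters of \<open>L\<close>,
  written out at lattice elements so that no dual group has to be carried along.\<close>

definition cocycle :: "('g \<Rightarrow> 'x \<Rightarrow> complex) \<Rightarrow> bool"
  where "cocycle z \<longleftrightarrow> (\<forall>g\<in>carrier W. z g \<in> hom L complex_units) \<and>
    (\<forall>g\<in>carrier W. \<forall>h\<in>carrier W. \<forall>x\<in>carrier L.
      z (g \<otimes>\<^bsub>W\<^esub> h) x = z g x * z h (act (inv\<^bsub>W\<^esub> g) x))"

lemma cocycle_nonzero: "cocycle z \<Longrightarrow> g \<in> carrier W \<Longrightarrow> x \<in> carrier L \<Longrightarrow> z g x \<noteq> 0"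
  by (auto simp: cocycle_def hom_def)

lemma cocycle_mult_L: "cocycle z \<Longrightarrow> g \<in> carrier W \<Longrightarrow> x \<in> carrier L \<Longrightarrow> y \<in> carrier L \<Longrightarrow>
    z g (x \<otimes>\<^bsub>L\<^esub> y) = z g x * z g y"
  by (auto simp: cocycle_def hom_def)

lemma cocycle_group_hom: "cocycle z \<Longrightarrow> g \<in> carrier W \<Longrightarrow> group_hom L complex_units (z g)"
  by (simp add: cocycle_def group_hom_def group_hom_axioms_def L.is_group units.is_group)

lemma cocycle_inv_L: "cocycle z \<Longrightarrow> g \<in> carrier W \<Longrightarrow> x \<in> carrier L \<Longrightarrow>
    z g (inv\<^bsub>L\<^esub> x) = inverse (z g x)"
  using group_hom.hom_inv[OF cocycle_group_hom] cocycle_nonzero by simp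

lemma cocycle_one_L: "cocycle z \<Longrightarrow> g \<in> carrier W \<Longrightarrow> z g \<one>\<^bsub>L\<^esub> = 1"
  using group_hom.hom_one[OF cocycle_group_hom] by simp

text \<open>The graph of a homomorphism \<open>m\<close> with \<open>m (displacement g x) = z g x\<close>, which exhibits \<open>z g\<close>
  as a coboundary on the elements of degree \<open>0\<close>, and \<open>z Fr\<close> as one on the kernel of the norm.\<close>

definition trivializing_graph :: "('g \<Rightarrow> 'x \<Rightarrow> complex) \<Rightarrow> ('x \<times> complex) set \<Rightarrow> bool"
  where "trivializing_graph z \<Gamma> \<longleftrightarrow>
    subgroup \<Gamma> (L \<times>\<times> complex_units) \<and> (\<forall>c. (\<one>\<^bsub>L\<^esub>, c) \<in> \<Gamma> \<longrightarrow> c = 1) \<and>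
    (\<forall>g\<in>carrier W. deg g = 0 \<longrightarrow> (\<forall>x\<in>carrier L. (displacement g x, z g x) \<in> \<Gamma>)) \<and>
    (\<forall>x\<in>carrier L. Nm x = \<one>\<^bsub>L\<^esub> \<longrightarrow> (displacement Fr x, z Fr x) \<in> \<Gamma>)"

lemma cocycle_cohomologous_unramified:
  assumes z: "cocycle z" and \<Gamma>: "trivializing_graph z \<Gamma>"
  shows "\<exists>m\<in>hom L complex_units. \<exists>f. (\<forall>x\<in>carrier L. \<forall>y\<in>carrier L. f (x \<otimes>\<^bsub>L\<^esub> y) = f x + f y) \<and>
    (\<forall>g\<in>carrier W. \<forall>x\<in>carrier L.
      z g x = exp (of_int (deg g) * f (Nm x)) * m (act (inv\<^bsub>W\<^esub> g) x) / m x)"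
proof -
  have sub: "subgroup \<Gamma> (L \<times>\<times> complex_units)" and triv: "\<And>c. (\<one>\<^bsub>L\<^esub>, c) \<in> \<Gamma> \<Longrightarrow> c = 1"
    and \<Gamma>0: "\<And>g x. g \<in> carrier W \<Longrightarrow> deg g = 0 \<Longrightarrow> x \<in> carrier L \<Longrightarrow> (displacement g x, z g x) \<in> \<Gamma>"
    and \<Gamma>F: "\<And>x. x \<in> carrier L \<Longrightarrow> Nm x = \<one>\<^bsub>L\<^esub> \<Longrightarrow> (displacement Fr x, z Fr x) \<in> \<Gamma>"
    using \<Gamma> by (auto simp: trivializing_graph_def)
  obtain m where m: "m \<in> hom L complex_units" and m\<Gamma>': "\<forall>(x, c)\<in>\<Gamma>. m x = c"
    using L.character_extension[OF sub triv] by blast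
  have m\<Gamma>: "m x = c" if "(x, c) \<in> \<Gamma>" for x c using m\<Gamma>' that by auto
  interpret m: group_hom L complex_units m
    by (simp add: m group_hom_def group_hom_axioms_def L.is_group units.is_group)
  have m0: "m x \<noteq> 0" if "x \<in> carrier L" for x using m.hom_closed[OF that] by simp
  have mdisp: "m (displacement g x) = m (act (inv\<^bsub>W\<^esub> g) x) / m x" if "g \<in> carrier W" "x \<in> carrier L" for g x
    using that m0 by (simp add: displacement_def field_simps)
  \<comment> \<open>\<open>z\<close> divided by the coboundary of \<open>m\<close>. What remains is
    trivial in degree 0, and its value at \<open>Fr\<close> is trivial on the kernel of
    \<open>Nm\<close>.\<close>
  define z' where "z' g x = z g x * m x / m (act (inv\<^bsub>W\<^esub> g) x)" for g x
  have z'nz: "z' g x \<noteq> 0" if "g \<in> carrier W" "x \<in> carrier L" for g x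
    using that m0 cocycle_nonzero[OF z] by (simp add: z'_def)
  have z'mult: "z' (g \<otimes>\<^bsub>W\<^esub> h) x = z' g x * z' h (act (inv\<^bsub>W\<^esub> g) x)"
    if "g \<in> carrier W" "h \<in> carrier W" "x \<in> carrier L" for g h x
  proof -
    have "z (g \<otimes>\<^bsub>W\<^esub> h) x = z g x * z h (act (inv\<^bsub>W\<^esub> g) x)"
      using z that by (auto simp: cocycle_def)
    then show ?thesis using that m0 by (simp add: z'_def W.inv_mult_group act_mult field_simps)
  qed
  have z'L: "z' g (x \<otimes>\<^bsub>L\<^esub> y) = z' g x * z' g y"
    if "g \<in> carrier W" "x \<in> carrier L" "y \<in> carrier L" for g x y
    using that m0 by (simp add: z'_def cocycle_mult_L[OF z] act_mult_L)
  have z'0: "z' g x = 1" if "g \<in> carrier W" "deg g = 0" "x \<in> carrier L" for g x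
    using m\<Gamma>[OF \<Gamma>0[OF that]] mdisp[of g x] that m0 cocycle_nonzero[OF z] by (simp add: z'_def field_simps)
  have z'F: "z' Fr x = 1" if "x \<in> carrier L" "Nm x = \<one>\<^bsub>L\<^esub>" for x
    using m\<Gamma>[OF \<Gamma>F[OF that]] mdisp[of Fr x] that m0 Fr cocycle_nonzero[OF z] by (simp add: z'_def field_simps)
  \<comment> \<open>The graph of \<open>Nm x \<mapsto> z' Fr x\<close>, single-valued by
    \<open>z'F\<close>. It is a character of the image of \<open>Nm\<close> only; a second extension
    is needed because \<open>lift\<close> takes logarithms of characters of all of
    \<open>L\<close>.\<close>
  define \<Delta> where "\<Delta> = (\<lambda>x. (Nm x, z' Fr x)) ` carrier L"
  have sub: "subgroup \<Delta> (L \<times>\<times> complex_units)"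
  proof -
    have h: "(\<lambda>x. (Nm x, z' Fr x)) \<in> hom L (L \<times>\<times> complex_units)"
      using Fr z'nz by (auto simp: hom_def Nm_mult z'L)
    interpret group_hom L "L \<times>\<times> complex_units" "\<lambda>x. (Nm x, z' Fr x)"
      by (simp add: h group_hom_def group_hom_axioms_def L.is_group DirProd_group units.is_group)
    show ?thesis unfolding \<Delta>_def by (rule img_is_subgroup)
  qed
  have triv: "c = 1" if "(\<one>\<^bsub>L\<^esub>, c) \<in> \<Delta>" for c
    using that z'F by (auto simp: \<Delta>_def)
  obtain u where u: "u \<in> hom L complex_units" and u\<Delta>': "\<forall>(x, c)\<in>\<Delta>. u x = c"
    using L.character_extension[OF sub triv] by blast
  have u\<Delta>: "u x = c" if "(x, c) \<in> \<Delta>" for x c using u\<Delta>' that by auto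
  obtain f where f: "\<forall>x\<in>carrier L. \<forall>y\<in>carrier L. f (x \<otimes>\<^bsub>L\<^esub> y) = f x + f y"
    and uf: "\<And>x. x \<in> carrier L \<Longrightarrow> u x = exp (f x)"
    using lift[OF u] by blast
  have F: "z' Fr x = exp (f (Nm x))" if "x \<in> carrier L" for x
    using u\<Delta>[of "Nm x" "z' Fr x"] uf[of "Nm x"] that by (auto simp: \<Delta>_def)
  \<comment> \<open>The Frobenius that the cocycle identity applies to \<open>x\<close> is absorbed
    by \<open>Nm\<close>, so every factor \<open>Fr\<close> contributes the same
    \<open>exp (f (Nm x))\<close>.\<close>
  have "\<forall>x\<in>carrier L. z' g x = exp (of_int (deg g) * f (Nm x))" if "g \<in> carrier W" for g
    using that
  proof (induction g rule: degree_induct)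
    case (zero g) then show ?case using z'0 by simp
  next
    case (Fr g)
    have e: "z' (Fr \<otimes>\<^bsub>W\<^esub> g) x = exp (f (Nm x)) * z' g (act (inv\<^bsub>W\<^esub> Fr) x)" if "x \<in> carrier L" for x
      using z'mult[of Fr g x] F that Fr lattice_with_degree.Fr[OF lattice_with_degree_axioms] by simp
    have e2: "exp (of_int (deg (Fr \<otimes>\<^bsub>W\<^esub> g)) * f (Nm x)) = exp (f (Nm x)) * exp (of_int (deg g) * f (Nm x))" for x
      using Fr lattice_with_degree.Fr[OF lattice_with_degree_axioms] by (simp add: deg_mult ring_distribs exp_add)
    have FW: "Fr \<in> carrier W" by (rule lattice_with_degree.Fr[OF lattice_with_degree_axioms])
    have iff: "(z' (Fr \<otimes>\<^bsub>W\<^esub> g) x = exp (of_int (deg (Fr \<otimes>\<^bsub>W\<^esub> g)) * f (Nm x))) \<longleftrightarrow>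
      z' g (act (inv\<^bsub>W\<^esub> Fr) x) = exp (of_int (deg g) * f (Nm (act (inv\<^bsub>W\<^esub> Fr) x)))"
      if "x \<in> carrier L" for x using that e e2 FW by simp
    show ?case
    proof
      assume a: "\<forall>x\<in>carrier L. z' (Fr \<otimes>\<^bsub>W\<^esub> g) x = exp (of_int (deg (Fr \<otimes>\<^bsub>W\<^esub> g)) * f (Nm x))"
      show "\<forall>x\<in>carrier L. z' g x = exp (of_int (deg g) * f (Nm x))"
      proof
        fix x assume "x \<in> carrier L"
        then show "z' g x = exp (of_int (deg g) * f (Nm x))"
          using iff[of "act Fr x"] a FW by simp
      qed
    qed (use iff FW in auto)
  qed
  then have "z g x = exp (of_int (deg g) * f (Nm x)) * m (act (inv\<^bsub>W\<^esub> g) x) / m x"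
    if "g \<in> carrier W" "x \<in> carrier L" for g x
    using that m0 unfolding z'_def by (fastforce simp: field_simps)
  then show ?thesis using m f by blast
qed

text \<open>Chains made of the pairs on which \<open>trivializing_graph\<close> prescribes a value;
  the cycle condition is imposed separately. The alternative for each \<open>i\<close> is what makes
  the \<open>i\<close>-th term \<open>deg (w i) * \<kappa> (Nm (l i))\<close> in
  \<open>transfer_degree\<close> vanish.\<close>

definition admissible_cycle :: "nat \<Rightarrow> (nat \<Rightarrow> 'g) \<Rightarrow> (nat \<Rightarrow> 'x) \<Rightarrow> bool"
  where "admissible_cycle n w l \<longleftrightarrow>
    (\<forall>i<n. w i \<in> carrier W \<and> l i \<in> carrier L \<and> (deg (w i) = 0 \<or> Nm (l i) = \<one>\<^bsub>L\<^esub>))"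

text \<open>Take all pairs of the boundary of an admissible chain and its pairing with
  \<open>z\<close>. Concatenating chains multiplies both entries and inverting the
  \<open>l i\<close> inverts both, so this is a subgroup. Over the identity the chain is a cycle,
  where the assumption applies.\<close>

lemma trivializing_graph_if_cycles:
  assumes z: "cocycle z"
    and cyc: "\<And>n w l. admissible_cycle n w l \<Longrightarrow>
      finprod L (\<lambda>i. displacement (w i) (l i)) {..<n} = \<one>\<^bsub>L\<^esub> \<Longrightarrow> (\<Prod>i<n. z (w i) (l i)) = 1"
  shows "\<exists>\<Gamma>. trivializing_graph z \<Gamma>"
proof -
  define bd where "bd n w l = finprod L (\<lambda>i. displacement (w i) (l i)) {..<n::nat}" for n w l
  define ev where "ev n w l = (\<Prod>i<n::nat. z (w i) (l i))" for n w l
  define \<Gamma> where "\<Gamma> = {(bd n w l, ev n w l) | n w l. admissible_cycle n w l}"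
  have mem: "(bd n w l, ev n w l) \<in> \<Gamma>" if "admissible_cycle n w l" for n w l
    using that by (auto simp: \<Gamma>_def)
  let ?P = "L \<times>\<times> complex_units"
  interpret P: group ?P by (intro DirProd_group L.is_group units.is_group)
  have disp: "(\<lambda>i. displacement (w i) (l i)) \<in> {..<n} \<rightarrow> carrier L" if "admissible_cycle n w l" for n w l
    using that by (auto simp: admissible_cycle_def)
  have nz: "z (w i) (l i) \<noteq> 0" if "admissible_cycle n w l" "i < n" for n w l i
    using that cocycle_nonzero[OF z] by (auto simp: admissible_cycle_def)
  have "subgroup \<Gamma> ?P"
  proof (rule P.subgroupI)
    show "\<Gamma> \<subseteq> carrier ?P"
      using disp nz by (auto simp: \<Gamma>_def bd_def ev_def intro!: L.finprod_closed)
    have "admissible_cycle 0 w l" for w l by (simp add: admissible_cycle_def)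
    then show "\<Gamma> \<noteq> {}" using mem by blast
    fix p assume "p \<in> \<Gamma>"
    then obtain n w l where p: "p = (bd n w l, ev n w l)" and a: "admissible_cycle n w l"
      by (auto simp: \<Gamma>_def)
    have a': "admissible_cycle n w (\<lambda>i. inv\<^bsub>L\<^esub> l i)"
      using a by (auto simp: admissible_cycle_def Nm_inv)
    have "bd n w (\<lambda>i. inv\<^bsub>L\<^esub> l i) = inv\<^bsub>L\<^esub> bd n w l"
      unfolding bd_def L.inv_finprod[OF disp[OF a]] using a
      by (intro L.finprod_cong') (auto simp: admissible_cycle_def displacement_inv)
    moreover have "ev n w (\<lambda>i. inv\<^bsub>L\<^esub> l i) = inverse (ev n w l)"
      unfolding ev_def prod_inversef[symmetric] o_def using a
      by (intro prod.cong) (auto simp: admissible_cycle_def cocycle_inv_L[OF z])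
    moreover have "bd n w l \<in> carrier L" "ev n w l \<noteq> 0"
      using disp[OF a] nz[OF a] by (auto simp: bd_def ev_def intro!: L.finprod_closed)
    ultimately have "inv\<^bsub>?P\<^esub> p = (bd n w (\<lambda>i. inv\<^bsub>L\<^esub> l i), ev n w (\<lambda>i. inv\<^bsub>L\<^esub> l i))"
      by (simp add: p L.is_group units.is_group)
    then show "inv\<^bsub>?P\<^esub> p \<in> \<Gamma>" using mem[OF a'] by simp
    fix p' assume "p' \<in> \<Gamma>"
    then obtain n' w' l' where p': "p' = (bd n' w' l', ev n' w' l')" and a': "admissible_cycle n' w' l'"
      by (auto simp: \<Gamma>_def)
    define w2 l2 where "w2 i = (if i < n then w i else w' (i - n))"
      and "l2 i = (if i < n then l i else l' (i - n))" for i
    have a2: "admissible_cycle (n + n') w2 l2"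
      using a a' by (auto simp: admissible_cycle_def w2_def l2_def)
    have split: "{..<n + n'} = {..<n} \<union> (\<lambda>i. n + i) ` {..<n'}"
    proof -
      have "i \<in> (\<lambda>i. n + i) ` {..<n'}" if "i < n + n'" "\<not> i < n" for i
        using that by (intro image_eqI[of _ _ "i - n"]) auto
      then show ?thesis by auto
    qed
    have "bd (n + n') w2 l2 = finprod L (\<lambda>i. displacement (w2 i) (l2 i)) {..<n} \<otimes>\<^bsub>L\<^esub>
        finprod L (\<lambda>i. displacement (w2 i) (l2 i)) ((\<lambda>i. n + i) ` {..<n'})"
      unfolding bd_def split using disp[OF a2] by (intro L.finprod_Un_disjoint) auto
    also have "finprod L (\<lambda>i. displacement (w2 i) (l2 i)) {..<n} = bd n w l"
      unfolding bd_def using disp[OF a] by (intro L.finprod_cong') (auto simp: w2_def l2_def)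
    also have "finprod L (\<lambda>i. displacement (w2 i) (l2 i)) ((\<lambda>i. n + i) ` {..<n'}) = 
       finprod L (\<lambda>i. displacement (w2 (n + i)) (l2 (n + i))) {..<n'}"
      using disp[OF a2] by (intro L.finprod_reindex) auto
    also have "\<dots> = bd n' w' l'"
      unfolding bd_def using disp[OF a'] by (intro L.finprod_cong') (auto simp: w2_def l2_def)
    finally have "bd (n + n') w2 l2 = bd n w l \<otimes>\<^bsub>L\<^esub> bd n' w' l'" .
    moreover have "ev (n + n') w2 l2 = ev n w l * ev n' w' l'"
      unfolding ev_def split
      by (subst prod.union_disjoint) (auto simp: prod.reindex w2_def l2_def)
    ultimately have "p \<otimes>\<^bsub>?P\<^esub> p' = (bd (n + n') w2 l2, ev (n + n') w2 l2)"
      by (simp add: p p')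
    then show "p \<otimes>\<^bsub>?P\<^esub> p' \<in> \<Gamma>" using mem[OF a2] by simp
  qed
  moreover have "c = 1" if "(\<one>\<^bsub>L\<^esub>, c) \<in> \<Gamma>" for c
    using that cyc by (auto simp: \<Gamma>_def bd_def ev_def)
  moreover have "(displacement g x, z g x) \<in> \<Gamma>"
    if "g \<in> carrier W" "x \<in> carrier L" "deg g = 0 \<or> Nm x = \<one>\<^bsub>L\<^esub>" for g x
  proof -
    have "{..<1::nat} = {0}" by auto
    then have "bd 1 (\<lambda>_. g) (\<lambda>_. x) = displacement g x" "ev 1 (\<lambda>_. g) (\<lambda>_. x) = z g x"
      using that by (auto simp: bd_def ev_def)
    then show ?thesis using mem[of 1 "\<lambda>_. g" "\<lambda>_. x"] that by (simp add: admissible_cycle_def)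
  qed
  ultimately show ?thesis using Fr unfolding trivializing_graph_def by blast
qed

text \<open>The quotient of \<open>L\<close> by this subgroup is the group of inertia coinvariants,
  whose characters are the inertia-fixed points of the dual.\<close>

definition augmentation :: "'x set"
  where "augmentation = generate L {displacement g x | g x. g \<in> carrier W \<and> deg g = 0 \<and> x \<in> carrier L}"

lemma augmentation_subgroup: "subgroup augmentation L"
  unfolding augmentation_def by (rule L.generate_is_subgroup) auto

lemma displacement_augmentation:
  "g \<in> carrier W \<Longrightarrow> deg g = 0 \<Longrightarrow> x \<in> carrier L \<Longrightarrow> displacement g x \<in> augmentation"
  unfolding augmentation_def by (rule generate.incl) blast

text \<open>The elements of degree 0 form a normal subgroup: moving \<open>act w\<close> past a
  displacement conjugates the group element by \<open>w\<close>.\<close>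

lemma act_augmentation:
  assumes w: "w \<in> carrier W" and "x \<in> augmentation" shows "act w x \<in> augmentation"
proof -
  have conj: "act w (displacement g x) \<in> augmentation" if g: "g \<in> carrier W" "deg g = 0" "x \<in> carrier L" for g x
  proof -
    let ?g = "w \<otimes>\<^bsub>W\<^esub> g \<otimes>\<^bsub>W\<^esub> inv\<^bsub>W\<^esub> w"
    have "act w (displacement g x) = displacement ?g (act w x)"
      using g w by (simp add: displacement_def act_mult_L act_inv_L W.inv_mult_group W.m_assoc flip: act_mult)
    then show ?thesis using displacement_augmentation[of ?g "act w x"] g w by (simp add: deg_mult)
  qed
  interpret A: subgroup augmentation L by (rule augmentation_subgroup)
  let ?D = "{displacement g x | g x. g \<in> carrier W \<and> deg g = 0 \<and> x \<in> carrier L}"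
  have "y \<in> augmentation \<and> act w y \<in> augmentation" if "y \<in> generate L ?D" for y
    using that
  proof (induction rule: generate.induct)
    case one then show ?case using w by simp
  next
    case (incl h) then show ?case using conj displacement_augmentation by auto
  next
    case (inv h)
    then obtain g x where h: "h = displacement g x" "g \<in> carrier W" "deg g = 0" "x \<in> carrier L" by blast
    then have "act w (inv\<^bsub>L\<^esub> h) = inv\<^bsub>L\<^esub> act w h" using w by (simp add: act_inv_L)
    then show ?case using conj[OF h(2-4)] displacement_augmentation[OF h(2-4)] h(1) by simp
  next
    case (eng h1 h2)
    then show ?case using w by (simp add: act_mult_L)
  qed
  then show ?thesis using assms(2) by (simp add: augmentation_def)
qed

text \<open>The graph assigns \<open>z Fr y\<close> to every element congruent to
  \<open>displacement Fr y\<close> modulo the augmentation. The point is uniqueness over the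
  identity: there \<open>y\<close> is fixed by Frobenius in the coinvariants, so \<open>Nm y\<close>
  is congruent to a power of \<open>y\<close>. As \<open>Nm y\<close> is trivial, \<open>y\<close>
  is torsion modulo the augmentation.\<close>

lemma trivializing_graph_if_torsion:
  assumes z: "cocycle z"
    and z0: "\<And>g x. g \<in> carrier W \<Longrightarrow> deg g = 0 \<Longrightarrow> x \<in> carrier L \<Longrightarrow> z g x = 1"
    and tors: "\<And>n x. x \<in> carrier L \<Longrightarrow> n > 0 \<Longrightarrow> x [^]\<^bsub>L\<^esub> (n::nat) \<in> augmentation \<Longrightarrow> z Fr x = 1"
  shows "\<exists>\<Gamma>. trivializing_graph z \<Gamma>"
proof -
  interpret A: subgroup augmentation L by (rule augmentation_subgroup)
  define \<Gamma> where "\<Gamma> = {(x, z Fr y) | x y. x \<in> carrier L \<and> y \<in> carrier L \<and> Nm y = \<one>\<^bsub>L\<^esub> \<and>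
      x \<otimes>\<^bsub>L\<^esub> inv\<^bsub>L\<^esub> displacement Fr y \<in> augmentation}"
  let ?P = "L \<times>\<times> complex_units"
  interpret P: group ?P by (intro DirProd_group L.is_group units.is_group)
  have FW: "Fr \<in> carrier W" by (rule Fr)
  have mem: "(x, z Fr y) \<in> \<Gamma>" if "x \<in> carrier L" "y \<in> carrier L" "Nm y = \<one>\<^bsub>L\<^esub>"
    "x \<otimes>\<^bsub>L\<^esub> inv\<^bsub>L\<^esub> displacement Fr y \<in> augmentation" for x y
    using that by (auto simp: \<Gamma>_def)
  have "subgroup \<Gamma> ?P"
  proof (rule P.subgroupI)
    show "\<Gamma> \<subseteq> carrier ?P" using cocycle_nonzero[OF z FW] by (auto simp: \<Gamma>_def)
    show "\<Gamma> \<noteq> {}" using mem[of "\<one>\<^bsub>L\<^esub>" "\<one>\<^bsub>L\<^esub>"] FW by auto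
    fix p assume "p \<in> \<Gamma>"
    then obtain x y where p: "p = (x, z Fr y)" and xy: "x \<in> carrier L" "y \<in> carrier L" "Nm y = \<one>\<^bsub>L\<^esub>"
      "x \<otimes>\<^bsub>L\<^esub> inv\<^bsub>L\<^esub> displacement Fr y \<in> augmentation" by (auto simp: \<Gamma>_def)
    have "(inv\<^bsub>L\<^esub> x, z Fr (inv\<^bsub>L\<^esub> y)) \<in> \<Gamma>"
    proof (rule mem)
      have "inv\<^bsub>L\<^esub> (x \<otimes>\<^bsub>L\<^esub> inv\<^bsub>L\<^esub> displacement Fr y) \<in> augmentation" using xy by blast
      then show "inv\<^bsub>L\<^esub> x \<otimes>\<^bsub>L\<^esub> inv\<^bsub>L\<^esub> displacement Fr (inv\<^bsub>L\<^esub> y) \<in> augmentation"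
        using xy FW by (simp add: displacement_inv L.inv_mult)
    qed (use xy in \<open>auto simp: Nm_inv\<close>)
    then show "inv\<^bsub>?P\<^esub> p \<in> \<Gamma>" using xy FW cocycle_nonzero[OF z]
      by (simp add: p cocycle_inv_L[OF z] L.is_group units.is_group)
    fix p' assume "p' \<in> \<Gamma>"
    then obtain x' y' where p': "p' = (x', z Fr y')" and xy': "x' \<in> carrier L" "y' \<in> carrier L" "Nm y' = \<one>\<^bsub>L\<^esub>"
      "x' \<otimes>\<^bsub>L\<^esub> inv\<^bsub>L\<^esub> displacement Fr y' \<in> augmentation" by (auto simp: \<Gamma>_def)
    have "(x \<otimes>\<^bsub>L\<^esub> x', z Fr (y \<otimes>\<^bsub>L\<^esub> y')) \<in> \<Gamma>"
    proof (rule mem)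
      have "(x \<otimes>\<^bsub>L\<^esub> inv\<^bsub>L\<^esub> displacement Fr y) \<otimes>\<^bsub>L\<^esub> (x' \<otimes>\<^bsub>L\<^esub> inv\<^bsub>L\<^esub> displacement Fr y') \<in> augmentation"
        using xy xy' by blast
      then show "x \<otimes>\<^bsub>L\<^esub> x' \<otimes>\<^bsub>L\<^esub> inv\<^bsub>L\<^esub> displacement Fr (y \<otimes>\<^bsub>L\<^esub> y') \<in> augmentation"
        using xy xy' FW by (simp add: displacement_mult L.inv_mult L.m_ac)
    qed (use xy xy' in \<open>auto simp: Nm_mult\<close>)
    then show "p \<otimes>\<^bsub>?P\<^esub> p' \<in> \<Gamma>" using xy xy' FW by (simp add: p p' cocycle_mult_L[OF z])
  qed
  moreover have "c = 1" if c: "(\<one>\<^bsub>L\<^esub>, c) \<in> \<Gamma>" for c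
  proof -
    obtain y where y: "y \<in> carrier L" "Nm y = \<one>\<^bsub>L\<^esub>" "c = z Fr y"
      "inv\<^bsub>L\<^esub> displacement Fr y \<in> augmentation"
      using c FW by (auto simp: \<Gamma>_def)
    have dF: "displacement Fr y \<in> augmentation" using A.m_inv_closed[OF y(4)] y FW by simp
    \<comment> \<open>\<open>y\<close> is fixed by \<open>Fr\<close> modulo the augmentation, and by
      degree 0 elements in any case, hence by all of \<open>W\<close>.\<close>
    have inA: "act g y \<otimes>\<^bsub>L\<^esub> inv\<^bsub>L\<^esub> y \<in> augmentation" if "g \<in> carrier W" for g
      using that
    proof (induction g rule: degree_induct)
      case (zero g)
      then show ?case using displacement_augmentation[of "inv\<^bsub>W\<^esub> g" y] y by (simp add: displacement_def)
    next
      case (Fr g)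
      have "act Fr (act g y \<otimes>\<^bsub>L\<^esub> inv\<^bsub>L\<^esub> y) = act Fr (act g y) \<otimes>\<^bsub>L\<^esub> inv\<^bsub>L\<^esub> act Fr y"
        using Fr y FW by (simp add: act_mult_L act_inv_L)
      moreover have "act Fr (displacement Fr y) = y \<otimes>\<^bsub>L\<^esub> inv\<^bsub>L\<^esub> act Fr y"
        using y FW by (simp add: displacement_def act_mult_L act_inv_L)
      ultimately have e: "act (Fr \<otimes>\<^bsub>W\<^esub> g) y \<otimes>\<^bsub>L\<^esub> inv\<^bsub>L\<^esub> y =
          act Fr (act g y \<otimes>\<^bsub>L\<^esub> inv\<^bsub>L\<^esub> y) \<otimes>\<^bsub>L\<^esub> inv\<^bsub>L\<^esub> act Fr (displacement Fr y)"
        using Fr y FW L.quotient_cancel[of "act Fr (act g y)" "act Fr y" y] by (simp add: act_mult)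
      have b: "inv\<^bsub>L\<^esub> act Fr (displacement Fr y) \<in> augmentation" "act Fr (displacement Fr y) \<in> augmentation"
        using act_augmentation[OF FW dF] by auto
      show ?case
      proof
        assume "act g y \<otimes>\<^bsub>L\<^esub> inv\<^bsub>L\<^esub> y \<in> augmentation"
        then show "act (Fr \<otimes>\<^bsub>W\<^esub> g) y \<otimes>\<^bsub>L\<^esub> inv\<^bsub>L\<^esub> y \<in> augmentation"
          unfolding e using act_augmentation[OF FW] b by blast
      next
        assume "act (Fr \<otimes>\<^bsub>W\<^esub> g) y \<otimes>\<^bsub>L\<^esub> inv\<^bsub>L\<^esub> y \<in> augmentation"
        then have "act Fr (act g y \<otimes>\<^bsub>L\<^esub> inv\<^bsub>L\<^esub> y) \<otimes>\<^bsub>L\<^esub> inv\<^bsub>L\<^esub> act Fr (displacement Fr y) \<otimes>\<^bsub>L\<^esub>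
            act Fr (displacement Fr y) \<in> augmentation"
          unfolding e using b by blast
        then have "act Fr (act g y \<otimes>\<^bsub>L\<^esub> inv\<^bsub>L\<^esub> y) \<in> augmentation"
          using Fr y FW by (simp add: L.m_assoc)
        from act_augmentation[OF W.inv_closed[OF FW] this]
        show "act g y \<otimes>\<^bsub>L\<^esub> inv\<^bsub>L\<^esub> y \<in> augmentation" using Fr y FW by simp
      qed
    qed
    \<comment> \<open>Multiplying these congruences over \<open>R\<close> compares
      \<open>Nm y\<close>, which is trivial, with the \<open>card R\<close>-th power of
      \<open>y\<close>.\<close>
    have "finprod L (\<lambda>r. act r y \<otimes>\<^bsub>L\<^esub> inv\<^bsub>L\<^esub> y) R \<in> augmentation"
      using inA R by (intro L.subgroup_finprod L.comm_group_axioms augmentation_subgroup) auto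
    moreover have "finprod L (\<lambda>r. act r y \<otimes>\<^bsub>L\<^esub> inv\<^bsub>L\<^esub> y) R = Nm y \<otimes>\<^bsub>L\<^esub> (inv\<^bsub>L\<^esub> y) [^]\<^bsub>L\<^esub> card R"
      unfolding Nm_def using R y by (subst L.finprod_multf) (auto simp: L.finprod_const)
    ultimately have "inv\<^bsub>L\<^esub> (y [^]\<^bsub>L\<^esub> card R) \<in> augmentation"
      using y by (simp add: L.nat_pow_inv)
    then have "y [^]\<^bsub>L\<^esub> card R \<in> augmentation"
      using A.m_inv_closed[of "inv\<^bsub>L\<^esub> (y [^]\<^bsub>L\<^esub> card R)"] y by simp
    moreover have "card R > 0" using R by (simp add: card_gt_0_iff)
    ultimately show "c = 1" using tors y by blast
  qed
  moreover have "(displacement g x, z g x) \<in> \<Gamma>" if "g \<in> carrier W" "deg g = 0" "x \<in> carrier L" for g x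
    using mem[of "displacement g x" "\<one>\<^bsub>L\<^esub>"] that FW z0[of g x] cocycle_one_L[OF z]
    by (simp add: displacement_augmentation)
  moreover have "(displacement Fr x, z Fr x) \<in> \<Gamma>" if "x \<in> carrier L" "Nm x = \<one>\<^bsub>L\<^esub>" for x
    using mem[of "displacement Fr x" x] that FW by simp
  ultimately show ?thesis unfolding trivializing_graph_def by blast
qed

end

section \<open>Non-archimedean absolute values\<close>

lemma finite_extension_self:
  assumes K: "subfield K field_of_type" shows "finite_extension K K"
proof -
  interpret field "field_of_type :: 'a ring" by (rule field_from_type_algebra)
  show ?thesis using K finite_dimensionI[OF dimension_one[OF K]]
    by (simp add: finite_extension_def)
qed

lemma subfield_facts:
  assumes "subfield K (field_of_type :: 'a::field ring)"
  shows "0 \<in> K" "1 \<in> K" "x \<in> K \<Longrightarrow> y \<in> K \<Longrightarrow> x + y \<in> K" "x \<in> K \<Longrightarrow> y \<in> K \<Longrightarrow> x * y \<in> K"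
    "x \<in> K \<Longrightarrow> - x \<in> K" "x \<in> K \<Longrightarrow> y \<in> K \<Longrightarrow> x - y \<in> K" "x \<in> K \<Longrightarrow> inverse x \<in> K"
    "x \<in> K \<Longrightarrow> y \<in> K \<Longrightarrow> x / y \<in> K" "x \<in> K \<Longrightarrow> x ^ n \<in> K" "x \<in> K \<Longrightarrow> x powi k \<in> K"
proof -
  interpret field "field_of_type :: 'a ring" by (rule field_from_type_algebra)
  note sr = subringE[OF subfieldE(1)[OF assms]]
  show z: "0 \<in> K" using sr(2) by (simp add: ring_of_type_algebra_def)
  show o: "1 \<in> K" using sr(3) by (simp add: ring_of_type_algebra_def)
  show add: "x + y \<in> K" if "x \<in> K" "y \<in> K" for x y
    using sr(7)[OF that] by (simp add: ring_of_type_algebra_def)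
  show mult: "x * y \<in> K" if "x \<in> K" "y \<in> K" for x y
    using sr(6)[OF that] by (simp add: ring_of_type_algebra_def)
  show neg: "- x \<in> K" if "x \<in> K" for x
  proof -
    have "\<ominus>\<^bsub>field_of_type\<^esub> x = - x"
      by (rule minus_equality) (auto simp: ring_of_type_algebra_def)
    then show ?thesis using sr(5)[OF that] by simp
  qed
  show "x - y \<in> K" if "x \<in> K" "y \<in> K" for x y
    using add[OF that(1) neg[OF that(2)]] by simp
  show inv: "inverse x \<in> K" if "x \<in> K" for x
  proof (cases "x = 0")
    case False
    then have xK: "x \<in> K - {\<zero>\<^bsub>field_of_type\<^esub>}" using that by (simp add: ring_of_type_algebra_def)
    have "inv\<^bsub>field_of_type\<^esub> x \<in> K" "x * inv\<^bsub>field_of_type\<^esub> x = 1"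
      using subfield_m_inv[OF assms xK] by (auto simp: ring_of_type_algebra_def)
    then show ?thesis using inverse_unique by metis
  qed (use z in simp)
  show "x / y \<in> K" if "x \<in> K" "y \<in> K" for x y
    using mult[OF that(1) inv[OF that(2)]] by (simp add: divide_inverse)
  show pow: "x ^ n \<in> K" if "x \<in> K" for x n using that by (induction n) (auto intro: o mult)
  show "x powi k \<in> K" if "x \<in> K" for x k
    using pow[OF that] pow[OF inv[OF that]] by (auto simp: power_int_def)
qed

locale nonarch =
  fixes v :: "'a::field \<Rightarrow> real"
  assumes nonarch_abs: "nonarch_abs v"
begin

lemma v_nonneg [simp]: "0 \<le> v x" and v_eq_0 [simp]: "v x = 0 \<longleftrightarrow> x = 0"
  and v_mult: "v (x * y) = v x * v y" and v_add: "v (x + y) \<le> max (v x) (v y)"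
  using nonarch_abs by (auto simp: nonarch_abs_def)

lemma v_0 [simp]: "v 0 = 0" by (simp only: v_eq_0)

lemma v_pos [simp]: "0 < v x \<longleftrightarrow> x \<noteq> 0"
  using v_nonneg[of x] v_eq_0[of x] by linarith

lemma v_1 [simp]: "v 1 = 1"
  using v_mult[of 1 1] v_eq_0[of 1] by simp

lemma v_power: "v (x ^ n) = v x ^ n"
  by (induction n) (auto simp: v_mult)

lemma v_minus [simp]: "v (- x) = v x"
proof -
  have "v (- 1) ^ 2 = 1" by (simp flip: v_power)
  then have "v (- 1) = 1" using v_nonneg[of "- 1"] by (simp add: power2_eq_1_iff)
  then show ?thesis using v_mult[of "- 1" x] by simp
qed

lemma v_diff: "v (x - y) \<le> max (v x) (v y)"
  using v_add[of x "- y"] by simp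

lemma v_commute: "v (x - y) = v (y - x)"
  using v_minus[of "x - y"] by simp

lemma v_inverse: "v (inverse x) = inverse (v x)"
proof (cases "x = 0")
  case False
  then have "v x * v (inverse x) = 1" by (simp flip: v_mult)
  then show ?thesis by (metis inverse_unique)
qed simp

lemma v_divide: "v (x / y) = v x / v y"
  by (simp add: divide_inverse v_mult v_inverse)

lemma v_powi: "v (x powi k) = v x powi k"
  by (auto simp: power_int_def v_power v_inverse)

lemma v_prod: "v (\<Prod>i\<in>A. f i) = (\<Prod>i\<in>A. v (f i))"
  by (induction A rule: infinite_finite_induct) (auto simp: v_mult)

lemma v_of_nat: "v (of_nat n) \<le> 1"
proof (induction n)
  case (Suc n) then show ?case using v_add[of 1 "of_nat n"] by simp
qed simp

lemma v_add_le: "v x \<le> r \<Longrightarrow> v y \<le> r \<Longrightarrow> v (x + y) \<le> r"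
  and v_add_less: "v x < r \<Longrightarrow> v y < r \<Longrightarrow> v (x + y) < r"
  and v_diff_le: "v x \<le> r \<Longrightarrow> v y \<le> r \<Longrightarrow> v (x - y) \<le> r"
  and v_diff_less: "v x < r \<Longrightarrow> v y < r \<Longrightarrow> v (x - y) < r"
  using v_add[of x y] v_diff[of x y] by linarith+

lemma v_sum_le: "0 \<le> r \<Longrightarrow> (\<And>i. i \<in> A \<Longrightarrow> v (f i) \<le> r) \<Longrightarrow> v (\<Sum>i\<in>A. f i) \<le> r"
  by (induction A rule: infinite_finite_induct) (auto intro: v_add_le)

lemma v_sum_less: "0 < r \<Longrightarrow> (\<And>i. i \<in> A \<Longrightarrow> v (f i) < r) \<Longrightarrow> v (\<Sum>i\<in>A. f i) < r"
  by (induction A rule: infinite_finite_induct) (auto intro: v_add_less)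

lemma v_eq_of_close: "v (x - y) < v x \<Longrightarrow> v y = v x"
  using v_add[of "x - y" y] v_diff[of x "x - y"] by simp

definition cong_v (infix "\<doteq>" 50) where "x \<doteq> y \<longleftrightarrow> v (x - y) < 1"

lemma cong_refl [simp]: "x \<doteq> x" by (simp add: cong_v_def)

lemma cong_sym: "x \<doteq> y \<Longrightarrow> y \<doteq> x" by (simp add: cong_v_def v_commute)

lemma cong_trans: "x \<doteq> y \<Longrightarrow> y \<doteq> z \<Longrightarrow> x \<doteq> z"
  using v_add_less[of "x - y" 1 "y - z"] by (simp add: cong_v_def)

lemma cong_le: "x \<doteq> y \<Longrightarrow> v y \<le> 1 \<Longrightarrow> v x \<le> 1"
  using v_add_le[of "x - y" 1 y] by (simp add: cong_v_def)

lemma cong_less: "x \<doteq> y \<Longrightarrow> v y < 1 \<Longrightarrow> v x < 1"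
  using v_add_less[of "x - y" 1 y] by (simp add: cong_v_def)

lemma v_mult_less: "v x \<le> 1 \<Longrightarrow> v y < 1 \<Longrightarrow> v (x * y) < 1"
  unfolding v_mult by (metis mult_left_le_one_le order_le_less_trans v_nonneg mult.commute)

lemma v_mult_le: "v x \<le> 1 \<Longrightarrow> v y \<le> 1 \<Longrightarrow> v (x * y) \<le> 1"
  unfolding v_mult by (simp add: mult_le_one)

lemma cong_mult:
  assumes "x \<doteq> x'" "y \<doteq> y'" "v x \<le> 1" "v y' \<le> 1" shows "x * y \<doteq> x' * y'"
proof -
  have "x * y - x' * y' = x * (y - y') + y' * (x - x')" by (simp add: algebra_simps)
  then show ?thesis using assms by (simp add: cong_v_def v_add_less v_mult_less)
qed

lemma v_power_le: "v x \<le> 1 \<Longrightarrow> v (x ^ n) \<le> 1"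
  by (simp add: v_power power_le_one)

lemma v_power_le_iff: "n > 0 \<Longrightarrow> v (x ^ n) \<le> 1 \<longleftrightarrow> v x \<le> 1"
  by (simp add: v_power power_le_one_iff)

lemma v_power_less_iff: "n > 0 \<Longrightarrow> v (x ^ n) < 1 \<longleftrightarrow> v x < 1"
  by (simp add: v_power power_less_one_iff)

lemma cong_power: "x \<doteq> y \<Longrightarrow> v x \<le> 1 \<Longrightarrow> x ^ n \<doteq> y ^ n"
proof (induction n)
  case (Suc n)
  have "v y \<le> 1" using Suc cong_le cong_sym by blast
  with Suc show ?case by (auto intro!: cong_mult simp: v_power_le)
qed simp

end

section \<open>Residue characteristic and powers of Frobenius\<close>

locale residue_char = nonarch +
  fixes p :: nat
  assumes prime_p: "normalization_semidom_class.prime p" and v_p: "v (of_nat p) < 1"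
begin

lemma p_pos: "p > 0" and p_gt_1: "p > 1"
  using prime_gt_0_nat[OF prime_p] prime_gt_1_nat[OF prime_p] by auto

lemma cong_add_power_p:
  assumes "v x \<le> 1" "v y \<le> 1" shows "(x + y) ^ p \<doteq> x ^ p + y ^ p"
proof -
  let ?f = "\<lambda>k. of_nat (p choose k) * x ^ k * y ^ (p - k)"
  have "{..p} = insert 0 (insert p {0<..<p})" using p_pos by auto
  then have "(x + y) ^ p = x ^ p + y ^ p + (\<Sum>k\<in>{0<..<p}. ?f k)"
    unfolding binomial_ring using p_pos by simp
  moreover have "v (\<Sum>k\<in>{0<..<p}. ?f k) < 1"
  proof (rule v_sum_less)
    fix k assume k: "k \<in> {0<..<p}"
    then have "p dvd (p choose k)" using prime_p by (intro dvd_choose_prime) auto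
    then obtain j where "p choose k = p * j" by blast
    then have e: "?f k = (of_nat j * (x ^ k * y ^ (p - k))) * of_nat p" by simp
    show "v (?f k) < 1" unfolding e
      using assms v_of_nat[of j] by (intro v_mult_less v_mult_le v_power_le v_p) auto
  qed simp
  ultimately show ?thesis by (simp add: cong_v_def)
qed

text \<open>Modulo the maximal ideal the difference of the \<open>p\<close>-th powers is
  \<open>(x - y) ^ p\<close>: Frobenius is injective on residue classes.\<close>

lemma cong_power_p_iff:
  assumes "v x \<le> 1" "v y \<le> 1" shows "x ^ p \<doteq> y ^ p \<longleftrightarrow> x \<doteq> y"
proof -
  have "x ^ p \<doteq> (x - y) ^ p + y ^ p"
    using cong_add_power_p[of "x - y" y] assms by (simp add: v_diff_le)
  then have "v ((x ^ p - y ^ p) - (x - y) ^ p) < 1" by (simp add: cong_v_def algebra_simps)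
  then have "v (x ^ p - y ^ p) < 1 \<longleftrightarrow> v ((x - y) ^ p) < 1"
    using v_add_less[of "(x ^ p - y ^ p) - (x - y) ^ p" 1 "(x - y) ^ p"]
      v_diff_less[of "x ^ p - y ^ p" 1 "(x ^ p - y ^ p) - (x - y) ^ p"] by auto
  then show ?thesis using p_pos by (simp add: cong_v_def v_power_less_iff)
qed

lemma cong_power_p_power_iff:
  assumes "v x \<le> 1" "v y \<le> 1" shows "x ^ p ^ i \<doteq> y ^ p ^ i \<longleftrightarrow> x \<doteq> y"
proof (induction i)
  case (Suc i)
  have "x ^ p ^ Suc i = (x ^ p ^ i) ^ p" for x :: 'a by (simp add: mult.commute flip: power_mult)
  then show ?case using Suc cong_power_p_iff[of "x ^ p ^ i" "y ^ p ^ i"] assms by (simp add: v_power_le)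
qed simp

text \<open>\<open>\<sigma>\<close> acts on the residue field as the rational power \<open>p\<^sup>j\<^sup>-\<^sup>i\<close>.\<close>

definition p_frobenius :: "('a \<Rightarrow> 'a) \<Rightarrow> nat \<Rightarrow> nat \<Rightarrow> bool"
  where "p_frobenius \<sigma> i j \<longleftrightarrow> (\<forall>x. v x \<le> 1 \<longrightarrow> \<sigma> x ^ p ^ i \<doteq> x ^ p ^ j)"

lemma p_frobenius_integral: "p_frobenius \<sigma> i j \<Longrightarrow> v x \<le> 1 \<Longrightarrow> v (\<sigma> x) \<le> 1"
  using cong_le[of "\<sigma> x ^ p ^ i" "x ^ p ^ j"] p_pos
  by (auto simp: p_frobenius_def v_power_le v_power_le_iff)

text \<open>A common exponent can be cancelled because Frobenius is injective on residue classes.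
  Only the difference of the two exponents matters, so negative powers of Frobenius need no separate
  treatment.\<close>

lemma p_frobenius_shift: "p_frobenius \<sigma> (i + k) (j + k) \<longleftrightarrow> p_frobenius \<sigma> i j"
proof -
  have e: "y ^ p ^ (i + k) = (y ^ p ^ i) ^ p ^ k" for y :: 'a and i
    by (simp add: power_add power_mult)
  have "(\<sigma> x ^ p ^ i \<doteq> x ^ p ^ j) \<longleftrightarrow> (\<sigma> x ^ p ^ (i + k) \<doteq> x ^ p ^ (j + k))"
    if "v x \<le> 1" "v (\<sigma> x) \<le> 1" for x
    unfolding e using that by (simp add: cong_power_p_power_iff v_power_le)
  moreover have "v (\<sigma> x) \<le> 1" if "v x \<le> 1" "p_frobenius \<sigma> (i + k) (j + k) \<or> p_frobenius \<sigma> i j" for x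
    using that p_frobenius_integral by blast
  ultimately show ?thesis unfolding p_frobenius_def by meson
qed

lemma p_frobenius_comp:
  assumes "p_frobenius \<sigma> i j" "p_frobenius \<tau> k l" shows "p_frobenius (\<sigma> \<circ> \<tau>) (i + k) (j + l)"
  unfolding p_frobenius_def o_def
proof (intro allI impI)
  fix x assume x: "v x \<le> 1"
  have tx: "v (\<tau> x) \<le> 1" and sx: "v (\<sigma> (\<tau> x)) \<le> 1"
    using assms x p_frobenius_integral by blast+
  have "\<sigma> (\<tau> x) ^ p ^ i \<doteq> \<tau> x ^ p ^ j" using assms(1) tx by (simp add: p_frobenius_def)
  then have "(\<sigma> (\<tau> x) ^ p ^ i) ^ p ^ k \<doteq> (\<tau> x ^ p ^ j) ^ p ^ k"
    using sx by (intro cong_power v_power_le)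
  moreover have "(\<tau> x ^ p ^ j) ^ p ^ k = (\<tau> x ^ p ^ k) ^ p ^ j" by (simp add: mult.commute flip: power_mult)
  moreover have "(\<tau> x ^ p ^ k) ^ p ^ j \<doteq> (x ^ p ^ l) ^ p ^ j"
    using assms(2) x tx by (intro cong_power v_power_le) (auto simp: p_frobenius_def)
  ultimately show "\<sigma> (\<tau> x) ^ p ^ (i + k) \<doteq> x ^ p ^ (j + l)"
    using cong_trans unfolding add.commute[of j l] power_add power_mult by fastforce
qed

lemma p_frobenius_inv:
  assumes "p_frobenius \<sigma> i j" and \<sigma>: "\<sigma> \<in> galois_set K" shows "p_frobenius (inv_into UNIV \<sigma>) j i"
  unfolding p_frobenius_def
proof (intro allI impI)
  fix x assume x: "v x \<le> 1"
  have b: "bij \<sigma>" and m: "\<And>x y. \<sigma> (x * y) = \<sigma> x * \<sigma> y" and a: "\<And>x y. \<sigma> (x + y) = \<sigma> x + \<sigma> y"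
    using \<sigma> by (auto simp: galois_set_def)
  define y where "y = inv_into UNIV \<sigma> x"
  have sy: "\<sigma> y = x" using b by (simp add: y_def bij_is_surj surj_f_inv_f)
  have s0: "\<sigma> 0 = 0" by (metis a add.right_neutral add_left_cancel)
  have s1: "\<sigma> 1 = 1"
  proof -
    have "\<sigma> 1 \<noteq> 0" using s0 b by (metis bij_pointE one_neq_zero)
    then show ?thesis using m[of 1 1] by simp
  qed
  \<comment> \<open>It is not known that \<open>\<sigma>\<close> preserves \<open>v\<close>. But if
    \<open>y\<close> were not integral, its inverse would lie in the maximal ideal, and so would the
    image of that inverse under \<open>\<sigma>\<close>, which is inverse to the integral element
    \<open>x\<close>.\<close>
  have y: "v y \<le> 1"
  proof (rule ccontr)
    assume "\<not> v y \<le> 1"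
    then have "1 < v y" by simp
    then have y1: "v (inverse y) < 1" "y \<noteq> 0" by (auto simp: v_inverse inverse_less_1_iff)
    then have "\<sigma> (inverse y) ^ p ^ i \<doteq> inverse y ^ p ^ j" using assms(1) by (simp add: p_frobenius_def)
    moreover have "v (inverse y ^ p ^ j) < 1" using y1 p_pos by (simp add: v_power_less_iff)
    ultimately have "v (\<sigma> (inverse y) ^ p ^ i) < 1" by (rule cong_less)
    then have "v (\<sigma> (inverse y)) < 1" using p_pos by (simp add: v_power_less_iff)
    moreover have "v (\<sigma> (inverse y)) * v x = 1"
      using m[of "inverse y" y] y1 s1 sy by (simp flip: v_mult)
    moreover have "v (\<sigma> (inverse y)) * v x \<le> v (\<sigma> (inverse y)) * 1"
      using x by (intro mult_left_mono) auto
    ultimately show False by simp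
  qed
  show "y ^ p ^ j \<doteq> x ^ p ^ i" using assms(1) y sy by (auto simp: p_frobenius_def intro: cong_sym)
qed

end

locale sep_closed_residue_char = residue_char +
  assumes sep_closed: "\<And>P :: 'a poly. Polynomial.degree P > 0 \<Longrightarrow> coprime P (pderiv P) \<Longrightarrow> \<exists>x. poly P x = 0"
begin

text \<open>The witness is a root of the separable polynomial \<open>X ^ p ^ k - X - 1\<close>.\<close>

lemma residue_field_infinite:
  assumes "k > 0" shows "\<exists>x. v x \<le> 1 \<and> \<not> x ^ p ^ k \<doteq> x"
proof -
  define N where "N = p ^ k"
  have N: "N > 1" using one_less_power[OF p_gt_1 assms] by (simp add: N_def)
  have vN: "v (of_nat N) < 1"
    using v_p assms by (simp add: N_def v_power_less_iff)
  define P where "P = Polynomial.monom 1 N - [:1, 1::'a:]"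
  have degP: "Polynomial.degree P = N"
    unfolding P_def diff_conv_add_uminus using N
    by (subst degree_add_eq_left) (auto simp: degree_monom_eq)
  have cop: "coprime P (pderiv P)"
  proof (rule coprimeI)
    fix d assume d: "d dvd P" "d dvd pderiv P"
    \<comment> \<open>This combination of the polynomial and its derivative is linear, so a common
      divisor that is not a unit would vanish at the root of \<open>l\<close>. That root has
      absolute value below 1, where \<open>x ^ N - x = 1\<close> is impossible.\<close>
    define l where "l = [:- of_nat N, 1 - of_nat N :: 'a:]"
    have "Polynomial.smult (of_nat N) P - [:0, 1:] * pderiv P = l"
    proof -
      have "[:0, 1::'a:] * Polynomial.monom (of_nat N) (N - 1) = Polynomial.monom (of_nat N) N"
        using N monom_Suc[of "of_nat N :: 'a" "N - 1"] by simp
      then show ?thesis unfolding P_def l_def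
        by (simp add: pderiv_diff pderiv_monom pderiv_pCons smult_diff_right smult_monom algebra_simps)
    qed
    then have dl: "d dvd l" using d by (metis dvd_diff dvd_mult dvd_smult)
    then obtain e where e: "l = d * e" by blast
    have N1: "1 - of_nat N \<noteq> (0::'a)" using vN by (metis eq_iff_diff_eq_0 less_irrefl v_1)
    then have l: "l \<noteq> 0" "Polynomial.degree l = 1" by (auto simp: l_def)
    have de: "Polynomial.degree d + Polynomial.degree e = 1"
      using l e by (metis degree_mult_eq mult_eq_0_iff)
    have d0: "d \<noteq> 0" "e \<noteq> 0" using l e by auto
    show "is_unit d"
    proof (rule ccontr)
      assume nu: "\<not> is_unit d"
      have "Polynomial.degree d \<noteq> 0" using nu d0 by (metis is_unit_iff_degree)
      then have "Polynomial.degree e = 0" using de by simp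
      then obtain c where c: "e = [:c:]" by (metis degree_eq_zeroE)
      define x where "x = of_nat N / (1 - of_nat N :: 'a)"
      have "poly l x = 0" using N1 by (simp add: l_def x_def field_simps)
      then have "poly d x * c = 0" by (auto simp: e c)
      moreover have "c \<noteq> 0" using d0 c by auto
      ultimately have "poly d x = 0" by simp
      then have "poly P x = 0" using d by auto
      then have Px: "x ^ N - x = 1" by (simp add: P_def poly_monom algebra_simps)
      have "v (1 - of_nat N) = 1" using v_eq_of_close[of 1 "1 - of_nat N"] vN by simp
      then have "v x < 1" using vN by (simp add: x_def v_divide)
      then have "v (x ^ N - x) < 1" using N by (intro v_diff_less) (auto simp: v_power_less_iff)
      then show False using Px by simp
    qed
  qed
  have "Polynomial.degree P > 0" using degP N by simp
  from sep_closed[OF this cop] obtain x where "poly P x = 0" by blast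
  then have x: "x ^ N = x + 1" by (simp add: P_def poly_monom algebra_simps)
  have "v x \<le> 1"
  proof (rule ccontr)
    assume "\<not> v x \<le> 1"
    then have x1: "1 < v x" by simp
    have "v (x + 1) \<le> v x" using x1 v_add[of x 1] by simp
    then have "v x ^ N \<le> v x ^ 1" using x by (metis power_one_right v_power)
    then have "N \<le> 1" using x1 power_le_imp_le_exp by blast
    then show False using N by simp
  qed
  moreover have "\<not> x ^ p ^ k \<doteq> x" using x by (simp add: cong_v_def N_def)
  ultimately show ?thesis by blast
qed

text \<open>Two different powers would make some positive power of Frobenius the identity on the
  residue field of the separable closure, against \<open>residue_field_infinite\<close>. This makes
  the degree of a Weil group element well defined.\<close>

lemma p_frobenius_unique:
  assumes "p_frobenius \<sigma> i j" "p_frobenius \<sigma> i' j'" shows "i + j' = i' + j"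
proof (rule ccontr)
  assume ne: "i + j' \<noteq> i' + j"
  have A: "False" if ab: "p_frobenius \<sigma> n a" "p_frobenius \<sigma> n b" "a < b" for a b n
  proof -
    obtain x where x: "v x \<le> 1" "\<not> x ^ p ^ (b - a) \<doteq> x"
      using residue_field_infinite[of "b - a"] ab by auto
    have "x ^ p ^ b \<doteq> x ^ p ^ a"
      using that x unfolding p_frobenius_def by (meson cong_sym cong_trans)
    moreover have "x ^ p ^ b = (x ^ p ^ (b - a)) ^ p ^ a"
      using that by (simp flip: power_mult power_add)
    ultimately have "x ^ p ^ (b - a) \<doteq> x" using x by (simp add: cong_power_p_power_iff v_power_le)
    then show False using x by simp
  qed
  have "p_frobenius \<sigma> (i + i') (j + i')" using assms(1) by (simp add: p_frobenius_shift)
  moreover have "p_frobenius \<sigma> (i + i') (j' + i)"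
    using assms(2) by (simp only: add.commute[of i i'] p_frobenius_shift)
  ultimately
  show False using A ne by (metis add.commute nat_neq_iff)
qed

end

section \<open>Residue fields and uniformizers\<close>

text \<open>\<open>residue_field\<close> is a bare set of equivalence classes. Recognizing it as the
  carrier of a quotient group makes theorems on finite groups available for its cardinality.\<close>

lemma additive_quotient_residue_field:
  fixes v :: "'a::field \<Rightarrow> real"
  assumes "nonarch_abs v" and K: "subfield K field_of_type"
  defines "G \<equiv> \<lparr>carrier = {x \<in> K. v x \<le> 1}, mult = (+), one = 0\<rparr> :: 'a monoid"
  defines "H \<equiv> {x \<in> K. v x < 1}"
  shows "comm_group G" "subgroup H G" "carrier (G Mod H) = residue_field K v"
proof -
  interpret nonarch v by unfold_locales fact
  note K = subfield_facts[OF K]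
  show cG: "comm_group G"
  proof (rule comm_groupI)
    fix x assume "x \<in> carrier G"
    then show "\<exists>y\<in>carrier G. y \<otimes>\<^bsub>G\<^esub> x = \<one>\<^bsub>G\<^esub>"
      using K by (intro bexI[of _ "- x"]) (auto simp: G_def)
  qed (use K in \<open>auto simp: G_def add_ac intro: v_add_le\<close>)
  interpret G: comm_group G by fact
  have invG: "inv\<^bsub>G\<^esub> x = - x" if "x \<in> carrier G" for x
    using that K by (intro G.inv_equality) (auto simp: G_def)
  show "subgroup H G"
  proof (rule G.subgroupI)
    show "H \<noteq> {}" using K by (auto simp: H_def intro!: exI[of _ 0])
    show "inv\<^bsub>G\<^esub> a \<in> H" if "a \<in> H" for a
      using that K by (subst invG) (auto simp: H_def G_def)
  qed (use K in \<open>auto simp: H_def G_def intro: v_add_less\<close>)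
  have coset: "H #>\<^bsub>G\<^esub> x = {(x, y). x \<in> K \<and> y \<in> K \<and> v x \<le> 1 \<and> v y \<le> 1 \<and> v (x - y) < 1} `` {x}"
    if x: "x \<in> carrier G" for x
  proof
    show "H #>\<^bsub>G\<^esub> x \<subseteq> {(x, y). x \<in> K \<and> y \<in> K \<and> v x \<le> 1 \<and> v y \<le> 1 \<and> v (x - y) < 1} `` {x}"
      using x K by (auto simp: r_coset_def H_def G_def intro: v_add_le)
    show "{(x, y). x \<in> K \<and> y \<in> K \<and> v x \<le> 1 \<and> v y \<le> 1 \<and> v (x - y) < 1} `` {x} \<subseteq> H #>\<^bsub>G\<^esub> x"
    proof
      fix y assume "y \<in> {(x, y). x \<in> K \<and> y \<in> K \<and> v x \<le> 1 \<and> v y \<le> 1 \<and> v (x - y) < 1} `` {x}"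
      then have "y - x \<in> H" "y = (y - x) + x" using K by (auto simp: H_def v_commute)
      then show "y \<in> H #>\<^bsub>G\<^esub> x" by (auto simp: r_coset_def G_def intro!: bexI[of _ "y - x"])
    qed
  qed
  show "carrier (G Mod H) = residue_field K v"
    using coset by (auto simp: FactGroup_def RCOSETS_def residue_field_def quotient_def G_def)
qed

context nonarch
begin

text \<open>By Bezout, two distinct primes in the maximal ideal would put 1 there. It also
  identifies the residue characteristics of \<open>F\<close> and \<open>E\<close>, since both use
  the same \<open>v\<close>.\<close>

lemma residue_characteristic_unique:
  assumes "normalization_semidom_class.prime (l::nat)" "normalization_semidom_class.prime p"
    and "v (of_nat l) < 1" "v (of_nat p) < 1"
  shows "l = p"
proof (rule ccontr)
  assume "l \<noteq> p"
  then have "coprime l p" using assms by (simp add: primes_coprime)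
  then obtain x y where xy: "l * x = p * y + 1"
    using bezout_nat[of l p] prime_gt_0_nat[OF assms(1)] by auto
  have "v (of_nat (l * x)) < 1"
    using v_mult_less[OF v_of_nat[of x] assms(3)] by (simp add: mult.commute)
  moreover have "v (of_nat (p * y)) < 1"
    using v_mult_less[OF v_of_nat[of y] assms(4)] by (simp add: mult.commute)
  ultimately have "v (of_nat (l * x) - of_nat (p * y)) < 1" by (rule v_diff_less)
  then show False unfolding xy by simp
qed

text \<open>If a prime \<open>l\<close> divides the cardinality, some unit \<open>x\<close> has
  order \<open>l\<close> in the additive residue group, so \<open>l * x\<close> and hence
  \<open>l\<close> lie in the maximal ideal. Only one prime can do so.\<close>

lemma residue_card_prime_power:
  assumes K: "subfield K field_of_type" and card: "residue_card K v > 0"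
  shows "\<exists>p b. normalization_semidom_class.prime (p::nat) \<and> v (of_nat p) < 1 \<and> b > 0 \<and> residue_card K v = p ^ b"
proof -
  define G where "G = (\<lparr>carrier = {x \<in> K. v x \<le> 1}, mult = (+), one = 0\<rparr> :: 'a monoid)"
  define H where "H = {x \<in> K. v x < 1}"
  note res = additive_quotient_residue_field[OF nonarch_abs K, folded G_def H_def]
  interpret G: comm_group G by (rule res)
  have nH: "H \<lhd> G" using res(2) by (rule G.subgroup_imp_normal)
  interpret Q: group "G Mod H" using normal.factorgroup_is_group[OF nH] .
  note Kf = subfield_facts[OF K]
  have pow: "x [^]\<^bsub>G\<^esub> (n::nat) = of_nat n * x" if "x \<in> carrier G" for x n
    by (induction n) (auto simp: G_def algebra_simps)
  have fin: "finite (carrier (G Mod H))" using card res(3) by (metis card_gt_0_iff)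
  have ord: "order (G Mod H) = residue_card K v" by (simp add: order_def res(3))
  have prime_lt: "v (of_nat l) < 1" if l: "normalization_semidom_class.prime (l::nat)" "l dvd residue_card K v" for l
  proof -
    obtain m where "residue_card K v = l ^ 1 * m" using l by auto
    \<comment> \<open>The Sylow theorem with exponent 1 serves as Cauchy's theorem: a subgroup of
      order \<open>l\<close>, any non-trivial element of which is killed by
      \<open>l\<close>.\<close>
    then obtain J where J: "subgroup J (G Mod H)" "card J = l ^ 1"
      using sylow_thm[OF l(1) Q.is_group _ fin] ord by metis
    have l1: "l > 1" using prime_gt_1_nat[OF l(1)] .
    then have "\<not> J \<subseteq> {\<one>\<^bsub>G Mod H\<^esub>}" using J(2) card_mono[of "{\<one>\<^bsub>G Mod H\<^esub>}" J] by auto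
    then obtain c where c: "c \<in> J" "c \<noteq> \<one>\<^bsub>G Mod H\<^esub>" by blast
    have gJ: "group ((G Mod H)\<lparr>carrier := J\<rparr>)" using subgroup.subgroup_is_group[OF J(1) Q.is_group] .
    have "c [^]\<^bsub>(G Mod H)\<lparr>carrier := J\<rparr>\<^esub> order ((G Mod H)\<lparr>carrier := J\<rparr>) = \<one>\<^bsub>(G Mod H)\<lparr>carrier := J\<rparr>\<^esub>"
      using c by (intro group.pow_order_eq_1[OF gJ]) simp
    then have cl: "c [^]\<^bsub>G Mod H\<^esub> l = H"
      using J(2) by (simp add: order_def nat_pow_def FactGroup_def)
    have "c \<in> carrier (G Mod H)" using c J(1) subgroup.mem_carrier by fast
    then obtain x where x: "x \<in> carrier G" "c = H #>\<^bsub>G\<^esub> x" by (auto simp: FactGroup_def RCOSETS_def)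
    have "H #>\<^bsub>G\<^esub> (of_nat l * x) = H"
      using cl normal.FactGroup_pow[OF nH x(1)] by (simp add: x(2) pow[OF x(1)])
    moreover have lx: "of_nat l * x \<in> carrier G"
      using G.nat_pow_closed[OF x(1)] pow[OF x(1)] by metis
    ultimately have "of_nat l * x \<in> H" using G.rcos_self[OF _ res(2)] by metis
    then have 1: "v (of_nat l) * v x < 1" by (simp add: H_def v_mult)
    have "x \<notin> H" using x c G.coset_join2[OF x(1) res(2)] by (auto simp: FactGroup_def)
    then have "v x = 1" using x by (auto simp: H_def G_def)
    then show ?thesis using 1 by simp
  qed
  have q1: "residue_card K v \<noteq> 1"
  proof
    assume "residue_card K v = 1"
    then obtain C where C: "residue_field K v = {C}" using card_1_singletonE by blast
    have mem: "H #>\<^bsub>G\<^esub> x = C" if "x \<in> carrier G" for x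
      using that res(3) C by (auto simp: FactGroup_def RCOSETS_def)
    have o: "0 \<in> carrier G" "1 \<in> carrier G" using Kf by (auto simp: G_def)
    have "1 \<in> H #>\<^bsub>G\<^esub> 1" using G.rcos_self[OF o(2) res(2)] .
    then have "1 \<in> H #>\<^bsub>G\<^esub> 0" using mem o by metis
    then show False by (auto simp: r_coset_def G_def H_def)
  qed
  then obtain p :: nat where p: "normalization_semidom_class.prime p" "p dvd residue_card K v"
    using prime_factor_nat by blast
  have unique: "l = p" if l: "normalization_semidom_class.prime (l::nat)" "l dvd residue_card K v" for l
    using l(1) p(1) prime_lt[OF l] prime_lt[OF p] by (rule residue_characteristic_unique)
  have np: "\<not> is_unit p" using p(1) by auto
  obtain m where m: "residue_card K v = p ^ multiplicity p (residue_card K v) * m" "\<not> p dvd m"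
    using multiplicity_decompose'[OF _ np] card by (metis less_numeral_extra(3))
  have "m = 1"
  proof (rule ccontr)
    assume "m \<noteq> 1"
    then obtain l :: nat where l: "normalization_semidom_class.prime l" "l dvd m" using prime_factor_nat by blast
    then have "l dvd residue_card K v" using m(1) by (metis dvd_mult)
    then show False using unique l m(2) by blast
  qed
  then have e: "residue_card K v = p ^ multiplicity p (residue_card K v)" using m(1) by simp
  have "multiplicity p (residue_card K v) > 0" using e q1 by (metis gr0I power_0)
  then show ?thesis using e p prime_lt by blast
qed

text \<open>A single term of maximal absolute value could not be cancelled by the smaller ones, by
  the ultrametric inequality.\<close>

lemma vanishing_sum_equal_valuation:
  assumes "finite A" "(\<Sum>i\<in>A. f i) = 0" "\<exists>i\<in>A. f i \<noteq> 0"
  shows "\<exists>i\<in>A. \<exists>j\<in>A. i \<noteq> j \<and> f i \<noteq> 0 \<and> v (f i) = v (f j)"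
proof -
  let ?M = "Max ((\<lambda>i. v (f i)) ` A)"
  obtain i0 where i0: "i0 \<in> A" "f i0 \<noteq> 0" using assms(3) by blast
  have "?M \<in> (\<lambda>i. v (f i)) ` A" using assms(1) i0 by (intro Max_in) auto
  then obtain i where i: "i \<in> A" "v (f i) = ?M" by auto
  have le: "v (f j) \<le> v (f i)" if "j \<in> A" for j
    using that i assms(1) by simp
  have fi: "f i \<noteq> 0"
  proof
    assume "f i = 0"
    then have "v (f i0) \<le> 0" using le[OF i0(1)] by simp
    then show False using i0 v_nonneg[of "f i0"] v_eq_0[of "f i0"] by linarith
  qed
  show ?thesis
  proof (rule ccontr)
    assume "\<not> ?thesis"
    then have lt: "v (f j) < v (f i)" if "j \<in> A - {i}" for j
      using that le[of j] i fi by fastforce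
    have "v (\<Sum>j\<in>A - {i}. f j) < v (f i)" using fi lt by (intro v_sum_less) auto
    moreover have "(\<Sum>j\<in>A - {i}. f j) = - f i"
      using assms(1,2) i(1) by (simp add: sum_diff1)
    ultimately show False by simp
  qed
qed

text \<open>Dividing an integral \<open>a\<close> by the right power of \<open>\<pi>\<close> gives
  an absolute value above \<open>v \<pi>\<close> and at most 1. As \<open>K\<close> has no absolute
  value strictly between \<open>v \<pi>\<close> and 1, it is 1. Inverting covers the remaining
  \<open>a\<close>.\<close>

lemma uniformizer_valuation:
  assumes K: "subfield K field_of_type" and \<pi>: "uniformizer K v \<pi>" and a: "a \<in> K" "a \<noteq> 0"
  shows "\<exists>k. v a = v \<pi> powi k"
proof -
  note Kf = subfield_facts[OF K]
  have \<pi>': "\<pi> \<in> K" "0 < v \<pi>" "v \<pi> < 1" "\<And>x. x \<in> K \<Longrightarrow> v x < 1 \<Longrightarrow> v x \<le> v \<pi>"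
    using \<pi> unfolding uniformizer_def by blast+
  have pos: "\<exists>n::nat. v a = v \<pi> ^ n" if a: "a \<in> K" "a \<noteq> 0" "v a \<le> 1" for a
  proof -
    have "\<exists>n. v \<pi> ^ n < v a" using real_arch_pow_inv[of "v a" "v \<pi>"] a \<pi>' by auto
    then obtain n where n: "v \<pi> ^ n < v a" "\<And>m. m < n \<Longrightarrow> \<not> v \<pi> ^ m < v a"
      using exists_least_iff[of "\<lambda>n. v \<pi> ^ n < v a"] by blast
    then have "n \<noteq> 0" using a by (cases n) auto
    then obtain m where m: "n = Suc m" using not0_implies_Suc by blast
    then have le: "v a \<le> v \<pi> ^ m" using n(2)[of m] by simp
    have pm: "v \<pi> ^ m > 0" using \<pi>' by simp
    have "a / \<pi> ^ m \<in> K" using Kf(8)[OF a(1) Kf(9)[OF \<pi>'(1)]] .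
    moreover have "v (a / \<pi> ^ m) = v a / v \<pi> ^ m" by (simp add: v_divide v_power)
    moreover have "v a / v \<pi> ^ m > v \<pi>" using n(1) pm by (simp add: m pos_less_divide_eq)
    ultimately have "\<not> v a / v \<pi> ^ m < 1" using \<pi>'(4) by (metis leD)
    then have "v a = v \<pi> ^ m" using le pm by (simp add: not_less pos_le_divide_eq)
    then show ?thesis by blast
  qed
  show ?thesis
  proof (cases "v a \<le> 1")
    case True
    then obtain n where "v a = v \<pi> ^ n" using pos a by blast
    then show ?thesis by (intro exI[of _ "int n"]) simp
  next
    case False
    then have "v (inverse a) \<le> 1" by (simp add: v_inverse inverse_le_1_iff)
    then obtain n where "v (inverse a) = v \<pi> ^ n" using pos[of "inverse a"] a Kf by auto
    then have "v a = inverse (v \<pi> ^ n)" by (metis inverse_inverse_eq v_inverse)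
    then show ?thesis by (intro exI[of _ "- int n"]) (simp add: power_int_minus)
  qed
qed

end

lemma combine_eq_sum:
  assumes "length Ks = length Us"
  shows "ring.combine field_of_type Ks Us = (\<Sum>i<length Us. Ks ! i * Us ! i :: 'a::field)"
proof -
  interpret field "field_of_type :: 'a ring" by (rule field_from_type_algebra)
  have ops: "a \<otimes>\<^bsub>field_of_type\<^esub> b = a * b" "a \<oplus>\<^bsub>field_of_type\<^esub> b = a + b" for a b :: 'a
    by (auto simp: ring_of_type_algebra_def)
  show ?thesis using assms
  proof (induction Ks Us rule: list_induct2)
    case Nil
    have "combine [] [] = \<zero>\<^bsub>field_of_type\<^esub>" by simp
    then show ?case by (simp add: ring_of_type_algebra_def del: combine.simps)
  next
    case (Cons k Ks u Us)
    have "combine (k # Ks) (u # Us) = k * u + combine Ks Us" by (simp only: combine.simps ops)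
    then show ?case using Cons by (simp add: sum.lessThan_Suc_shift del: sum.lessThan_Suc combine.simps)
  qed
qed

text \<open>With \<open>n\<close> the degree, the \<open>n + 1\<close> powers of \<open>y\<close>
  are linearly dependent. That one \<open>n\<close> serves all \<open>y\<close> is what
  \<open>uniformizer_exists\<close> needs.\<close>

lemma finite_extension_algebraic:
  assumes "finite_extension F E"
  shows "\<exists>n. \<forall>y\<in>E. \<exists>c. (\<forall>i. c i \<in> F) \<and> (\<exists>i\<le>n. c i \<noteq> 0) \<and> (\<Sum>i\<le>n. c i * y ^ i) = (0::'a::field)"
proof -
  interpret field "field_of_type :: 'a ring" by (rule field_from_type_algebra)
  have F: "subfield F field_of_type" and E: "subfield E field_of_type" and "finite_dimension F E"
    using assms by (auto simp: finite_extension_def)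
  then obtain n where n: "dimension n F E" using finite_dimensionE' by blast
  have "\<exists>c. (\<forall>i. c i \<in> F) \<and> (\<exists>i\<le>n. c i \<noteq> 0) \<and> (\<Sum>i\<le>n. c i * y ^ i) = 0" if y: "y \<in> E" for y
  proof -
    define Us where "Us = map (\<lambda>i. y ^ i) [0..<Suc n]"
    have len: "length Us = Suc n" by (simp add: Us_def)
    have "set Us \<subseteq> E" using subfield_facts[OF E] y by (auto simp: Us_def)
    then have "dependent F Us" using independent_length_le_dimension[OF F n] len by fastforce
    moreover have "set Us \<subseteq> carrier field_of_type" by (simp add: ring_of_type_algebra_def)
    ultimately obtain Ks where Ks: "length Ks = length Us" "combine Ks Us = \<zero>\<^bsub>field_of_type\<^esub>" "set Ks \<subseteq> F"
      "set Ks \<noteq> {\<zero>\<^bsub>field_of_type\<^esub>}"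
      using dependent_imp_non_trivial_combine[OF F] by metis
    define c where "c i = (if i < Suc n then Ks ! i else 0)" for i
    have "c i \<in> F" for i using Ks(1,3) len subfield_facts(1)[OF F] by (auto simp: c_def)
    moreover have "\<exists>i\<le>n. c i \<noteq> 0"
    proof (rule ccontr)
      assume "\<not> ?thesis"
      then have "Ks ! i = 0" if "i < length Ks" for i using that Ks(1) len by (auto simp: c_def less_Suc_eq_le)
      then have "set Ks \<subseteq> {0}" by (metis in_set_conv_nth singletonI subsetI)
      moreover have "set Ks \<noteq> {}" using Ks(1) len by auto
      ultimately have "set Ks = {0}" by (metis subset_singletonD)
      then show False using Ks(4) by (simp add: ring_of_type_algebra_def)
    qed
    moreover have "(\<Sum>i\<le>n. c i * y ^ i) = 0"
    proof -
      have "(\<Sum>i\<le>n. c i * y ^ i) = (\<Sum>i<Suc n. Ks ! i * Us ! i)"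
        unfolding lessThan_Suc_atMost[symmetric] by (intro sum.cong) (auto simp: c_def Us_def simp del: upt_Suc)
      also have "\<dots> = combine Ks Us" using Ks(1) len by (simp add: combine_eq_sum)
      finally show ?thesis using Ks(2) by (simp add: ring_of_type_algebra_def)
    qed
    ultimately show ?thesis by blast
  qed
  then show ?thesis by blast
qed

context nonarch
begin

text \<open>In an algebraic equation for \<open>y\<close> two terms have equal absolute value, so
  some power of \<open>v y\<close> with exponent at most \<open>n\<close> is a value of
  \<open>F\<close>. Raising to the power \<open>n!\<close> therefore sends all values of
  \<open>E\<close> to powers of \<open>v \<pi>\<close>, and the values of \<open>E\<close> are
  discrete.\<close>

lemma uniformizer_exists:
  assumes ext: "finite_extension F E" and \<pi>: "uniformizer F v \<pi>"
  shows "\<exists>\<pi>'. uniformizer E v \<pi>'"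
proof -
  have F: "subfield F field_of_type" and E: "subfield E field_of_type" and FE: "F \<subseteq> E"
    using ext by (auto simp: finite_extension_def)
  have \<pi>': "\<pi> \<in> F" "0 < v \<pi>" "v \<pi> < 1" using \<pi> by (auto simp: uniformizer_def)
  obtain n where n: "\<And>y. y \<in> E \<Longrightarrow>
      \<exists>c. (\<forall>i. c i \<in> F) \<and> (\<exists>i\<le>n. c i \<noteq> 0) \<and> (\<Sum>i\<le>n. c i * y ^ i) = 0"
    using finite_extension_algebraic[OF ext] by blast
  define M where "M = (fact n :: nat)"
  have M: "M > 0" by (simp add: M_def)
  have val: "\<exists>k. v y ^ M = v \<pi> powi k" if y: "y \<in> E" "y \<noteq> 0" for y
  proof -
    obtain c where c: "\<And>i. c i \<in> F" "\<exists>i\<le>n. c i \<noteq> 0" "(\<Sum>i\<le>n. c i * y ^ i) = 0"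
      using n[OF y(1)] by blast
    then obtain i0 j0 where "i0 \<le> n" "j0 \<le> n" "i0 \<noteq> j0" "c i0 * y ^ i0 \<noteq> 0"
      "v (c i0 * y ^ i0) = v (c j0 * y ^ j0)"
      using vanishing_sum_equal_valuation[of "{..n}" "\<lambda>i. c i * y ^ i"] y by auto
    then have "\<exists>i j. j \<le> n \<and> i < j \<and> c i \<noteq> 0 \<and> c j \<noteq> 0 \<and> v (c i * y ^ i) = v (c j * y ^ j)"
      using y v_eq_0 by (metis mult_eq_0_iff nat_neq_iff)
    then obtain i j where ij: "j \<le> n" "i < j" "c i \<noteq> 0" "c j \<noteq> 0" "v (c i * y ^ i) = v (c j * y ^ j)"
      by blast
    have "v y ^ j = v y ^ i * v y ^ (j - i)" using ij by (simp flip: power_add)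
    then have "v y ^ (j - i) = v (c i / c j)"
      using ij y by (simp add: v_mult v_power v_divide field_simps)
    moreover obtain k where "v (c i / c j) = v \<pi> powi k"
      using uniformizer_valuation[OF F \<pi>, of "c i / c j"] c(1) subfield_facts[OF F] ij by auto
    ultimately have k: "v y ^ (j - i) = v \<pi> powi k" by simp
    have "(j - i) dvd M" unfolding M_def using ij by (intro dvd_fact) auto
    then obtain d where "M = (j - i) * d" by blast
    then have "v y ^ M = v \<pi> powi (k * int d)" using k by (simp add: power_mult power_int_mult)
    then show ?thesis by blast
  qed
  \<comment> \<open>The exponents reached by elements of the maximal ideal of \<open>E\<close>. An
    element with the least such exponent has the largest absolute value below 1, which makes it a
    uniformizer.\<close>
  define good where "good k = (\<exists>y\<in>E. v y < 1 \<and> v y ^ M = v \<pi> ^ k)" for k :: nat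
  have goodex: "\<exists>k. v y ^ M = v \<pi> ^ k" if y: "y \<in> E" "y \<noteq> 0" "v y < 1" for y
  proof -
    obtain k where k: "v y ^ M = v \<pi> powi k" using val y by blast
    have "k \<ge> 0"
    proof (rule ccontr)
      assume "\<not> k \<ge> 0"
      then have "v \<pi> powi k = inverse (v \<pi> ^ nat (- k))" by (simp add: power_int_def power_inverse)
      moreover have "v \<pi> ^ nat (- k) \<le> 1" using \<pi>' by (simp add: power_le_one)
      ultimately have "v y ^ M \<ge> 1" using k \<pi>' by (simp add: one_le_inverse_iff)
      moreover have "v y ^ M < 1" using y M by (simp add: power_less_one_iff)
      ultimately show False by simp
    qed
    then show ?thesis using k by (intro exI[of _ "nat k"]) (simp add: power_int_def)
  qed
  have "\<exists>k. good k" using goodex[of \<pi>] \<pi>' FE unfolding good_def by (metis subsetD v_pos)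
  then obtain k where k: "good k" "\<And>m. m < k \<Longrightarrow> \<not> good m" using exists_least_iff[of good] by blast
  then obtain y where y: "y \<in> E" "v y < 1" "v y ^ M = v \<pi> ^ k" by (auto simp: good_def)
  have "uniformizer E v y"
    unfolding uniformizer_def
  proof (intro conjI ballI impI)
    show "0 < v y"
    proof (rule ccontr)
      assume "\<not> 0 < v y"
      then have "v y = 0" using v_nonneg[of y] by linarith
      then show False using y(3) \<pi>' by (simp add: zero_power[OF M])
    qed
    fix x assume x: "x \<in> E" "v x < 1"
    show "v x \<le> v y"
    proof (cases "x = 0")
      case False
      then obtain m where m: "v x ^ M = v \<pi> ^ m" using goodex x by blast
      then have "k \<le> m" using k(2)[of m] x by (auto simp: good_def not_less[symmetric])
      then have "v \<pi> ^ m \<le> v \<pi> ^ k" using \<pi>' by (intro power_decreasing) auto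
      then have "v x ^ M \<le> v y ^ M" using m y by simp
      then show ?thesis using M by (simp add: power_mono_iff)
    qed simp
  qed (use y in auto)
  then show ?thesis by blast
qed

end

section \<open>Galois and Weil groups of local fields\<close>

lemma galois_set_hom:
  assumes "\<sigma> \<in> galois_set K"
  shows "bij \<sigma>" "\<sigma> (x + y) = \<sigma> x + \<sigma> y" "\<sigma> (x * y) = \<sigma> x * \<sigma> y" "z \<in> K \<Longrightarrow> \<sigma> z = z"
    "\<sigma> 0 = 0" "\<sigma> 1 = 1" "\<sigma> (- x) = - \<sigma> x" "\<sigma> (inverse x) = inverse (\<sigma> x)" "\<sigma> x = 0 \<longleftrightarrow> x = 0"
    "\<sigma> (x ^ n) = \<sigma> x ^ n" "\<sigma> (sum f A) = (\<Sum>i\<in>A. \<sigma> (f i))"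
proof -
  show b: "bij \<sigma>" and a: "\<sigma> (x + y) = \<sigma> x + \<sigma> y" and m: "\<sigma> (x * y) = \<sigma> x * \<sigma> y"
    and "z \<in> K \<Longrightarrow> \<sigma> z = z" for x y z
    using assms by (auto simp: galois_set_def)
  show s0: "\<sigma> 0 = 0" by (metis a add.right_neutral add_left_cancel)
  show s: "\<sigma> x = 0 \<longleftrightarrow> x = 0" for x using s0 b by (metis bij_pointE)
  show s1: "\<sigma> 1 = 1" using s[of 1] m[of 1 1] by simp
  show "\<sigma> (- x) = - \<sigma> x" using a[of x "- x"] s0 by (simp add: eq_neg_iff_add_eq_0 add.commute)
  show "\<sigma> (inverse x) = inverse (\<sigma> x)"
    using m[of x "inverse x"] s1 s0 by (cases "x = 0") (auto intro: inverse_unique[symmetric])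
  show "\<sigma> (x ^ n) = \<sigma> x ^ n" by (induction n) (auto simp: s1 m)
  show "\<sigma> (sum f A) = (\<Sum>i\<in>A. \<sigma> (f i))" by (induction A rule: infinite_finite_induct) (auto simp: s0 a)
qed

lemma galois_set_closed:
  "id \<in> galois_set K" "\<sigma> \<in> galois_set K \<Longrightarrow> \<tau> \<in> galois_set K \<Longrightarrow> \<sigma> \<circ> \<tau> \<in> galois_set K"
  "\<sigma> \<in> galois_set K \<Longrightarrow> inv_into UNIV \<sigma> \<in> galois_set K"
proof -
  show "id \<in> galois_set K" by (auto simp: galois_set_def)
  show "\<sigma> \<in> galois_set K \<Longrightarrow> \<tau> \<in> galois_set K \<Longrightarrow> \<sigma> \<circ> \<tau> \<in> galois_set K"
    by (auto simp: galois_set_def bij_comp)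
  assume \<sigma>: "\<sigma> \<in> galois_set K"
  then have b: "bij \<sigma>" and f: "\<And>x. \<sigma> (inv_into UNIV \<sigma> x) = x" "\<And>x. inv_into UNIV \<sigma> (\<sigma> x) = x"
    using galois_set_hom(1) bij_is_surj surj_f_inv_f bij_is_inj inv_f_f by metis+
  show "inv_into UNIV \<sigma> \<in> galois_set K"
    unfolding galois_set_def
  proof (intro CollectI conjI allI ballI)
    show "bij (inv_into UNIV \<sigma>)" using b bij_imp_bij_inv by blast
    show "inv_into UNIV \<sigma> (x + y) = inv_into UNIV \<sigma> x + inv_into UNIV \<sigma> y" for x y
      using galois_set_hom(2)[OF \<sigma>] f by metis
    show "inv_into UNIV \<sigma> (x * y) = inv_into UNIV \<sigma> x * inv_into UNIV \<sigma> y" for x y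
      using galois_set_hom(3)[OF \<sigma>] f by metis
    show "inv_into UNIV \<sigma> x = x" if "x \<in> K" for x
      using galois_set_hom(4)[OF \<sigma> that] f by metis
  qed
qed

lemma galois_inv:
  assumes "\<sigma> \<in> galois_set K"
  shows "\<sigma> (inv_into UNIV \<sigma> x) = x" "inv_into UNIV \<sigma> (\<sigma> x) = x"
    "\<sigma> \<circ> inv_into UNIV \<sigma> = id" "inv_into UNIV \<sigma> \<circ> \<sigma> = id"
    "inv_into UNIV (inv_into UNIV \<sigma>) = \<sigma>"
  using galois_set_hom(1)[OF assms]
  by (auto simp: bij_is_surj surj_f_inv_f bij_is_inj inv_f_f inv_inv_eq fun_eq_iff)

text \<open>An embedding of \<open>E\<close> over \<open>F\<close> is determined by its values on a
  basis, and each of these is a root of a fixed non-zero polynomial over \<open>F\<close>.\<close>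

lemma finite_galois_restrictions:
  assumes ext: "finite_extension F E"
  shows "finite ((\<lambda>\<sigma>. restrict \<sigma> E) ` galois_set F)"
proof -
  interpret field "field_of_type :: 'a ring" by (rule field_from_type_algebra)
  have F: "subfield F field_of_type" and "finite_dimension F E"
    using ext by (auto simp: finite_extension_def)
  then obtain n where n: "dimension n F E" using finite_dimensionE' by blast
  obtain Us where Us: "length Us = n" "Span F Us = E" "independent F Us" using exists_base[OF F n] by blast
  obtain m where m: "\<And>y. y \<in> E \<Longrightarrow>
      \<exists>c. (\<forall>i. c i \<in> F) \<and> (\<exists>i\<le>m. c i \<noteq> 0) \<and> (\<Sum>i\<le>m. c i * y ^ i) = 0"
    using finite_extension_algebraic[OF ext] by blast
  have fin: "finite ((\<lambda>\<sigma>. \<sigma> y) ` galois_set F)" if y: "y \<in> E" for y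
  proof -
    obtain c where c: "\<And>i. c i \<in> F" "\<exists>i\<le>m. c i \<noteq> 0" "(\<Sum>i\<le>m. c i * y ^ i) = 0"
      using m[OF y] by blast
    define P where "P = (\<Sum>i\<le>m. Polynomial.monom (c i) i)"
    have P: "poly P x = (\<Sum>i\<le>m. c i * x ^ i)" for x by (simp add: P_def poly_sum poly_monom)
    have "Polynomial.coeff P i = c i" if "i \<le> m" for i
      using that by (simp add: P_def Polynomial.coeff_sum)
    then have "P \<noteq> 0" using c(2) by (metis Polynomial.coeff_0)
    then have "finite {x. poly P x = 0}" by (rule poly_roots_finite)
    moreover have "poly P (\<sigma> y) = 0" if "\<sigma> \<in> galois_set F" for \<sigma>
    proof -
      have "(\<Sum>i\<le>m. c i * \<sigma> y ^ i) = \<sigma> (\<Sum>i\<le>m. c i * y ^ i)"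
        using c(1) by (simp add: galois_set_hom[OF that])
      then show ?thesis using P c(3) galois_set_hom(5)[OF that] by simp
    qed
    ultimately show ?thesis by (elim finite_subset[rotated]) auto
  qed
  have UsE: "set Us \<subseteq> E" using Us Span_base_incl[OF F, of Us] independent_in_carrier by blast
  have agree: "\<sigma> x = \<tau> x" if st: "\<sigma> \<in> galois_set F" "\<tau> \<in> galois_set F" "\<forall>u\<in>set Vs. \<sigma> u = \<tau> u" "x \<in> Span F Vs" for \<sigma> \<tau> x Vs
    using st(3,4)
  proof (induction Vs arbitrary: x)
    case Nil
    then have "x = \<zero>\<^bsub>field_of_type\<^esub>" by simp
    then have "x = 0" by (simp add: ring_of_type_algebra_def)
    then show ?case using galois_set_hom(5) st by metis
  next
    case (Cons u Vs)
    have "x \<in> line_extension F u (Span F Vs)" using Cons.prems by simp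
    then obtain k w where "k \<in> F" "w \<in> Span F Vs" "x = k \<otimes>\<^bsub>field_of_type\<^esub> u \<oplus>\<^bsub>field_of_type\<^esub> w"
      unfolding line_extension_mem_iff by blast
    moreover have "k \<otimes>\<^bsub>field_of_type\<^esub> u \<oplus>\<^bsub>field_of_type\<^esub> w = k * u + w"
      by (simp add: ring_of_type_algebra_def)
    ultimately have "k \<in> F" "w \<in> Span F Vs" "x = k * u + w" by auto
    then show ?case using Cons galois_set_hom[OF st(1)] galois_set_hom[OF st(2)] by simp
  qed
  define B where "B = (\<Union>u\<in>set Us. (\<lambda>\<sigma>. \<sigma> u) ` galois_set F)"
  have finB: "finite B" using fin UsE by (auto simp: B_def)
  have "inj_on (\<lambda>s. map s Us) ((\<lambda>\<sigma>. restrict \<sigma> E) ` galois_set F)"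
  proof (rule inj_onI)
    fix s t assume s: "s \<in> (\<lambda>\<sigma>. restrict \<sigma> E) ` galois_set F" and t: "t \<in> (\<lambda>\<sigma>. restrict \<sigma> E) ` galois_set F"
      and e: "map s Us = map t Us"
    obtain \<sigma> \<tau> where st: "\<sigma> \<in> galois_set F" "\<tau> \<in> galois_set F" "s = restrict \<sigma> E" "t = restrict \<tau> E"
      using s t by blast
    have "\<forall>u\<in>set Us. \<sigma> u = \<tau> u"
    proof
      fix u assume u: "u \<in> set Us"
      then have "s u = t u" "u \<in> E" using e UsE by auto
      then show "\<sigma> u = \<tau> u" by (simp add: st)
    qed
    then show "s = t" using agree[OF st(1,2)] Us st by (auto simp: restrict_def fun_eq_iff)
  qed
  moreover have "(\<lambda>s. map s Us) ` ((\<lambda>\<sigma>. restrict \<sigma> E) ` galois_set F) \<subseteq> {xs. set xs \<subseteq> B \<and> length xs = length Us}"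
    using UsE by (fastforce simp: B_def)
  ultimately show ?thesis
    using finite_lists_length_eq[OF finB] by (meson finite_imageD finite_subset)
qed

text \<open>The prime \<open>p\<close> is shared by all fields inside the separable closure and only
  the exponent \<open>b\<close> depends on \<open>K\<close>. Degrees over \<open>F\<close> and over
  \<open>E\<close> can then be compared as powers of \<open>p\<close>.\<close>

locale weil = sep_closed_residue_char +
  fixes K :: "'a set" and b :: nat
  assumes subfield_K: "subfield K field_of_type" and card_K: "residue_card K v = p ^ b" and b_pos: "b > 0"
begin

text \<open>Writing an integer exponent as a difference of natural numbers places one power of the
  residue cardinality on each side of the congruence, so later proofs need no distinction by
  sign.\<close>

lemma frobenius_power_iff:
  "frobenius_power K v \<sigma> (int j - int i) \<longleftrightarrow> p_frobenius \<sigma> (b * i) (b * j)"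
proof (cases "i \<le> j")
  case True
  then have "frobenius_power K v \<sigma> (int j - int i) \<longleftrightarrow> p_frobenius \<sigma> 0 (b * (j - i))"
    by (simp add: frobenius_power_def p_frobenius_def cong_v_def card_K nat_diff_distrib power_mult)
  also have "\<dots> \<longleftrightarrow> p_frobenius \<sigma> (0 + b * i) (b * (j - i) + b * i)"
    by (rule p_frobenius_shift[symmetric])
  also have "b * (j - i) + b * i = b * j" using True by (simp flip: distrib_left)
  finally show ?thesis by simp
next
  case False
  then have "frobenius_power K v \<sigma> (int j - int i) \<longleftrightarrow> p_frobenius \<sigma> (b * (i - j)) 0"
    by (simp add: frobenius_power_def p_frobenius_def cong_v_def card_K nat_diff_distrib power_mult)
  also have "\<dots> \<longleftrightarrow> p_frobenius \<sigma> (b * (i - j) + b * j) (0 + b * j)"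
    by (rule p_frobenius_shift[symmetric])
  also have "b * (i - j) + b * j = b * i" using False by (simp flip: distrib_left)
  finally show ?thesis by simp
qed

lemma int_eq_diff: "\<exists>i j. (n::int) = int j - int i"
  by (metis int_diff_cases)

lemma frobenius_power_unique:
  assumes "frobenius_power K v \<sigma> n" "frobenius_power K v \<sigma> m" shows "n = m"
proof -
  obtain i j i' j' where e: "n = int j - int i" "m = int j' - int i'" using int_eq_diff by metis
  then have "p_frobenius \<sigma> (b * i) (b * j)" "p_frobenius \<sigma> (b * i') (b * j')"
    using assms by (simp_all only: frobenius_power_iff)
  then have "b * i + b * j' = b * i' + b * j" by (rule p_frobenius_unique)
  then have "b * (i + j') = b * (i' + j)" by (simp add: distrib_left)
  then have "i + j' = i' + j" using b_pos by simp
  then show ?thesis using e by simp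
qed

definition wdeg :: "('a \<Rightarrow> 'a) \<Rightarrow> int" where "wdeg w = (THE n. frobenius_power K v w n)"

lemma wdeg_eq: "frobenius_power K v w n \<Longrightarrow> wdeg w = n"
  unfolding wdeg_def using frobenius_power_unique by blast

lemma weil_setD:
  assumes "w \<in> weil_set K v" shows "w \<in> galois_set K" "frobenius_power K v w (wdeg w)"
  using assms wdeg_eq by (auto simp: weil_set_def)

lemma weil_setI: "w \<in> galois_set K \<Longrightarrow> frobenius_power K v w n \<Longrightarrow> w \<in> weil_set K v"
  by (auto simp: weil_set_def)

lemma frobenius_power_comp:
  assumes "frobenius_power K v \<sigma> n" "frobenius_power K v \<tau> m" shows "frobenius_power K v (\<sigma> \<circ> \<tau>) (n + m)"
proof -
  obtain i j i' j' where e: "n = int j - int i" "m = int j' - int i'" using int_eq_diff by metis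
  then have "p_frobenius (\<sigma> \<circ> \<tau>) (b * i + b * i') (b * j + b * j')"
    using assms by (auto simp: frobenius_power_iff intro: p_frobenius_comp)
  then have "frobenius_power K v (\<sigma> \<circ> \<tau>) (int (j + j') - int (i + i'))"
    unfolding frobenius_power_iff by (simp add: distrib_left)
  moreover have "int (j + j') - int (i + i') = n + m" using e by simp
  ultimately show ?thesis by metis
qed

lemma frobenius_power_inv:
  assumes "frobenius_power K v \<sigma> n" "\<sigma> \<in> galois_set K"
  shows "frobenius_power K v (inv_into UNIV \<sigma>) (- n)"
proof -
  obtain i j where e: "n = int j - int i" using int_eq_diff by metis
  then have "p_frobenius (inv_into UNIV \<sigma>) (b * j) (b * i)"
    using assms by (auto simp: frobenius_power_iff intro: p_frobenius_inv)
  then have "frobenius_power K v (inv_into UNIV \<sigma>) (int i - int j)"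
    unfolding frobenius_power_iff .
  then show ?thesis by (simp add: e)
qed

lemma frobenius_power_id: "frobenius_power K v id 0"
  by (simp add: frobenius_power_def)

lemma weil_set_id [simp]: "id \<in> weil_set K v" and wdeg_id [simp]: "wdeg id = 0"
  using weil_setI[OF galois_set_closed(1) frobenius_power_id] wdeg_eq[OF frobenius_power_id] by auto

lemma weil_set_comp: "\<sigma> \<in> weil_set K v \<Longrightarrow> \<tau> \<in> weil_set K v \<Longrightarrow> \<sigma> \<circ> \<tau> \<in> weil_set K v"
  and wdeg_comp: "\<sigma> \<in> weil_set K v \<Longrightarrow> \<tau> \<in> weil_set K v \<Longrightarrow> wdeg (\<sigma> \<circ> \<tau>) = wdeg \<sigma> + wdeg \<tau>"
  using frobenius_power_comp weil_setD galois_set_closed(2) weil_setI wdeg_eq by meson+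

lemma weil_set_inv: "\<sigma> \<in> weil_set K v \<Longrightarrow> inv_into UNIV \<sigma> \<in> weil_set K v"
  and wdeg_inv: "\<sigma> \<in> weil_set K v \<Longrightarrow> wdeg (inv_into UNIV \<sigma>) = - wdeg \<sigma>"
  using frobenius_power_inv weil_setD galois_set_closed(3) weil_setI wdeg_eq by meson+

lemma inertia_iff: "\<sigma> \<in> inertia K v \<longleftrightarrow> \<sigma> \<in> weil_set K v \<and> wdeg \<sigma> = 0"
proof -
  have e: "frobenius_power K v \<sigma> 0 \<longleftrightarrow> (\<forall>x. v x \<le> 1 \<longrightarrow> v (\<sigma> x - x) < 1)"
    by (simp add: frobenius_power_def)
  show ?thesis
  proof
    assume "\<sigma> \<in> inertia K v"
    then have "\<sigma> \<in> galois_set K" "frobenius_power K v \<sigma> 0" by (auto simp: inertia_def e)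
    then show "\<sigma> \<in> weil_set K v \<and> wdeg \<sigma> = 0" using weil_setI wdeg_eq by blast
  next
    assume "\<sigma> \<in> weil_set K v \<and> wdeg \<sigma> = 0"
    then have "\<sigma> \<in> galois_set K" "frobenius_power K v \<sigma> 0" using weil_setD by metis+
    then show "\<sigma> \<in> inertia K v" by (auto simp: inertia_def e)
  qed
qed

lemma weil_group_simps [simp]:
  "carrier (weil_group K v) = weil_set K v" "\<sigma> \<otimes>\<^bsub>weil_group K v\<^esub> \<tau> = \<sigma> \<circ> \<tau>" "\<one>\<^bsub>weil_group K v\<^esub> = id"
  by (simp_all add: weil_group_def)

lemma weil_group: "group (weil_group K v)"
proof (rule groupI)
  fix \<sigma> assume "\<sigma> \<in> carrier (weil_group K v)"
  then show "\<exists>\<tau>\<in>carrier (weil_group K v). \<tau> \<otimes>\<^bsub>weil_group K v\<^esub> \<sigma> = \<one>\<^bsub>weil_group K v\<^esub>"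
    using weil_set_inv galois_inv(4)[OF weil_setD(1)] by (intro bexI[of _ "inv_into UNIV \<sigma>"]) auto
qed (auto intro: weil_set_comp simp: comp_assoc)

lemma weil_group_inv [simp]:
  assumes "\<sigma> \<in> weil_set K v" shows "inv\<^bsub>weil_group K v\<^esub> \<sigma> = inv_into UNIV \<sigma>"
  using assms weil_set_inv galois_inv(4)[OF weil_setD(1)]
  by (intro group.inv_equality[OF weil_group]) auto

lemma inertia_open: "w \<in> weil_set K v \<Longrightarrow> openin (weil_topology K v) ((\<lambda>u. w \<circ> u) ` inertia K v)"
proof -
  assume w: "w \<in> weil_set K v"
  have "inertia K v \<inter> galois_set K = inertia K v" by (auto simp: inertia_def)
  then show ?thesis
    unfolding weil_topology_def using w finite_extension_self[OF subfield_K]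
    by (intro topology_generated_by_Basis) (auto intro!: exI[of _ w] exI[of _ K])
qed

lemma topspace_weil [simp]: "topspace (weil_topology K v) = weil_set K v"
proof
  show "topspace (weil_topology K v) \<subseteq> weil_set K v"
    unfolding weil_topology_def topology_generated_by_topspace
    by (auto simp: inertia_iff intro: weil_set_comp)
  show "weil_set K v \<subseteq> topspace (weil_topology K v)"
  proof
    fix w assume w: "w \<in> weil_set K v"
    have "id \<in> inertia K v" by (simp add: inertia_iff)
    then have "w \<in> (\<lambda>u. w \<circ> u) ` inertia K v" by (intro image_eqI[of _ _ id]) auto
    then show "w \<in> topspace (weil_topology K v)" using openin_subset[OF inertia_open[OF w]] by blast
  qed
qed

section \<open>The abelianized Weil group and the valuation under reciprocity\<close>

definition commutator_closure :: "('a \<Rightarrow> 'a) set"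
  where "commutator_closure = weil_topology K v closure_of derived (weil_group K v) (weil_set K v)"

lemma commutator_closure: "id \<in> commutator_closure" "commutator_closure \<subseteq> weil_set K v"
proof -
  show "commutator_closure \<subseteq> weil_set K v"
    using closure_of_subset_topspace[of "weil_topology K v"] by (simp add: commutator_closure_def)
  have "id \<in> derived (weil_group K v) (weil_set K v)"
    using generate.one[of "weil_group K v"] by (simp add: derived_def)
  then show "id \<in> commutator_closure"
    unfolding commutator_closure_def closure_of_def by auto
qed

lemma weil_ab_simps:
  "carrier (weil_ab K v) = (\<lambda>w. (\<lambda>h. h \<circ> w) ` commutator_closure) ` weil_set K v"
  "C \<otimes>\<^bsub>weil_ab K v\<^esub> C' = {g \<circ> h | g h. g \<in> C \<and> h \<in> C'}"
  by (auto simp: weil_ab_def FactGroup_def RCOSETS_def r_coset_def set_mult_def commutator_closure_def)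

lemma weil_ab_coset:
  assumes "C \<in> carrier (weil_ab K v)" shows "C \<noteq> {}" "C \<subseteq> weil_set K v"
  using assms commutator_closure weil_set_comp by (auto simp: weil_ab_simps)

lemma weil_ab_cover: "w \<in> weil_set K v \<Longrightarrow> \<exists>C\<in>carrier (weil_ab K v). w \<in> C"
proof -
  assume "w \<in> weil_set K v"
  moreover have "w \<in> (\<lambda>h. h \<circ> w) ` commutator_closure"
    using commutator_closure(1) by (rule image_eqI[rotated]) simp
  ultimately show ?thesis unfolding weil_ab_simps by blast
qed

text \<open>The normalization, which only concerns uniformizers, suffices: multiply \<open>a\<close> by a power of \<open>\<pi>\<close>.\<close>

lemma reciprocity_valuation:
  assumes r: "r \<in> iso (mult_group K) (weil_ab K v)"
    and norm: "\<And>\<pi> w. uniformizer K v \<pi> \<Longrightarrow> w \<in> r \<pi> \<Longrightarrow> frobenius_power K v w 1"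
    and \<pi>: "uniformizer K v \<pi>" and a: "a \<in> K" "a \<noteq> 0" and w: "w \<in> r a"
  shows "v a = v \<pi> powi wdeg w"
proof -
  note Kf = subfield_facts[OF subfield_K]
  have \<pi>': "\<pi> \<in> K" "\<pi> \<noteq> 0" "v \<pi> < 1" "v \<pi> > 0" using \<pi> unfolding uniformizer_def by auto
  have closed: "r x \<in> carrier (weil_ab K v)" if "x \<in> K" "x \<noteq> 0" for x
    using r that by (auto simp: iso_def hom_def)
  have mult: "g \<circ> h \<in> r (x * y)" if "x \<in> K" "x \<noteq> 0" "y \<in> K" "y \<noteq> 0" "g \<in> r x" "h \<in> r y" for x y g h
  proof -
    have "r (x * y) = r x \<otimes>\<^bsub>weil_ab K v\<^esub> r y" using r that by (auto simp: iso_def hom_def)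
    then show ?thesis using that by (auto simp: weil_ab_simps)
  qed
  have W: "g \<in> weil_set K v" if "x \<in> K" "x \<noteq> 0" "g \<in> r x" for x g
    using weil_ab_coset(2)[OF closed[OF that(1,2)]] that by blast
  \<comment> \<open>Every element with the absolute value of \<open>\<pi>\<close> is itself a
    uniformizer, so the normalization gives degree 1 to its whole class.\<close>
  have unif: "uniformizer K v x" if "x \<in> K" "v x = v \<pi>" for x
    using \<pi> that by (simp add: uniformizer_def)
  have deg1: "wdeg g = 1" if "x \<in> K" "v x = v \<pi>" "g \<in> r x" for x g
    using norm[OF unif[OF that(1,2)] that(3)] by (rule wdeg_eq)
  obtain g where g: "g \<in> r \<pi>" using weil_ab_coset(1)[OF closed[OF \<pi>'(1,2)]] by blast
  have i\<pi>: "inverse \<pi> \<in> K" "inverse \<pi> \<noteq> 0" using Kf \<pi>' by auto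
  obtain g' where g': "g' \<in> r (inverse \<pi>)" using weil_ab_coset(1)[OF closed[OF i\<pi>]] by blast
  have g1: "wdeg g = 1" using deg1[OF \<pi>'(1) refl g] .
  \<comment> \<open>The normalization says nothing directly about the inverse of
    \<open>\<pi>\<close>. Its class has degree -1 because a product of one element of it and two of
    the class of \<open>\<pi>\<close> lies in the class of \<open>\<pi>\<close> again.\<close>
  have g'1: "wdeg g' = - 1"
  proof -
    have "(g' \<circ> g) \<circ> g \<in> r (inverse \<pi> * \<pi> * \<pi>)"
      using \<pi>' i\<pi> Kf g g' by (intro mult) auto
    then have "(g' \<circ> g) \<circ> g \<in> r \<pi>" using \<pi>' by simp
    then have "wdeg ((g' \<circ> g) \<circ> g) = 1" using deg1 \<pi>' by blast
    then show ?thesis using g1 W[OF \<pi>'(1,2) g] W[OF i\<pi> g'] by (simp add: wdeg_comp weil_set_comp)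
  qed
  have shift: "\<exists>h. h \<in> r (a * \<pi> powi k) \<and> wdeg h = wdeg w + k" for k
  proof (induction k rule: int_induct[where k = 0])
    case base then show ?case using w by auto
  next
    case (step1 k)
    then obtain h where h: "h \<in> r (a * \<pi> powi k)" "wdeg h = wdeg w + k" by blast
    have K: "a * \<pi> powi k \<in> K" "a * \<pi> powi k \<noteq> 0" using a \<pi>' Kf by auto
    have "h \<circ> g \<in> r (a * \<pi> powi k * \<pi>)" using K \<pi>' h g by (intro mult) auto
    moreover have "a * \<pi> powi k * \<pi> = a * \<pi> powi (k + 1)" using \<pi>' by (simp add: power_int_add)
    moreover have "wdeg (h \<circ> g) = wdeg w + (k + 1)"
      using wdeg_comp[OF W[OF K h(1)] W[OF \<pi>'(1,2) g]] h g1 by linarith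
    ultimately show ?case by metis
  next
    case (step2 k)
    then obtain h where h: "h \<in> r (a * \<pi> powi k)" "wdeg h = wdeg w + k" by blast
    have K: "a * \<pi> powi k \<in> K" "a * \<pi> powi k \<noteq> 0" using a \<pi>' Kf by auto
    have "h \<circ> g' \<in> r (a * \<pi> powi k * inverse \<pi>)" using K i\<pi> h g' by (intro mult) auto
    moreover have "a * \<pi> powi k * inverse \<pi> = a * \<pi> powi (k - 1)"
      using \<pi>' by (simp add: power_int_diff divide_inverse)
    moreover have "wdeg (h \<circ> g') = wdeg w + (k - 1)"
      using wdeg_comp[OF W[OF K h(1)] W[OF i\<pi> g']] h g'1 by linarith
    ultimately show ?case by metis
  qed
  obtain k where k: "v a = v \<pi> powi k" using uniformizer_valuation[OF subfield_K \<pi> a] by blast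
  \<comment> \<open>The exponent \<open>1 - k\<close> brings \<open>a\<close> to the absolute value
    of \<open>\<pi>\<close>, where the degree is known to be 1.\<close>
  obtain h where h: "h \<in> r (a * \<pi> powi (1 - k))" "wdeg h = wdeg w + (1 - k)" using shift by blast
  have "v (a * \<pi> powi (1 - k)) = v \<pi>" using k \<pi>' by (simp add: v_mult v_powi flip: power_int_add)
  moreover have "a * \<pi> powi (1 - k) \<in> K" using a \<pi>' Kf by auto
  ultimately have "wdeg h = 1" using deg1 h by blast
  then show ?thesis using h k by simp
qed

end

text \<open>Both sides are the exponent of \<open>p\<close> by which \<open>w\<close> acts on the
  residue field of the separable closure, and this exponent is unique.\<close>

lemma (in sep_closed_residue_char) wdeg_extension:
  assumes F: "weil v p F b" and E: "weil v p E c"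
    and w: "w \<in> weil_set F v" "w \<in> weil_set E v"
  shows "int b * weil.wdeg v F w = int c * weil.wdeg v E w"
proof -
  interpret F: weil v p F b by fact
  interpret E: weil v p E c by fact
  obtain i j i' j' where e: "F.wdeg w = int j - int i" "E.wdeg w = int j' - int i'" using F.int_eq_diff by metis
  have "p_frobenius w (b * i) (b * j)" "p_frobenius w (c * i') (c * j')"
    using F.weil_setD(2)[OF w(1)] E.weil_setD(2)[OF w(2)]
    unfolding e F.frobenius_power_iff E.frobenius_power_iff .
  then have "b * i + c * j' = c * i' + b * j" by (rule p_frobenius_unique)
  then have "int b * int i + int c * int j' = int c * int i' + int b * int j"
    by (metis of_nat_add of_nat_mult)
  then show ?thesis by (simp add: e algebra_simps)
qed

text \<open>An element of degree \<open>c * k\<close> over \<open>F\<close> raises residues to the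
  power with exponent \<open>b * c * k\<close> of \<open>p\<close>, which is \<open>b * k\<close>
  Frobenius steps over \<open>E\<close>. Divisibility by \<open>c\<close> is asked for rather than
  by the residue degree, so that \<open>b\<close> and \<open>c\<close> need not be related.\<close>

lemma (in sep_closed_residue_char) weil_set_extensionI:
  assumes F: "weil v p F b" and E: "weil v p E c"
    and w: "w \<in> weil_set F v" "w \<in> galois_set E" and d: "int c dvd weil.wdeg v F w"
  shows "w \<in> weil_set E v"
proof -
  interpret F: weil v p F b by fact
  interpret E: weil v p E c by fact
  obtain k where k: "F.wdeg w = int c * k" using d by blast
  obtain i j where e: "k = int j - int i" using F.int_eq_diff by metis
  have "frobenius_power F v w (int (c * j) - int (c * i))"
    using F.weil_setD(2)[OF w(1)] k by (simp add: e algebra_simps)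
  then have "p_frobenius w (c * (b * i)) (c * (b * j))"
    unfolding F.frobenius_power_iff by (simp add: mult.left_commute)
  then have "frobenius_power E v w (int (b * j) - int (b * i))" unfolding E.frobenius_power_iff .
  then show ?thesis using w E.weil_setI by blast
qed

section \<open>Split tori and their cocharacters\<close>

lemma function_algebra_in_subfield:
  assumes "subfield K field_of_type" "\<And>g. g \<in> G \<Longrightarrow> g x \<in> K" "h \<in> function_algebra K G"
  shows "h x \<in> K"
  using assms(3)
  by (induction rule: function_algebra.induct) (auto intro: assms(2) subfield_facts(3,4)[OF assms(1)])

lemma function_algebra_compose:
  assumes "h \<in> function_algebra K G" "K \<subseteq> K'" "\<And>g. g \<in> G \<Longrightarrow> (\<lambda>x. g (k x)) \<in> function_algebra K' G'"
  shows "(\<lambda>x. h (k x)) \<in> function_algebra K' G'"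
  using assms(1)
  by (induction rule: function_algebra.induct) (use assms in \<open>auto intro: function_algebra.intros\<close>)

lemma function_algebra_sum:
  "0 \<in> K \<Longrightarrow> (\<And>i. i \<in> A \<Longrightarrow> f i \<in> function_algebra K G) \<Longrightarrow>
    (\<lambda>x. \<Sum>i\<in>A. f i x) \<in> function_algebra K G"
  by (induction A rule: infinite_finite_induct) (auto intro: function_algebra.intros)

lemma function_algebra_prod:
  "1 \<in> K \<Longrightarrow> (\<And>i. i \<in> A \<Longrightarrow> f i \<in> function_algebra K G) \<Longrightarrow>
    (\<lambda>x. \<Prod>i\<in>A. f i x) \<in> function_algebra K G"
  by (induction A rule: infinite_finite_induct) (auto intro: function_algebra.intros)

definition laurent_functions :: "('a::field \<Rightarrow> 'a) set"
  where "laurent_functions = function_algebra UNIV {id, inverse}"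

lemma laurent_const: "(\<lambda>t. c) \<in> laurent_functions"
  and laurent_id: "(\<lambda>t. t) \<in> laurent_functions"
  and laurent_inverse: "inverse \<in> laurent_functions"
  and laurent_add: "f \<in> laurent_functions \<Longrightarrow> g \<in> laurent_functions \<Longrightarrow> (\<lambda>t. f t + g t) \<in> laurent_functions"
  and laurent_mult: "f \<in> laurent_functions \<Longrightarrow> g \<in> laurent_functions \<Longrightarrow> (\<lambda>t. f t * g t) \<in> laurent_functions"
  unfolding laurent_functions_def
  using function_algebra.gen[of id "{id, inverse}" UNIV]
  by (auto simp: id_def intro: function_algebra.intros)

lemma laurent_powi: "(\<lambda>t::'a::field. t powi k) \<in> laurent_functions"
proof -
  have pow: "(\<lambda>t. h t ^ n) \<in> laurent_functions" if "h \<in> laurent_functions" for h :: "'a \<Rightarrow> 'a" and n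
    using that by (induction n) (auto intro: laurent_const laurent_mult)
  show ?thesis
    using pow[OF laurent_id] pow[OF laurent_inverse] by (cases "0 \<le> k") (auto simp: power_int_def)
qed

lemma laurent_compose_inverse:
  "h \<in> laurent_functions \<Longrightarrow> (\<lambda>t. h (inverse t)) \<in> laurent_functions"
  unfolding laurent_functions_def
  using laurent_id laurent_inverse
  by (elim function_algebra_compose) (auto simp: laurent_functions_def)

lemma laurent_polynomial:
  assumes "h \<in> laurent_functions"
  shows "\<exists>n p. \<forall>t. t \<noteq> 0 \<longrightarrow> h t * t ^ n = poly p t"
  using assms unfolding laurent_functions_def
proof (induction rule: function_algebra.induct)
  case (const c) then show ?case by (intro exI[of _ 0] exI[of _ "[:c:]"]) simp
next
  case (gen g)
  then consider "g = id" | "g = inverse" by auto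
  then show ?case
  proof cases
    case 1 then show ?thesis by (intro exI[of _ 0] exI[of _ "[:0, 1:]"]) simp
  next
    case 2 then show ?thesis by (intro exI[of _ 1] exI[of _ "[:1:]"]) simp
  qed
next
  case (add f g)
  from add(3) obtain n p where e1: "\<And>t. t \<noteq> 0 \<Longrightarrow> f t * t ^ n = poly p t" by blast
  from add(4) obtain m q where e2: "\<And>t. t \<noteq> 0 \<Longrightarrow> g t * t ^ m = poly q t" by blast
  note e = e1 e2
  have "(f t + g t) * t ^ (n + m) = poly (p * Polynomial.monom 1 m + q * Polynomial.monom 1 n) t" if "t \<noteq> 0" for t
    by (simp add: poly_monom power_add algebra_simps flip: e(1)[OF that] e(2)[OF that])
  then show ?case by blast
next
  case (mult f g)
  from mult(3) obtain n p where e1: "\<And>t. t \<noteq> 0 \<Longrightarrow> f t * t ^ n = poly p t" by blast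
  from mult(4) obtain m q where e2: "\<And>t. t \<noteq> 0 \<Longrightarrow> g t * t ^ m = poly q t" by blast
  note e = e1 e2
  have "(f t * g t) * t ^ (n + m) = poly (p * q) t" if "t \<noteq> 0" for t
    by (simp add: power_add algebra_simps flip: e(1)[OF that] e(2)[OF that])
  then show ?case by blast
qed

text \<open>With \<open>t ^ n * h t = p t\<close>, the equation \<open>h t * h (inverse t) = 1\<close> says that the product of
  \<open>p\<close> and its reflection is a monomial of the degree of \<open>p\<close>, so the reflection is constant.\<close>

lemma multiplicative_laurent_power:
  fixes h :: "'a::field \<Rightarrow> 'a"
  assumes inf: "infinite (UNIV :: 'a set)" and "h \<in> laurent_functions"
    and mult: "\<And>s t. s \<noteq> 0 \<Longrightarrow> t \<noteq> 0 \<Longrightarrow> h (s * t) = h s * h t" and h1: "h 1 = 1"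
  shows "\<exists>k. \<forall>t. t \<noteq> 0 \<longrightarrow> h t = t powi k"
proof -
  obtain n p where p: "\<And>t. t \<noteq> 0 \<Longrightarrow> h t * t ^ n = poly p t"
    using laurent_polynomial[OF assms(2)] by blast
  define d where "d = Polynomial.degree p"
  have eq: "poly (p * reflect_poly p) t = poly (Polynomial.monom 1 d) t" if t: "t \<noteq> 0" for t
  proof -
    have "poly (reflect_poly p) t = t ^ d * (h (inverse t) * inverse t ^ n)"
      using t p[of "inverse t"] by (simp add: poly_reflect_poly_nz d_def)
    then have "poly (p * reflect_poly p) t = (h t * h (inverse t)) * (t ^ n * inverse t ^ n) * t ^ d"
      using p[OF t] by (simp add: algebra_simps flip: p[OF t])
    also have "h t * h (inverse t) = 1" using mult[of t "inverse t"] t h1 by simp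
    also have "t ^ n * inverse t ^ n = 1" using t by (simp flip: power_mult_distrib)
    finally show ?thesis by (simp add: poly_monom)
  qed
  have "p * reflect_poly p = Polynomial.monom 1 d"
  proof (rule ccontr)
    assume "p * reflect_poly p \<noteq> Polynomial.monom 1 d"
    then have "finite {t. poly (p * reflect_poly p - Polynomial.monom 1 d) t = 0}"
      by (intro poly_roots_finite) simp
    moreover have "UNIV - {0} \<subseteq> {t. poly (p * reflect_poly p - Polynomial.monom 1 d) t = 0}"
      using eq by auto
    ultimately have "finite (UNIV - {0::'a})" by (rule finite_subset[rotated])
    then show False using inf by simp
  qed
  moreover from this have nz: "p \<noteq> 0" "reflect_poly p \<noteq> 0" by (auto simp: monom_eq_0_iff)
  ultimately have "d + Polynomial.degree (reflect_poly p) = d"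
    using degree_mult_eq[OF nz] by (simp add: d_def degree_monom_eq)
  then obtain c where c: "reflect_poly p = [:c:]" by (metis add_left_cancel add.right_neutral degree_eq_zeroE)
  have ct: "poly p t * c = t ^ d" if "t \<noteq> 0" for t
    using eq[OF that] by (simp add: c poly_monom algebra_simps)
  then have "poly p 1 * c = 1" by simp
  moreover have "poly p 1 = 1" using p[of 1] h1 by simp
  ultimately have "c = 1" by simp
  have "h t = t powi (int d - int n)" if "t \<noteq> 0" for t
    using p[OF that] ct[OF that] that \<open>c = 1\<close> by (simp add: power_int_diff field_simps)
  then show ?thesis by blast
qed

lemma det_in_subfield:
  fixes A :: "'a::field^'n^'n"
  assumes "subfield K field_of_type" "\<And>i j. A $ i $ j \<in> K" shows "det A \<in> K"
proof -
  note K = subfield_facts[OF assms(1)]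
  have sum: "sum g B \<in> K" if "\<And>i. i \<in> B \<Longrightarrow> g i \<in> K" for g and B :: "('n \<Rightarrow> 'n) set"
    using that by (induction B rule: infinite_finite_induct) (auto intro: K)
  have prod: "prod g B \<in> K" if "\<And>i. i \<in> B \<Longrightarrow> g i \<in> K" for g and B :: "'n set"
    using that by (induction B rule: infinite_finite_induct) (auto intro: K)
  show ?thesis unfolding det_def
    by (intro sum K(4) prod assms) (auto simp: sign_def intro: K)
qed

text \<open>The columns of the inverse solve linear systems over \<open>K\<close>, and Cramer's rule
  writes their entries as quotients of determinants over \<open>K\<close>.\<close>

lemma inverse_in_subfield:
  fixes A B :: "'a::field^'n^'n"
  assumes K: "subfield K field_of_type" and A: "\<And>i j. A $ i $ j \<in> K" and AB: "A ** B = mat 1"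
  shows "B $ i $ j \<in> K"
proof -
  have "det A * det B = 1" using AB by (metis det_I det_mul)
  then have nz: "det A \<noteq> 0" by auto
  have "A *v column j B = axis j 1"
    using AB by (simp add: vec_eq_iff matrix_vector_mult_def matrix_matrix_mult_def column_def axis_def mat_def)
  then have "column j B = (\<chi> k. det (\<chi> i l. if l = k then axis j 1 $ i else A $ i $ l) / det A)"
    using cramer[OF nz] by blast
  then have 1: "B $ i $ j = det (\<chi> m l. if l = i then axis j 1 $ m else A $ m $ l) / det A"
    by (simp add: column_def vec_eq_iff)
  have 2: "det (\<chi> m l. if l = i then axis j 1 $ m else A $ m $ l) \<in> K"
    using A subfield_facts(1,2)[OF K] by (intro det_in_subfield K) (simp add: axis_def)
  show ?thesis unfolding 1 by (rule subfield_facts(8)[OF K 2 det_in_subfield[OF K A]])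
qed

lemma map_matrix_mult:
  assumes "\<sigma> \<in> galois_set K" shows "map_matrix \<sigma> (A ** B) = map_matrix \<sigma> A ** map_matrix \<sigma> B"
  by (simp add: vec_eq_iff matrix_matrix_mult_def map_matrix_def galois_set_hom[OF assms])

lemma map_matrix_one:
  assumes "\<sigma> \<in> galois_set K" shows "map_matrix \<sigma> (mat 1) = mat 1"
  by (simp add: vec_eq_iff mat_def map_matrix_def galois_set_hom[OF assms])

text \<open>Fixes the rank \<open>r\<close> and the isomorphism \<open>f\<close> hidden in
  \<open>splits_over S E\<close>. The infinite ambient field ensures that a Laurent monomial is
  determined by its values.\<close>

locale split_torus =
  fixes S :: "('a::field^'n^'n) set" and E :: "'a set" and r :: nat
    and f :: "(nat \<Rightarrow> 'a) \<Rightarrow> 'a^'n^'n"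
  assumes subfield_E: "subfield E field_of_type" and infinite_field: "infinite (UNIV :: 'a set)"
    and S_invertible: "A \<in> S \<Longrightarrow> invertible A"
    and f_bij: "bij_betw f (Gm_pow r) S"
    and f_mult: "s \<in> Gm_pow r \<Longrightarrow> t \<in> Gm_pow r \<Longrightarrow> f (\<lambda>i. s i * t i) = f s ** f t"
    and f_regular: "\<exists>h\<in>regular_on_Gm_pow E r. \<forall>t\<in>Gm_pow r. f t $ i $ j = h t"
    and f_inv_regular: "k < r \<Longrightarrow> \<exists>h\<in>regular_on_GL E. \<forall>t\<in>Gm_pow r. h (f t) = t k"
begin

definition coord :: "'a^'n^'n \<Rightarrow> nat \<Rightarrow> 'a" where "coord = inv_into (Gm_pow r) f"

lemma f_in_S: "t \<in> Gm_pow r \<Longrightarrow> f t \<in> S"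
  using f_bij by (auto simp: bij_betw_def)

lemma coord_f: "t \<in> Gm_pow r \<Longrightarrow> coord (f t) = t"
  unfolding coord_def using f_bij by (intro inv_into_f_f) (auto simp: bij_betw_def)

lemma f_coord: "A \<in> S \<Longrightarrow> f (coord A) = A"
  unfolding coord_def using f_bij by (intro f_inv_into_f) (auto simp: bij_betw_def)

lemma coord_Gm: "A \<in> S \<Longrightarrow> coord A \<in> Gm_pow r"
  unfolding coord_def using f_bij by (intro inv_into_into) (auto simp: bij_betw_def)

lemma coord_nonzero: "A \<in> S \<Longrightarrow> coord A k \<noteq> 0"
  using coord_Gm[of A] by (cases "k < r") (auto simp: Gm_pow_def)

lemma coord_beyond: "A \<in> S \<Longrightarrow> k \<ge> r \<Longrightarrow> coord A k = 1"
  using coord_Gm[of A] by (auto simp: Gm_pow_def)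

lemma coord_eqI: "A \<in> S \<Longrightarrow> B \<in> S \<Longrightarrow> (\<And>k. k < r \<Longrightarrow> coord A k = coord B k) \<Longrightarrow> A = B"
  using f_coord coord_beyond by (metis ext not_le)

lemma Gm_mult: "s \<in> Gm_pow r \<Longrightarrow> t \<in> Gm_pow r \<Longrightarrow> (\<lambda>i. s i * t i) \<in> Gm_pow r"
  and Gm_one: "(\<lambda>i. 1) \<in> Gm_pow r" and Gm_inverse: "t \<in> Gm_pow r \<Longrightarrow> (\<lambda>i. inverse (t i)) \<in> Gm_pow r"
  by (auto simp: Gm_pow_def)

lemma S_mult: "A \<in> S \<Longrightarrow> B \<in> S \<Longrightarrow> A ** B \<in> S"
  and coord_mult: "A \<in> S \<Longrightarrow> B \<in> S \<Longrightarrow> coord (A ** B) k = coord A k * coord B k"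
proof -
  assume AB: "A \<in> S" "B \<in> S"
  then have e: "A ** B = f (\<lambda>i. coord A i * coord B i)"
    by (simp add: f_mult coord_Gm f_coord)
  show "A ** B \<in> S" "coord (A ** B) k = coord A k * coord B k"
    unfolding e using AB by (simp_all add: f_in_S coord_f Gm_mult coord_Gm)
qed

lemma f_one: "f (\<lambda>i. 1) = mat 1"
proof -
  have "f (\<lambda>i. 1) ** f (\<lambda>i. 1) = f (\<lambda>i. 1)" using f_mult[OF Gm_one Gm_one] by simp
  moreover obtain B where "B ** f (\<lambda>i. 1) = mat 1"
    using S_invertible[OF f_in_S[OF Gm_one]] by (auto simp: invertible_def)
  ultimately show ?thesis by (metis matrix_mul_assoc matrix_mul_lid)
qed

lemma S_one: "mat 1 \<in> S" and coord_one: "coord (mat 1) k = 1"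
  using f_in_S[OF Gm_one] coord_f[OF Gm_one] by (simp_all add: f_one)

lemma S_inverse: "A \<in> S \<Longrightarrow> \<exists>B\<in>S. A ** B = mat 1 \<and> B ** A = mat 1"
proof -
  assume A: "A \<in> S"
  let ?B = "f (\<lambda>i. inverse (coord A i))"
  have "A ** ?B = f (\<lambda>i. coord A i * inverse (coord A i))"
    using f_mult[OF coord_Gm[OF A] Gm_inverse[OF coord_Gm[OF A]]] A by (simp add: f_coord)
  then have "A ** ?B = mat 1" using A by (simp add: coord_nonzero f_one)
  then show ?thesis
    using A f_in_S[OF Gm_inverse[OF coord_Gm[OF A]]] matrix_left_right_inverse by blast
qed

lemma S_commute: "A \<in> S \<Longrightarrow> B \<in> S \<Longrightarrow> A ** B = B ** A"
  by (rule coord_eqI) (simp_all add: S_mult coord_mult mult.commute)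

lemma torus_points_simps [simp]:
  "carrier (torus_points S K) = {A \<in> S. \<forall>i j. A $ i $ j \<in> K}"
  "A \<otimes>\<^bsub>torus_points S K\<^esub> B = A ** B" "\<one>\<^bsub>torus_points S K\<^esub> = mat 1"
  by (simp_all add: torus_points_def)

lemma torus_points_comm_group:
  assumes K: "subfield K field_of_type" shows "comm_group (torus_points S K)"
proof (rule comm_groupI)
  note Kf = subfield_facts[OF K]
  have sum: "sum g B \<in> K" if "\<And>i. g i \<in> K" for g and B :: "'n set"
    using that by (induction B rule: infinite_finite_induct) (auto intro: Kf)
  show "A \<otimes>\<^bsub>torus_points S K\<^esub> B \<in> carrier (torus_points S K)"
    if "A \<in> carrier (torus_points S K)" "B \<in> carrier (torus_points S K)" for A B
  proof -
    have "(A ** B) $ i $ j \<in> K" for i j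
      using that by (auto simp: matrix_matrix_mult_def intro!: sum Kf(4))
    then show ?thesis using that by (auto simp: S_mult)
  qed
  have "(mat 1 :: 'a^'n^'n) $ i $ j \<in> K" for i j by (simp add: mat_def Kf)
  then show "\<one>\<^bsub>torus_points S K\<^esub> \<in> carrier (torus_points S K)" by (simp add: S_one)
  show "\<exists>B\<in>carrier (torus_points S K). B \<otimes>\<^bsub>torus_points S K\<^esub> A = \<one>\<^bsub>torus_points S K\<^esub>"
    if A: "A \<in> carrier (torus_points S K)" for A
  proof -
    obtain B where B: "B \<in> S" "A ** B = mat 1" "B ** A = mat 1" using S_inverse[of A] A by auto
    have "B $ i $ j \<in> K" for i j using A by (intro inverse_in_subfield[OF K _ B(2)]) auto
    then show ?thesis using B by (intro bexI[of _ B]) auto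
  qed
  show "A \<otimes>\<^bsub>torus_points S K\<^esub> B = B \<otimes>\<^bsub>torus_points S K\<^esub> A"
    if "A \<in> carrier (torus_points S K)" "B \<in> carrier (torus_points S K)" for A B
    using that S_commute[of A B] by simp
qed (simp_all add: matrix_mul_assoc)

lemma coord_in_subfield:
  assumes "A \<in> carrier (torus_points S E)" shows "coord A k \<in> E"
proof (cases "k < r")
  case True
  have A: "A \<in> S" "\<And>i j. A $ i $ j \<in> E" using assms by auto
  obtain h where h: "h \<in> regular_on_GL E" "\<And>t. t \<in> Gm_pow r \<Longrightarrow> h (f t) = t k"
    using f_inv_regular[OF True] by blast
  have "inverse (det A) \<in> E"
    by (intro subfield_facts(7)[OF subfield_E] det_in_subfield[OF subfield_E] A)
  then have "h A \<in> E"
    using function_algebra_in_subfield[OF subfield_E _ h(1)[unfolded regular_on_GL_def], of A] A by auto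
  then show ?thesis using h(2)[OF coord_Gm[OF A(1)]] A by (simp add: f_coord)
next
  case False
  then show ?thesis using assms subfield_facts(2)[OF subfield_E] by (auto simp: coord_beyond)
qed

lemma f_in_torus_points:
  assumes "t \<in> Gm_pow r" "\<And>k. t k \<in> E" shows "f t \<in> carrier (torus_points S E)"
proof -
  have "f t $ i $ j \<in> E" for i j
  proof -
    obtain h where h: "h \<in> regular_on_Gm_pow E r" "\<And>t. t \<in> Gm_pow r \<Longrightarrow> f t $ i $ j = h t"
      using f_regular by blast
    have "h t \<in> E"
      using h(1) unfolding regular_on_Gm_pow_def
      by (rule function_algebra_in_subfield[OF subfield_E, rotated])
        (use assms subfield_facts[OF subfield_E] in auto)
    then show ?thesis using h(2) assms by simp
  qed
  then show ?thesis using f_in_S assms by auto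
qed

text \<open>The entries of \<open>f\<close> are regular functions with coefficients in
  \<open>E\<close>, and those coefficients are fixed by \<open>\<sigma>\<close>. It is the reason
  why the Galois group of \<open>E\<close> acts trivially on cocharacters.\<close>

lemma galois_f:
  assumes \<sigma>: "\<sigma> \<in> galois_set E" and t: "t \<in> Gm_pow r"
  shows "map_matrix \<sigma> (f t) = f (\<lambda>i. \<sigma> (t i))"
proof -
  have st: "(\<lambda>i. \<sigma> (t i)) \<in> Gm_pow r" using t by (auto simp: Gm_pow_def galois_set_hom[OF \<sigma>])
  have "\<sigma> (f t $ i $ j) = f (\<lambda>i. \<sigma> (t i)) $ i $ j" for i j
  proof -
    obtain h where h: "h \<in> regular_on_Gm_pow E r" "\<And>t. t \<in> Gm_pow r \<Longrightarrow> f t $ i $ j = h t"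
      using f_regular by blast
    have "\<sigma> (h t) = h (\<lambda>i. \<sigma> (t i))"
      using h(1) unfolding regular_on_Gm_pow_def
      by (induction rule: function_algebra.induct) (auto simp: galois_set_hom[OF \<sigma>])
    then show ?thesis using h(2) t st by simp
  qed
  then show ?thesis by (simp add: vec_eq_iff map_matrix_def)
qed

end

lemma laurent_galois:
  assumes \<sigma>: "\<sigma> \<in> galois_set K" and "h \<in> laurent_functions"
  shows "(\<lambda>t. \<sigma> (h (inv_into UNIV \<sigma> t))) \<in> laurent_functions"
  using assms(2)[unfolded laurent_functions_def]
proof (induction rule: function_algebra.induct)
  case (gen g)
  then consider "g = id" | "g = inverse" by auto
  then show ?case
  proof cases
    case 1 then show ?thesis using laurent_id by (simp add: galois_inv(1)[OF \<sigma>])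
  next
    case 2 then show ?thesis
      using laurent_inverse by (simp add: galois_inv(1)[OF \<sigma>] galois_set_hom(8)[OF \<sigma>])
  qed
qed (auto simp: galois_set_hom[OF \<sigma>] intro: laurent_const laurent_add laurent_mult)

lemma powi_inject:
  assumes inf: "infinite (UNIV :: 'a::field set)" and e: "\<And>t::'a. t \<noteq> 0 \<Longrightarrow> t powi n = t powi m"
  shows "n = m"
proof -
  have "n \<le> m" if e: "\<And>t::'a. t \<noteq> 0 \<Longrightarrow> t powi n = t powi m" for n m
  proof (rule ccontr)
    assume "\<not> n \<le> m"
    define k where "k = nat (n - m)"
    have k: "k > 0" "n = m + int k" using \<open>\<not> n \<le> m\<close> by (auto simp: k_def)
    have "t ^ k = 1" if "t \<noteq> 0" for t :: 'a using e[OF that] that by (simp add: k power_int_add)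
    then have "UNIV - {0} \<subseteq> {t. poly (Polynomial.monom 1 k - 1) t = (0::'a)}" by (auto simp: poly_monom)
    moreover have "Polynomial.monom 1 k \<noteq> (1 :: 'a poly)"
      using k degree_monom_eq[of "1::'a" k] by (metis degree_1 less_irrefl one_neq_zero)
    then have "finite {t. poly (Polynomial.monom 1 k - 1) t = (0::'a)}" by (intro poly_roots_finite) simp
    ultimately have "finite (UNIV - {0::'a})" by (rule finite_subset)
    then show False using inf by simp
  qed
  from this[of n m] this[of m n] e show ?thesis by force
qed

lemma cochar_group_simps:
  "\<mu> \<otimes>\<^bsub>cochar_group S\<^esub> \<nu> = (\<lambda>t\<in>- {0}. \<mu> t ** \<nu> t)"
  "\<one>\<^bsub>cochar_group S\<^esub> = (\<lambda>t\<in>- {0}. mat 1)"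
  by (simp_all add: cochar_group_def)

lemma cochar_groupD:
  fixes \<mu> :: "'a::field \<Rightarrow> 'a^'n^'n"
  assumes "\<mu> \<in> carrier (cochar_group S)"
  shows "\<mu> \<in> extensional (- {0})" "t \<noteq> 0 \<Longrightarrow> \<mu> t \<in> S"
    "s \<noteq> 0 \<Longrightarrow> t \<noteq> 0 \<Longrightarrow> \<mu> (s * t) = \<mu> s ** \<mu> t"
    "\<exists>h\<in>laurent_functions. \<forall>t. t \<noteq> 0 \<longrightarrow> \<mu> t $ i $ j = h t"
  using assms by (auto simp: cochar_group_def PiE_iff laurent_functions_def)

context split_torus
begin

definition cochar :: "(nat \<Rightarrow> int) \<Rightarrow> 'a \<Rightarrow> 'a^'n^'n"
  where "cochar n = (\<lambda>t\<in>- {0}. f (\<lambda>i. if i < r then t powi n i else 1))"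

lemma powi_Gm: "t \<noteq> 0 \<Longrightarrow> (\<lambda>i. if i < r then t powi n i else 1) \<in> Gm_pow r"
  by (auto simp: Gm_pow_def)

lemma cochar_closed: "cochar n \<in> carrier (cochar_group S)"
proof -
  have "\<exists>h\<in>laurent_functions. \<forall>t. t \<noteq> 0 \<longrightarrow> cochar n t $ i $ j = h t" for i j
  proof -
    obtain h where h: "h \<in> regular_on_Gm_pow E r" "\<And>t. t \<in> Gm_pow r \<Longrightarrow> f t $ i $ j = h t"
      using f_regular by blast
    have "(\<lambda>t. h (\<lambda>i. if i < r then t powi n i else 1)) \<in> laurent_functions"
      using h(1) unfolding regular_on_Gm_pow_def laurent_functions_def
    proof (rule function_algebra_compose)
      fix g :: "(nat \<Rightarrow> 'a) \<Rightarrow> 'a" assume "g \<in> {\<lambda>t. t i |i. i < r} \<union> {\<lambda>t. inverse (t i) |i. i < r}"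
      then obtain k where "k < r" "g = (\<lambda>t. t k) \<or> g = (\<lambda>t. inverse (t k))" by blast
      then show "(\<lambda>t. g (\<lambda>i. if i < r then t powi n i else 1)) \<in> function_algebra UNIV {id, inverse}"
        unfolding laurent_functions_def[symmetric]
        using laurent_powi[of "n k"] laurent_powi[of "- n k"] by (elim disjE) (simp_all add: power_int_minus)
    qed simp
    then show ?thesis using h(2)[OF powi_Gm] by (intro bexI) (auto simp: cochar_def)
  qed
  moreover have "cochar n (s * t) = cochar n s ** cochar n t" if "s \<noteq> 0" "t \<noteq> 0" for s t
    using that f_mult[OF powi_Gm[of s n] powi_Gm[of t n]]
    by (simp add: cochar_def power_int_mult_distrib if_distrib cong: if_cong)
  moreover have "cochar n t \<in> S" if "t \<noteq> 0" for t
    using that f_in_S[OF powi_Gm] by (simp add: cochar_def)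
  ultimately show ?thesis
    unfolding cochar_group_def laurent_functions_def[symmetric] by (auto simp: cochar_def PiE_iff)
qed

lemma coord_cochar: "t \<noteq> 0 \<Longrightarrow> k < r \<Longrightarrow> coord (cochar n t) k = t powi n k"
  using coord_f[OF powi_Gm[of t n]] by (simp add: cochar_def)

lemma cochar_of_one:
  assumes "\<mu> \<in> carrier (cochar_group S)" shows "\<mu> 1 = mat 1"
proof -
  have "\<mu> 1 \<in> S" "\<mu> 1 ** \<mu> 1 = \<mu> 1" using cochar_groupD(2,3)[OF assms, of 1] by auto
  then show ?thesis using S_inverse by (metis matrix_mul_assoc matrix_mul_lid)
qed

text \<open>A coordinate is regular on the matrix group, so along \<open>\<mu>\<close> it becomes a
  Laurent function of \<open>t\<close>. It is multiplicative as well, and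
  \<open>multiplicative_laurent_power\<close> leaves only monomials.\<close>

lemma coord_cochar_power:
  assumes \<mu>: "\<mu> \<in> carrier (cochar_group S)" and k: "k < r"
  shows "\<exists>n. \<forall>t. t \<noteq> 0 \<longrightarrow> coord (\<mu> t) k = t powi n"
proof -
  note \<mu>D = cochar_groupD[OF \<mu>]
  obtain h where h: "h \<in> regular_on_GL E" "\<And>t. t \<in> Gm_pow r \<Longrightarrow> h (f t) = t k"
    using f_inv_regular[OF k] by blast
  have hS: "h A = coord A k" if "A \<in> S" for A
    using h(2)[OF coord_Gm[OF that]] by (simp add: f_coord that)
  define e where "e i j = (SOME h. h \<in> laurent_functions \<and> (\<forall>t. t \<noteq> 0 \<longrightarrow> \<mu> t $ i $ j = h t))" for i j
  have e: "e i j \<in> laurent_functions" "t \<noteq> 0 \<Longrightarrow> \<mu> t $ i $ j = e i j t" for i j t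
  proof -
    have "\<exists>h. h \<in> laurent_functions \<and> (\<forall>t. t \<noteq> 0 \<longrightarrow> \<mu> t $ i $ j = h t)"
      using \<mu>D(4)[of i j] by blast
    from someI_ex[OF this] show "e i j \<in> laurent_functions" "t \<noteq> 0 \<Longrightarrow> \<mu> t $ i $ j = e i j t"
      unfolding e_def[symmetric] by auto
  qed
  \<comment> \<open>The inverse determinant is the generator whose composite with
    \<open>\<mu>\<close> is not visibly Laurent. Multiplicativity of \<open>\<mu>\<close> turns it
    into the determinant at the inverse argument.\<close>
  have inv: "inverse (det (\<mu> t)) = det (\<mu> (inverse t))" if "t \<noteq> 0" for t
  proof -
    have "\<mu> t ** \<mu> (inverse t) = mat 1" using \<mu>D(3)[of t "inverse t"] that cochar_of_one[OF \<mu>] by simp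
    then have "det (\<mu> t) * det (\<mu> (inverse t)) = 1" by (metis det_I det_mul)
    then show ?thesis by (rule inverse_unique)
  qed
  have "\<exists>g\<in>laurent_functions. \<forall>t. t \<noteq> 0 \<longrightarrow> h (\<mu> t) = g t"
    using h(1) unfolding regular_on_GL_def
  proof (induction rule: function_algebra.induct)
    case (const c) then show ?case by (intro bexI[of _ "\<lambda>_. c"]) (auto intro: laurent_const)
  next
    case (gen g)
    then consider i j where "g = (\<lambda>A. A $ i $ j)" | "g = (\<lambda>A. inverse (det A))" by blast
    then show ?case
    proof cases
      case 1 then show ?thesis using e by (intro bexI[of _ "e i j"]) auto
    next
      case 2
      have eD: "(\<lambda>t. \<Sum>p | p permutes UNIV. of_int (sign p) * (\<Prod>i\<in>UNIV. e i (p i) (inverse t))) \<in> laurent_functions"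
        unfolding laurent_functions_def
        by (intro function_algebra_sum function_algebra.mult function_algebra.const function_algebra_prod
            laurent_compose_inverse[unfolded laurent_functions_def] e[unfolded laurent_functions_def]) auto
      have "g (\<mu> t) = (\<Sum>p | p permutes UNIV. of_int (sign p) * (\<Prod>i\<in>UNIV. e i (p i) (inverse t)))"
        if "t \<noteq> 0" for t
        using that by (simp add: 2 inv det_def[of "\<mu> (inverse t)"] e(2))
      then show ?thesis by (intro bexI[OF _ eD]) simp
    qed
  next
    case (add g1 g2)
    then obtain k1 k2 where "k1 \<in> laurent_functions" "k2 \<in> laurent_functions"
      "\<forall>t. t \<noteq> 0 \<longrightarrow> g1 (\<mu> t) = k1 t" "\<forall>t. t \<noteq> 0 \<longrightarrow> g2 (\<mu> t) = k2 t" by auto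
    then show ?case by (intro bexI[of _ "\<lambda>t. k1 t + k2 t"]) (auto intro: laurent_add)
  next
    case (mult g1 g2)
    then obtain k1 k2 where "k1 \<in> laurent_functions" "k2 \<in> laurent_functions"
      "\<forall>t. t \<noteq> 0 \<longrightarrow> g1 (\<mu> t) = k1 t" "\<forall>t. t \<noteq> 0 \<longrightarrow> g2 (\<mu> t) = k2 t" by auto
    then show ?case by (intro bexI[of _ "\<lambda>t. k1 t * k2 t"]) (auto intro: laurent_mult)
  qed
  then obtain g where g: "g \<in> laurent_functions" and g': "\<And>t. t \<noteq> 0 \<Longrightarrow> h (\<mu> t) = g t"
    by blast
  have g2: "coord (\<mu> t) k = g t" if "t \<noteq> 0" for t
    using g'[OF that] hS[OF \<mu>D(2)[OF that]] by simp
  note g = g g2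
  have "\<exists>n. \<forall>t. t \<noteq> 0 \<longrightarrow> g t = t powi n"
  proof (rule multiplicative_laurent_power[OF infinite_field g(1)])
    show "g (s * t) = g s * g t" if "s \<noteq> 0" "t \<noteq> 0" for s t
      using that g(2)[of "s * t"] \<mu>D(2,3) by (simp add: coord_mult g(2))
    show "g 1 = 1" using g(2)[of 1] cochar_of_one[OF \<mu>] coord_one by simp
  qed
  then show ?thesis using g(2) by simp
qed

definition expo :: "('a \<Rightarrow> 'a^'n^'n) \<Rightarrow> nat \<Rightarrow> int"
  where "expo \<mu> k = (THE n. \<forall>t. t \<noteq> 0 \<longrightarrow> coord (\<mu> t) k = t powi n)"

lemma coord_expo:
  assumes "\<mu> \<in> carrier (cochar_group S)" "t \<noteq> 0" "k < r"
  shows "coord (\<mu> t) k = t powi expo \<mu> k"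
proof -
  have "\<exists>!n. \<forall>t. t \<noteq> 0 \<longrightarrow> coord (\<mu> t) k = t powi n"
    using coord_cochar_power[OF assms(1,3)] powi_inject[OF infinite_field] by metis
  from theI'[OF this] show ?thesis using assms(2) unfolding expo_def by blast
qed

lemma expo_cochar: "k < r \<Longrightarrow> expo (cochar n) k = n k"
  using coord_expo[OF cochar_closed, of _ k n] coord_cochar[of _ k n]
  by (intro powi_inject[OF infinite_field]) auto

lemma cochar_eqI:
  assumes "\<mu> \<in> carrier (cochar_group S)" "\<nu> \<in> carrier (cochar_group S)"
    and "\<And>k. k < r \<Longrightarrow> expo \<mu> k = expo \<nu> k"
  shows "\<mu> = \<nu>"
proof (rule extensionalityI)
  show "\<mu> \<in> extensional (- {0})" "\<nu> \<in> extensional (- {0})" using assms cochar_groupD(1) by auto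
  fix t :: 'a assume "t \<in> - {0}"
  then show "\<mu> t = \<nu> t"
    using assms cochar_groupD(2) by (intro coord_eqI) (auto simp: coord_expo)
qed

lemma cochar_expo: "\<mu> \<in> carrier (cochar_group S) \<Longrightarrow> cochar (expo \<mu>) = \<mu>"
  by (rule cochar_eqI) (auto simp: cochar_closed expo_cochar)

lemma cochar_mult: "cochar n \<otimes>\<^bsub>cochar_group S\<^esub> cochar m = cochar (\<lambda>k. n k + m k)"
proof (rule extensionalityI[of _ "- {0}"])
  fix t :: 'a assume t: "t \<in> - {0}"
  have "coord (cochar n t ** cochar m t) k = coord (cochar (\<lambda>k. n k + m k) t) k" if "k < r" for k
    using t that cochar_groupD(2)[OF cochar_closed] by (simp add: coord_mult coord_cochar power_int_add)
  then have "cochar n t ** cochar m t = cochar (\<lambda>k. n k + m k) t"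
    using t cochar_groupD(2)[OF cochar_closed] S_mult by (intro coord_eqI) auto
  then show "(cochar n \<otimes>\<^bsub>cochar_group S\<^esub> cochar m) t = cochar (\<lambda>k. n k + m k) t"
    using t by (simp add: cochar_group_simps)
qed (auto simp: cochar_group_simps cochar_def)

lemma cochar_zero: "cochar (\<lambda>k. 0) = \<one>\<^bsub>cochar_group S\<^esub>"
proof -
  have "(\<lambda>i. if i < r then t powi 0 else 1) = (\<lambda>i. 1)" for t :: 'a by auto
  then show ?thesis by (simp only: cochar_def cochar_group_simps f_one)
qed

lemma cochar_comm_group: "comm_group (cochar_group S)"
proof (rule comm_groupI)
  have cases: "\<exists>n. \<mu> = cochar n" if "\<mu> \<in> carrier (cochar_group S)" for \<mu>
    using cochar_expo[OF that] by metis
  show "\<mu> \<otimes>\<^bsub>cochar_group S\<^esub> \<nu> \<in> carrier (cochar_group S)"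
    if "\<mu> \<in> carrier (cochar_group S)" "\<nu> \<in> carrier (cochar_group S)" for \<mu> \<nu>
    using cases[OF that(1)] cases[OF that(2)] by (auto simp: cochar_mult cochar_closed)
  show "\<one>\<^bsub>cochar_group S\<^esub> \<in> carrier (cochar_group S)"
    unfolding cochar_zero[symmetric] by (rule cochar_closed)
  show "\<mu> \<otimes>\<^bsub>cochar_group S\<^esub> \<nu> \<otimes>\<^bsub>cochar_group S\<^esub> \<xi> = \<mu> \<otimes>\<^bsub>cochar_group S\<^esub> (\<nu> \<otimes>\<^bsub>cochar_group S\<^esub> \<xi>)" for \<mu> \<nu> \<xi>
    by (rule ext) (simp add: cochar_group_simps restrict_def matrix_mul_assoc)
  show "\<mu> \<otimes>\<^bsub>cochar_group S\<^esub> \<nu> = \<nu> \<otimes>\<^bsub>cochar_group S\<^esub> \<mu>"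
    if "\<mu> \<in> carrier (cochar_group S)" "\<nu> \<in> carrier (cochar_group S)" for \<mu> \<nu>
    using cases[OF that(1)] cases[OF that(2)] by (auto simp: cochar_mult add.commute)
  show "\<one>\<^bsub>cochar_group S\<^esub> \<otimes>\<^bsub>cochar_group S\<^esub> \<mu> = \<mu>" if "\<mu> \<in> carrier (cochar_group S)" for \<mu>
    using cases[OF that] by (auto simp: cochar_mult simp flip: cochar_zero)
  show "\<exists>\<nu>\<in>carrier (cochar_group S). \<nu> \<otimes>\<^bsub>cochar_group S\<^esub> \<mu> = \<one>\<^bsub>cochar_group S\<^esub>"
    if \<mu>: "\<mu> \<in> carrier (cochar_group S)" for \<mu>
  proof -
    obtain n where n: "\<mu> = cochar n" using cases[OF \<mu>] by blast
    show ?thesis unfolding n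
      by (rule bexI[of _ "cochar (\<lambda>k. - n k)"]) (simp_all add: cochar_mult cochar_zero cochar_closed)
  qed
qed

lemma expo_mult:
  assumes "\<mu> \<in> carrier (cochar_group S)" "\<nu> \<in> carrier (cochar_group S)" "k < r"
  shows "expo (\<mu> \<otimes>\<^bsub>cochar_group S\<^esub> \<nu>) k = expo \<mu> k + expo \<nu> k"
  using cochar_mult[of "expo \<mu>" "expo \<nu>"] expo_cochar[OF assms(3)] assms by (simp add: cochar_expo)

lemma cochar_torus_points:
  assumes \<mu>: "\<mu> \<in> carrier (cochar_group S)" and "a \<in> E" "a \<noteq> 0"
  shows "\<mu> a \<in> carrier (torus_points S E)"
proof -
  have "cochar (expo \<mu>) a \<in> carrier (torus_points S E)"
    using assms subfield_facts[OF subfield_E] powi_Gm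
    by (auto simp: cochar_def simp del: torus_points_simps intro!: f_in_torus_points)
  then show ?thesis using cochar_expo[OF \<mu>] by simp
qed

lemma cochar_act_apply: "t \<noteq> 0 \<Longrightarrow> cochar_act \<sigma> \<mu> t = map_matrix \<sigma> (\<mu> (inv_into UNIV \<sigma> t))"
  by (simp add: cochar_act_def)

lemma galois_inv_nonzero: "\<sigma> \<in> galois_set K \<Longrightarrow> t \<noteq> 0 \<Longrightarrow> inv_into UNIV \<sigma> t \<noteq> 0"
  using galois_set_hom(9)[OF galois_set_closed(3)] by blast

lemma cochar_act_closed:
  assumes \<sigma>: "\<sigma> \<in> galois_set K" and stable: "\<And>A. A \<in> S \<Longrightarrow> map_matrix \<sigma> A \<in> S"
    and \<mu>: "\<mu> \<in> carrier (cochar_group S)"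
  shows "cochar_act \<sigma> \<mu> \<in> carrier (cochar_group S)"
proof -
  note nz = galois_inv_nonzero[OF \<sigma>]
  have "\<exists>h\<in>laurent_functions. \<forall>t. t \<noteq> 0 \<longrightarrow> cochar_act \<sigma> \<mu> t $ i $ j = h t" for i j
  proof -
    obtain h where "h \<in> laurent_functions" "\<And>t. t \<noteq> 0 \<Longrightarrow> \<mu> t $ i $ j = h t"
      using cochar_groupD(4)[OF \<mu>, of i j] by blast
    then show ?thesis using nz laurent_galois[OF \<sigma>]
      by (intro bexI[of _ "\<lambda>t. \<sigma> (h (inv_into UNIV \<sigma> t))"]) (auto simp: cochar_act_apply)
  qed
  moreover have "cochar_act \<sigma> \<mu> (s * t) = cochar_act \<sigma> \<mu> s ** cochar_act \<sigma> \<mu> t" if "s \<noteq> 0" "t \<noteq> 0" for s t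
    using that nz cochar_groupD(3)[OF \<mu>]
    by (simp add: cochar_act_apply map_matrix_mult[OF \<sigma>] galois_set_hom(3)[OF galois_set_closed(3)[OF \<sigma>]])
  moreover have "cochar_act \<sigma> \<mu> t \<in> S" if "t \<noteq> 0" for t
    using that nz cochar_groupD(2)[OF \<mu>] stable by (simp add: cochar_act_apply)
  ultimately show ?thesis
    unfolding cochar_group_def laurent_functions_def[symmetric] by (auto simp: PiE_iff cochar_act_def)
qed

lemma cochar_act_mult:
  assumes \<sigma>: "\<sigma> \<in> galois_set K"
  shows "cochar_act \<sigma> (\<mu> \<otimes>\<^bsub>cochar_group S\<^esub> \<nu>) =
    cochar_act \<sigma> \<mu> \<otimes>\<^bsub>cochar_group S\<^esub> cochar_act \<sigma> \<nu>"
  using galois_inv_nonzero[OF \<sigma>]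
  by (intro ext) (simp add: cochar_act_def cochar_group_simps restrict_def map_matrix_mult[OF \<sigma>])

lemma cochar_act_id: "\<mu> \<in> carrier (cochar_group S) \<Longrightarrow> cochar_act id \<mu> = \<mu>"
  using cochar_groupD(1)[of \<mu>]
  by (auto simp: cochar_act_def map_matrix_def vec_eq_iff restrict_def extensional_def inv_id)

lemma cochar_act_comp:
  assumes \<sigma>: "\<sigma> \<in> galois_set K" and \<tau>: "\<tau> \<in> galois_set K"
  shows "cochar_act (\<sigma> \<circ> \<tau>) \<mu> = cochar_act \<sigma> (cochar_act \<tau> \<mu>)"
proof -
  have "inv_into UNIV (\<sigma> \<circ> \<tau>) t = inv_into UNIV \<tau> (inv_into UNIV \<sigma> t)" for t
    using o_inv_distrib[OF galois_set_hom(1)[OF \<sigma>] galois_set_hom(1)[OF \<tau>]] by simp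
  then show ?thesis using galois_inv_nonzero[OF \<sigma>]
    by (auto simp: cochar_act_def map_matrix_def vec_eq_iff)
qed

text \<open>In coordinates a cocharacter consists of integer powers of \<open>t\<close>. Conjugation
  by \<open>\<sigma>\<close> leaves these unchanged, and \<open>f\<close> commutes with
  \<open>\<sigma>\<close> by \<open>galois_f\<close>.\<close>

lemma cochar_act_trivial:
  assumes \<sigma>: "\<sigma> \<in> galois_set E" and \<mu>: "\<mu> \<in> carrier (cochar_group S)"
  shows "cochar_act \<sigma> \<mu> = \<mu>"
proof -
  have s1: "inv_into UNIV \<sigma> \<in> galois_set E" using \<sigma> by (rule galois_set_closed)
  have powi: "\<sigma> (x powi k) = \<sigma> x powi k" for x k
    by (simp add: power_int_def galois_set_hom[OF \<sigma>])
  have "cochar_act \<sigma> (cochar n) = cochar n" for n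
  proof (rule extensionalityI[of _ "- {0}"])
    fix t :: 'a assume t: "t \<in> - {0}"
    then show "cochar_act \<sigma> (cochar n) t = cochar n t"
      using galois_inv_nonzero[OF \<sigma>]
      by (simp add: cochar_act_apply cochar_def galois_f[OF \<sigma>] powi_Gm if_distrib powi galois_inv(1)[OF \<sigma>]
          galois_set_hom[OF \<sigma>] cong: if_cong)
  qed (auto simp: cochar_act_def cochar_def)
  from this[of "expo \<mu>"] show ?thesis using \<mu> by (simp add: cochar_expo)
qed

definition basic_cochar :: "nat \<Rightarrow> 'a \<Rightarrow> 'a^'n^'n"
  where "basic_cochar j = cochar (\<lambda>k. if k = j then 1 else 0)"

lemma basic_cochar_closed: "basic_cochar j \<in> carrier (cochar_group S)"
  by (simp add: basic_cochar_def cochar_closed)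

lemma additive_int_pow:
  fixes h :: "'x \<Rightarrow> int"
  assumes "comm_group L" and h: "\<And>x y. x \<in> carrier L \<Longrightarrow> y \<in> carrier L \<Longrightarrow> h (x \<otimes>\<^bsub>L\<^esub> y) = h x + h y"
    and x: "x \<in> carrier L"
  shows "h (x [^]\<^bsub>L\<^esub> (k::int)) = k * h x"
proof -
  interpret comm_group L by fact
  have h1: "h \<one>\<^bsub>L\<^esub> = 0" using h[of "\<one>\<^bsub>L\<^esub>" "\<one>\<^bsub>L\<^esub>"] by simp
  have n: "h (x [^]\<^bsub>L\<^esub> (n::nat)) = int n * h x" for n
    by (induction n) (auto simp: h1 h x algebra_simps)
  show ?thesis
  proof (cases "k < 0")
    case True
    have 1: "x [^]\<^bsub>L\<^esub> k = inv\<^bsub>L\<^esub> (x [^]\<^bsub>L\<^esub> nat (- k))"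
      unfolding int_pow_def2[of L x k] using True by (rule if_P)
    have "h (inv\<^bsub>L\<^esub> (x [^]\<^bsub>L\<^esub> nat (- k))) + h (x [^]\<^bsub>L\<^esub> nat (- k)) = 0"
      using x h1 by (simp flip: h)
    then show ?thesis unfolding 1 n using True by simp
  next
    case False
    have 1: "x [^]\<^bsub>L\<^esub> k = x [^]\<^bsub>L\<^esub> nat k" unfolding int_pow_def2[of L x k] using False by simp
    show ?thesis unfolding 1 n using False by simp
  qed
qed

lemma cochar_basis:
  assumes \<mu>: "\<mu> \<in> carrier (cochar_group S)"
  shows "\<mu> = finprod (cochar_group S) (\<lambda>j. basic_cochar j [^]\<^bsub>cochar_group S\<^esub> expo \<mu> j) {..<r}"
proof -
  interpret L: comm_group "cochar_group S" by (rule cochar_comm_group)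
  have c: "(\<lambda>j. basic_cochar j [^]\<^bsub>cochar_group S\<^esub> expo \<mu> j) \<in> {..<r} \<rightarrow> carrier (cochar_group S)"
    using basic_cochar_closed by auto
  show ?thesis
  proof (rule cochar_eqI[OF \<mu> L.finprod_closed[OF c]])
    fix k assume k: "k < r"
    have "expo (finprod (cochar_group S) (\<lambda>j. basic_cochar j [^]\<^bsub>cochar_group S\<^esub> expo \<mu> j) {..<r}) k =
        (\<Sum>j<r. expo (basic_cochar j [^]\<^bsub>cochar_group S\<^esub> expo \<mu> j) k)"
      using c k by (intro L.additive_finprod[where h = "\<lambda>\<mu>. expo \<mu> k"]) (auto simp: expo_mult)
    also have "\<dots> = (\<Sum>j<r. if j = k then expo \<mu> j else 0)"
    proof (intro sum.cong refl)
      fix j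
      have "expo (basic_cochar j [^]\<^bsub>cochar_group S\<^esub> expo \<mu> j) k = expo \<mu> j * expo (basic_cochar j) k"
        using k basic_cochar_closed
        by (intro additive_int_pow[where h = "\<lambda>\<mu>. expo \<mu> k", OF cochar_comm_group]) (auto simp: expo_mult)
      then show "expo (basic_cochar j [^]\<^bsub>cochar_group S\<^esub> expo \<mu> j) k = (if j = k then expo \<mu> j else 0)"
        using k by (simp add: basic_cochar_def expo_cochar)
    qed
    also have "\<dots> = expo \<mu> k" using k by (simp add: sum.delta)
    finally show "expo \<mu> k = expo (finprod (cochar_group S) (\<lambda>j. basic_cochar j [^]\<^bsub>cochar_group S\<^esub> expo \<mu> j) {..<r}) k" ..
  qed
qed

text \<open>The cocharacters are free on the \<open>basic_cochar j\<close>, so logarithms chosen on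
  this basis extend additively.\<close>

lemma character_logarithm:
  assumes u: "u \<in> hom (cochar_group S) complex_units"
  shows "\<exists>g. (\<forall>\<mu>\<in>carrier (cochar_group S). \<forall>\<nu>\<in>carrier (cochar_group S).
      g (\<mu> \<otimes>\<^bsub>cochar_group S\<^esub> \<nu>) = g \<mu> + g \<nu>) \<and> (\<forall>\<mu>\<in>carrier (cochar_group S). u \<mu> = exp (g \<mu>))"
proof -
  interpret L: comm_group "cochar_group S" by (rule cochar_comm_group)
  interpret u: group_hom "cochar_group S" complex_units u
    by (simp add: u group_hom_def group_hom_axioms_def L.is_group units.is_group)
  have u0: "u \<mu> \<noteq> 0" if "\<mu> \<in> carrier (cochar_group S)" for \<mu> using u.hom_closed[OF that] by simp
  define g where "g \<mu> = (\<Sum>j<r. of_int (expo \<mu> j) * ln (u (basic_cochar j)))" for \<mu>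
  have "g (\<mu> \<otimes>\<^bsub>cochar_group S\<^esub> \<nu>) = g \<mu> + g \<nu>"
    if "\<mu> \<in> carrier (cochar_group S)" "\<nu> \<in> carrier (cochar_group S)" for \<mu> \<nu>
    using that by (simp add: g_def expo_mult sum.distrib algebra_simps)
  moreover have "u \<mu> = exp (g \<mu>)" if \<mu>: "\<mu> \<in> carrier (cochar_group S)" for \<mu>
  proof -
    have "u \<mu> = u (finprod (cochar_group S) (\<lambda>j. basic_cochar j [^]\<^bsub>cochar_group S\<^esub> expo \<mu> j) {..<r})"
      using cochar_basis[OF \<mu>] by simp
    also have "\<dots> = finprod complex_units (\<lambda>j. u (basic_cochar j [^]\<^bsub>cochar_group S\<^esub> expo \<mu> j)) {..<r}"
      using basic_cochar_closed u.hom_one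
      by (intro comm_monoid_hom_finprod[OF L.comm_monoid_axioms units.comm_monoid_axioms u]) auto
    also have "\<dots> = (\<Prod>j<r. u (basic_cochar j [^]\<^bsub>cochar_group S\<^esub> expo \<mu> j))"
      using basic_cochar_closed u0 by (intro finprod_complex_units) auto
    also have "\<dots> = (\<Prod>j<r. exp (of_int (expo \<mu> j) * ln (u (basic_cochar j))))"
    proof (intro prod.cong refl)
      fix j
      have "u (basic_cochar j [^]\<^bsub>cochar_group S\<^esub> expo \<mu> j) = u (basic_cochar j) powi expo \<mu> j"
        using basic_cochar_closed u0 by (simp add: u.hom_int_pow)
      also have "\<dots> = exp (of_int (expo \<mu> j) * ln (u (basic_cochar j)))"
        using u0[OF basic_cochar_closed] by (simp add: exp_power_int mult.commute flip: exp_power_int)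
      finally show "u (basic_cochar j [^]\<^bsub>cochar_group S\<^esub> expo \<mu> j) = exp (of_int (expo \<mu> j) * ln (u (basic_cochar j)))" .
    qed
    finally show ?thesis by (simp add: g_def exp_sum)
  qed
  ultimately show ?thesis by blast
qed

end

section \<open>The maximal bounded subgroup\<close>

context nonarch
begin

lemma function_algebra_bounded:
  assumes "h \<in> function_algebra K G" and gen: "\<And>g. g \<in> G \<Longrightarrow> \<exists>C. \<forall>x\<in>A. v (g x) \<le> C"
  shows "\<exists>C. \<forall>x\<in>A. v (h x) \<le> C"
  using assms(1)
proof (induction rule: function_algebra.induct)
  case (add g h)
  then obtain C D where CD: "\<forall>x\<in>A. v (g x) \<le> C" "\<forall>x\<in>A. v (h x) \<le> D" by blast
  have "v (g x + h x) \<le> max C D" if "x \<in> A" for x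
    using CD that by (intro v_add_le) (auto simp: max.coboundedI1 max.coboundedI2)
  then show ?case by blast
next
  case (mult g h)
  then obtain C D where CD: "\<forall>x\<in>A. v (g x) \<le> C" "\<forall>x\<in>A. v (h x) \<le> D" by blast
  have "v (g x * h x) \<le> \<bar>C\<bar> * \<bar>D\<bar>" if "x \<in> A" for x
    unfolding v_mult using CD that by (intro mult_mono) (auto intro: order_trans)
  then show ?case by blast
qed (use gen in auto)

lemma matrix_dist_le_iff:
  fixes A B :: "'a^'n^'n"
  shows "matrix_dist v A B \<le> C \<longleftrightarrow> (\<forall>i j. v (A $ i $ j - B $ i $ j) \<le> C)"
proof -
  have e: "{v (A $ i $ j - B $ i $ j) |i j. True} = (\<lambda>(i, j). v (A $ i $ j - B $ i $ j)) ` UNIV" by auto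
  show ?thesis unfolding matrix_dist_def e by (subst Max_le_iff) auto
qed

lemma matrix_dist_ge:
  fixes A B :: "'a^'n^'n"
  shows "v (A $ i $ j - B $ i $ j) \<le> matrix_dist v A B"
  using matrix_dist_le_iff[of A B "matrix_dist v A B"] by simp

lemma matrix_dist_metric: "Metric_space M (matrix_dist v)"
proof
  show nonneg: "0 \<le> matrix_dist v A B" for A B
    using matrix_dist_ge v_nonneg by (rule order_trans[rotated])
  show "matrix_dist v A B = matrix_dist v B A" for A B
    by (simp add: matrix_dist_def v_commute)
  show "matrix_dist v A B = 0 \<longleftrightarrow> A = B" for A B
  proof -
    have "matrix_dist v A B = 0 \<longleftrightarrow> matrix_dist v A B \<le> 0" using nonneg[of A B] by linarith
    also have "\<dots> \<longleftrightarrow> (\<forall>i j. v (A $ i $ j - B $ i $ j) = 0)"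
      unfolding matrix_dist_le_iff by (metis order_antisym v_nonneg order_refl)
    also have "\<dots> \<longleftrightarrow> A = B" by (simp add: vec_eq_iff)
    finally show ?thesis .
  qed
  show "matrix_dist v A C \<le> matrix_dist v A B + matrix_dist v B C" for A B C
    unfolding matrix_dist_le_iff
  proof (intro allI)
    fix i j
    have "v (A $ i $ j - C $ i $ j) \<le> max (v (A $ i $ j - B $ i $ j)) (v (B $ i $ j - C $ i $ j))"
      using v_add[of "A $ i $ j - B $ i $ j" "B $ i $ j - C $ i $ j"] by simp
    then show "v (A $ i $ j - C $ i $ j) \<le> matrix_dist v A B + matrix_dist v B C"
      using matrix_dist_ge[of A i j B] matrix_dist_ge[of B i j C] nonneg[of A B] nonneg[of B C] by linarith
  qed
qed

lemma v_det_le: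
  fixes A :: "'a^'n^'n"
  assumes "\<And>i j. v (A $ i $ j) \<le> C" "1 \<le> C"
  shows "v (det A) \<le> C ^ CARD('n)"
  unfolding det_def
proof (rule v_sum_le)
  fix q :: "'n \<Rightarrow> 'n"
  have "(\<Prod>i\<in>(UNIV::'n set). v (A $ i $ q i)) \<le> (\<Prod>i\<in>(UNIV::'n set). C)"
    using assms by (intro prod_mono) auto
  moreover have "v (of_int (sign q)) = 1" by (simp add: sign_def)
  ultimately show "v (of_int (sign q) * (\<Prod>i\<in>UNIV. A $ i $ q i)) \<le> C ^ CARD('n)"
    by (simp add: v_mult v_prod)
qed (use assms in simp)

end

locale nonarch_split_torus = split_torus S E r f + nonarch v
  for S :: "('a::field^'n^'n) set" and E r f and v :: "'a \<Rightarrow> real"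
begin

text \<open>The points whose image in the split torus has unit coordinates. The coordinates come
  from the splitting over \<open>E\<close> although \<open>K\<close> will be \<open>F\<close>; those
  of an \<open>F\<close>-point lie in \<open>E\<close> in general.\<close>

definition integral_points :: "'a set \<Rightarrow> ('a^'n^'n) set"
  where "integral_points K = {A \<in> carrier (torus_points S K). \<forall>k<r. v (coord A k) = 1}"

lemma integral_points_subgroup:
  assumes K: "subfield K field_of_type"
  shows "subgroup (integral_points K) (torus_points S K)"
proof -
  interpret comm_group "torus_points S K" using K by (rule torus_points_comm_group)
  show ?thesis
  proof (rule subgroupI)
    show "integral_points K \<subseteq> carrier (torus_points S K)" by (auto simp: integral_points_def)
    show "integral_points K \<noteq> {}" using one_closed by (auto simp: integral_points_def coord_one)
    fix A assume A: "A \<in> integral_points K"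
    then have Ac: "A \<in> carrier (torus_points S K)" "A \<in> S" by (auto simp: integral_points_def)
    have ic: "inv\<^bsub>torus_points S K\<^esub> A \<in> carrier (torus_points S K)" by (rule inv_closed[OF Ac(1)])
    have "A ** inv\<^bsub>torus_points S K\<^esub> A = mat 1" using r_inv[OF Ac(1)] by simp
    then have "coord A k * coord (inv\<^bsub>torus_points S K\<^esub> A) k = 1" for k
      using coord_mult[of A "inv\<^bsub>torus_points S K\<^esub> A" k] Ac ic coord_one by simp
    then have e: "v (coord A k) * v (coord (inv\<^bsub>torus_points S K\<^esub> A) k) = 1" for k
      by (metis v_1 v_mult)
    have "v (coord (inv\<^bsub>torus_points S K\<^esub> A) k) = 1" if "k < r" for k
      using e[of k] A that by (simp add: integral_points_def)
    then show "inv\<^bsub>torus_points S K\<^esub> A \<in> integral_points K"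
      using ic unfolding integral_points_def by blast
    fix B assume B: "B \<in> integral_points K"
    then have Bc: "B \<in> carrier (torus_points S K)" "B \<in> S" by (auto simp: integral_points_def)
    show "A \<otimes>\<^bsub>torus_points S K\<^esub> B \<in> integral_points K"
      using m_closed[OF Ac(1) Bc(1)] A B Ac Bc by (simp add: integral_points_def coord_mult v_mult)
  qed
qed

lemma integral_points_bounded:
  assumes K: "subfield K field_of_type"
  shows "Metric_space.mbounded (carrier (torus_points S K)) (matrix_dist v) (integral_points K)"
proof -
  interpret comm_group "torus_points S K" using K by (rule torus_points_comm_group)
  define U where "U = {t \<in> Gm_pow r. \<forall>k<r. v (t k) = 1}"
  have "\<exists>C. \<forall>t\<in>U. v (f t $ i $ j) \<le> C" for i j
  proof -
    obtain h where h: "h \<in> regular_on_Gm_pow E r" "\<And>t. t \<in> Gm_pow r \<Longrightarrow> f t $ i $ j = h t"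
      using f_regular by blast
    have "\<exists>C. \<forall>t\<in>U. v (h t) \<le> C"
      using h(1) unfolding regular_on_Gm_pow_def
      by (rule function_algebra_bounded) (auto simp: U_def v_inverse intro!: exI[of _ 1])
    then show ?thesis using h(2) by (auto simp: U_def)
  qed
  then have "\<forall>i j. \<exists>C. \<forall>t\<in>U. v (f t $ i $ j) \<le> C" by blast
  then obtain C where "\<forall>i j. \<forall>t\<in>U. v (f t $ i $ j) \<le> C i j" unfolding choice_iff by blast
  then have C: "v (f t $ i $ j) \<le> C i j" if "t \<in> U" for i j t using that by blast
  define D where "D = 1 + (\<Sum>i\<in>UNIV. \<Sum>j\<in>UNIV. \<bar>C i j\<bar>)"
  have CD: "C i j \<le> D" for i j
  proof -
    have "\<bar>C i j\<bar> \<le> (\<Sum>j\<in>UNIV. \<bar>C i j\<bar>)" by (rule member_le_sum) auto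
    also have "\<dots> \<le> (\<Sum>i\<in>UNIV. \<Sum>j\<in>UNIV. \<bar>C i j\<bar>)"
      by (rule member_le_sum[of i UNIV "\<lambda>i. \<Sum>j\<in>UNIV. \<bar>C i j\<bar>"]) (auto intro: sum_nonneg)
    finally show ?thesis by (simp add: D_def)
  qed
  have D1: "1 \<le> D" by (auto simp: D_def intro!: sum_nonneg)
  have "matrix_dist v (mat 1) A \<le> D" if A: "A \<in> integral_points K" for A
    unfolding matrix_dist_le_iff
  proof (intro allI v_diff_le)
    fix i j
    have AS: "A \<in> S" and "coord A \<in> U" using A coord_Gm by (auto simp: integral_points_def U_def)
    then have "v (A $ i $ j) \<le> C i j" using C[of "coord A" i j] by (simp add: f_coord)
    then show "v (A $ i $ j) \<le> D" using CD[of i j] by linarith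
    show "v (mat 1 $ i $ j) \<le> D" using D1 by (simp add: mat_def)
  qed
  then show ?thesis
    using one_closed unfolding Metric_space.mbounded[OF matrix_dist_metric]
    by (intro disjI2 conjI) (auto simp: integral_points_def simp del: torus_points_simps(1))
qed

text \<open>The coordinates of a bounded subgroup are bounded, being regular functions, hence have
  absolute value 1, because their powers are bounded as well.\<close>

lemma bounded_subgroup_integral:
  assumes K: "subfield K field_of_type" and B: "subgroup B (torus_points S K)"
    and bd: "Metric_space.mbounded (carrier (torus_points S K)) (matrix_dist v) B"
  shows "B \<subseteq> integral_points K"
proof -
  interpret T: comm_group "torus_points S K" using K by (rule torus_points_comm_group)
  interpret B: subgroup B "torus_points S K" by fact
  have BS: "A \<in> S" if "A \<in> B" for A using B.subset that by auto
  have "\<exists>A0 C. \<forall>A\<in>B. matrix_dist v A0 A \<le> C"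
    using bd B.one_closed unfolding Metric_space.mbounded[OF matrix_dist_metric] by blast
  then obtain A0 C where C: "\<And>A. A \<in> B \<Longrightarrow> matrix_dist v A0 A \<le> C" by blast
  \<comment> \<open>A bound for all entries of all elements of \<open>B\<close>, independent of the
    centre \<open>A0\<close> of the ball; it is at least 1, as \<open>v_det_le\<close>
    demands.\<close>
  define D where "D = 1 + \<bar>C\<bar> + (\<Sum>i\<in>UNIV. \<Sum>j\<in>UNIV. v (A0 $ i $ j))"
  have D1: "1 \<le> D" by (auto simp: D_def intro!: add_nonneg_nonneg sum_nonneg)
  have D: "v (A $ i $ j) \<le> D" if A: "A \<in> B" for A :: "'a^'n^'n" and i j
  proof -
    have "v (A0 $ i $ j - A $ i $ j) \<le> C" using C[OF A] by (simp add: matrix_dist_le_iff)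
    moreover have "v (A $ i $ j) \<le> max (v (A0 $ i $ j)) (v (A0 $ i $ j - A $ i $ j))"
      using v_diff[of "A0 $ i $ j" "A0 $ i $ j - A $ i $ j"] by simp
    moreover have "v (A0 $ i $ j) \<le> (\<Sum>i\<in>UNIV. \<Sum>j\<in>UNIV. v (A0 $ i $ j))"
    proof -
      have "v (A0 $ i $ j) \<le> (\<Sum>j\<in>UNIV. v (A0 $ i $ j))" by (rule member_le_sum) auto
      also have "\<dots> \<le> (\<Sum>i\<in>UNIV. \<Sum>j\<in>UNIV. v (A0 $ i $ j))"
        by (rule member_le_sum[of i UNIV "\<lambda>i. \<Sum>j\<in>UNIV. v (A0 $ i $ j)"]) (auto intro: sum_nonneg)
      finally show ?thesis .
    qed
    ultimately show ?thesis using v_nonneg[of "A0 $ i $ j"] unfolding D_def by linarith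
  qed
  have inv: "A ** inv\<^bsub>torus_points S K\<^esub> A = mat 1" if "A \<in> B" for A
    using T.r_inv[of A] B.subset that by auto
  have coord_bd: "\<exists>C. \<forall>A\<in>B. v (coord A k) \<le> C" if k: "k < r" for k
  proof -
    obtain h where h: "h \<in> regular_on_GL E" "\<And>t. t \<in> Gm_pow r \<Longrightarrow> h (f t) = t k"
      using f_inv_regular[OF k] by blast
    \<comment> \<open>The inverse determinant is the determinant of the inverse matrix, which lies
      in the subgroup \<open>B\<close> and obeys the same bound.\<close>
    have "v (inverse (det A)) \<le> D ^ CARD('n)" if A: "A \<in> B" for A
    proof -
      have "det A * det (inv\<^bsub>torus_points S K\<^esub> A) = 1" using inv[OF A] by (metis det_I det_mul)
      then have "inverse (det A) = det (inv\<^bsub>torus_points S K\<^esub> A)" by (rule inverse_unique)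
      then show ?thesis using v_det_le[OF D D1] B.m_inv_closed[OF A] by metis
    qed
    then have "\<exists>C. \<forall>A\<in>B. v (h A) \<le> C"
      using h(1) unfolding regular_on_GL_def
      by (elim function_algebra_bounded) (use D in blast)
    moreover have "h A = coord A k" if "A \<in> B" for A
      using h(2)[OF coord_Gm[OF BS[OF that]]] by (simp add: f_coord BS that)
    ultimately show ?thesis by auto
  qed
  have coord_le: "v (coord A k) \<le> 1" if A: "A \<in> B" and k: "k < r" for A k
  proof (rule ccontr)
    assume "\<not> v (coord A k) \<le> 1"
    moreover obtain C where C: "\<And>A. A \<in> B \<Longrightarrow> v (coord A k) \<le> C" using coord_bd[OF k] by blast
    ultimately obtain n where n: "C < v (coord A k) ^ n" using real_arch_pow[of "v (coord A k)" C] by auto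
    have "A [^]\<^bsub>torus_points S K\<^esub> n \<in> B \<and> coord (A [^]\<^bsub>torus_points S K\<^esub> n) k = coord A k ^ n"
    proof (induction n)
      case 0 then show ?case using B.one_closed coord_one by simp
    next
      case (Suc n)
      then show ?case using A BS B.m_closed[of "A [^]\<^bsub>torus_points S K\<^esub> n" A]
        by (simp add: coord_mult BS mult.commute)
    qed
    then have "v (coord A k) ^ n \<le> C" using C v_power by metis
    then show False using n by simp
  qed
  show ?thesis
  proof
    fix A assume A: "A \<in> B"
    have "v (coord A k) = 1" if k: "k < r" for k
    proof -
      let ?I = "inv\<^bsub>torus_points S K\<^esub> A"
      have I: "?I \<in> B" using A by (rule B.m_inv_closed)
      have "coord A k * coord ?I k = 1"
        using coord_mult[OF BS[OF A] BS[OF I], of k] inv[OF A] coord_one by simp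
      then have e: "v (coord A k) * v (coord ?I k) = 1" by (metis v_1 v_mult)
      have "v (coord A k) * v (coord ?I k) \<le> v (coord A k) * 1"
        using coord_le[OF I k] by (intro mult_left_mono) auto
      then show ?thesis using e coord_le[OF A k] by simp
    qed
    then show "A \<in> integral_points K" using A B.subset by (auto simp: integral_points_def)
  qed
qed

text \<open>\<open>GREATEST\<close> refers to inclusion of sets. It denotes the integral points
  because these are bounded themselves and contain every bounded subgroup.\<close>

lemma maximal_bounded_subgroup_eq:
  assumes K: "subfield K field_of_type"
  shows "maximal_bounded_subgroup v S K = integral_points K"
  unfolding maximal_bounded_subgroup_def
  by (rule Greatest_equality)
    (use integral_points_subgroup[OF K] integral_points_bounded[OF K] bounded_subgroup_integral[OF K] in auto)

lemma coord_finprod: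
  assumes K: "subfield K field_of_type" and g: "g \<in> I \<rightarrow> carrier (torus_points S K)"
  shows "coord (finprod (torus_points S K) g I) k = (\<Prod>i\<in>I. coord (g i) k)"
proof -
  interpret T: comm_group "torus_points S K" using K by (rule torus_points_comm_group)
  have "(\<lambda>A. coord A k) \<in> hom (torus_points S K) (mult_group UNIV)"
    by (auto simp: hom_def coord_mult coord_nonzero)
  from comm_monoid_hom_finprod[OF T.comm_monoid_axioms units.comm_monoid_axioms this _ g]
  have "coord (finprod (torus_points S K) g I) k = finprod (mult_group UNIV) (\<lambda>i. coord (g i) k) I"
    by (simp add: coord_one)
  also have "\<dots> = (\<Prod>i\<in>I. coord (g i) k)"
  proof (rule finprod_complex_units)
    show "coord (g i) k \<noteq> 0" if "i \<in> I" for i using funcset_mem[OF g that] coord_nonzero by simp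
  qed
  finally show ?thesis .
qed

text \<open>The identification of \<open>S(E)\<close> with the tensor product of the units of
  \<open>E\<close> and the cocharacters, in explicit form.\<close>

lemma torus_point_decomposition:
  assumes A: "A \<in> carrier (torus_points S E)"
  shows "A = finprod (torus_points S E) (\<lambda>j. basic_cochar j (coord A j)) {..<r}"
proof -
  interpret T: comm_group "torus_points S E" using subfield_E by (rule torus_points_comm_group)
  have AS: "A \<in> S" using A by simp
  have c: "(\<lambda>j. basic_cochar j (coord A j)) \<in> {..<r} \<rightarrow> carrier (torus_points S E)"
    using cochar_torus_points[OF basic_cochar_closed coord_in_subfield[OF A] coord_nonzero[OF AS]] by blast
  have fc: "finprod (torus_points S E) (\<lambda>j. basic_cochar j (coord A j)) {..<r} \<in> S"
    using T.finprod_closed[OF c] by simp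
  show ?thesis
  proof (rule coord_eqI[OF AS fc])
    fix k assume k: "k < r"
    have "coord (finprod (torus_points S E) (\<lambda>j. basic_cochar j (coord A j)) {..<r}) k =
        (\<Prod>j<r. coord (basic_cochar j (coord A j)) k)"
      by (rule coord_finprod[OF subfield_E c])
    also have "\<dots> = (\<Prod>j<r. if j = k then coord A j else 1)"
      using k coord_nonzero[OF AS] by (intro prod.cong) (auto simp: basic_cochar_def coord_cochar)
    also have "\<dots> = coord A k" using k by simp
    finally show "coord A k = coord (finprod (torus_points S E) (\<lambda>j. basic_cochar j (coord A j)) {..<r}) k" ..
  qed
qed

end

section \<open>The Weil group action on the cocharacters\<close>

text \<open>\<open>WF\<close> and \<open>WE\<close> are Weil groups over the same \<open>p\<close>,
  with residue cardinalities \<open>p ^ b\<close> and \<open>p ^ c\<close>. The element of degree 1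
  will be supplied by reciprocity for \<open>F\<close>.\<close>

locale torus_over_local_field = nonarch_split_torus S E rk \<iota> v + sep_closed_residue_char v p +
  WF: weil v p F b + WE: weil v p E c
  for S :: "('a::field^'n^'n) set" and E rk \<iota> and v :: "'a \<Rightarrow> real" and p F b c +
  fixes R :: "('a \<Rightarrow> 'a) set"
  assumes extension: "finite_galois_extension F E"
    and stable: "\<sigma> \<in> galois_set F \<Longrightarrow> A \<in> S \<Longrightarrow> map_matrix \<sigma> A \<in> S"
    and representatives: "coset_representatives F E v R"
    and frobenius_exists: "\<exists>w\<in>weil_set F v. WF.wdeg w = 1"
begin

lemma F_subset_E: "F \<subseteq> E"
  using extension by (auto simp: finite_galois_extension_def finite_extension_def)

lemma galois_E: "\<sigma> \<in> galois_set F \<Longrightarrow> x \<in> E \<Longrightarrow> \<sigma> x \<in> E"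
  using extension by (auto simp: finite_galois_extension_def)

lemma galois_set_EF: "\<sigma> \<in> galois_set E \<Longrightarrow> \<sigma> \<in> galois_set F"
  using F_subset_E by (auto simp: galois_set_def)

lemma WF_galois: "w \<in> weil_set F v \<Longrightarrow> w \<in> galois_set F"
  and WE_galois: "w \<in> weil_set E v \<Longrightarrow> w \<in> galois_set E"
  by (rule WF.weil_setD(1), assumption, rule WE.weil_setD(1))

text \<open>Triviality on the residue field of the separable closure does not mention the base
  field, so inertia over \<open>E\<close> is contained in inertia over \<open>F\<close>.\<close>

lemma inertia_EF: "w \<in> weil_set E v \<Longrightarrow> WE.wdeg w = 0 \<Longrightarrow> w \<in> weil_set F v \<and> WF.wdeg w = 0"
  using galois_set_EF unfolding WF.inertia_iff[symmetric]
  by (metis (mono_tags, lifting) WE.inertia_iff inertia_def mem_Collect_eq)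

lemma R_WF: "r \<in> R \<Longrightarrow> r \<in> weil_set F v"
  using representatives by (auto simp: coset_representatives_def)

lemma R_unique: "g \<in> weil_set F v \<Longrightarrow> \<exists>!r. r \<in> R \<and> g \<circ> inv_into UNIV r \<in> weil_set E v"
  using representatives by (simp add: coset_representatives_def)

definition rep :: "('a \<Rightarrow> 'a) \<Rightarrow> 'a \<Rightarrow> 'a"
  where "rep g = (THE r. r \<in> R \<and> g \<circ> inv_into UNIV r \<in> weil_set E v)"

lemma rep: "g \<in> weil_set F v \<Longrightarrow> rep g \<in> R" "g \<in> weil_set F v \<Longrightarrow> g \<circ> inv_into UNIV (rep g) \<in> weil_set E v"
  using theI'[OF R_unique] unfolding rep_def by blast+

lemma rep_eqI: "g \<in> weil_set F v \<Longrightarrow> r \<in> R \<Longrightarrow> g \<circ> inv_into UNIV r \<in> weil_set E v \<Longrightarrow> rep g = r"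
  using R_unique rep by blast

lemma transfer_part_eq: "transfer_part E v R g = g \<circ> inv_into UNIV (rep g)"
  by (simp add: transfer_part_def rep_def)

lemma inv_comp_cancel:
  assumes "g \<in> galois_set F" "h \<in> galois_set F" "k \<in> galois_set F"
  shows "(g \<circ> inv_into UNIV k) \<circ> inv_into UNIV (h \<circ> inv_into UNIV k) = g \<circ> inv_into UNIV h"
proof -
  have "inv_into UNIV (h \<circ> inv_into UNIV k) = k \<circ> inv_into UNIV h"
    using o_inv_distrib[OF galois_set_hom(1)[OF assms(2)] galois_set_hom(1)[OF galois_set_closed(3)[OF assms(3)]]]
    by (simp add: galois_inv(5)[OF assms(3)])
  then show ?thesis using galois_inv(2)[OF assms(3)] by (auto simp: fun_eq_iff)
qed

lemma R_eqI: "r1 \<in> R \<Longrightarrow> r2 \<in> R \<Longrightarrow> r1 \<circ> inv_into UNIV r2 \<in> weil_set E v \<Longrightarrow> r1 = r2"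
proof -
  assume a: "r1 \<in> R" "r2 \<in> R" "r1 \<circ> inv_into UNIV r2 \<in> weil_set E v"
  have "r1 \<circ> inv_into UNIV r1 \<in> weil_set E v"
    using galois_inv(3)[OF WF_galois[OF R_WF[OF a(1)]]] WE.weil_set_id by simp
  then show ?thesis using rep_eqI[OF R_WF[OF a(1)]] a by metis
qed

text \<open>Representatives are separated by their restriction to \<open>E\<close> and their degree modulo \<open>c\<close>.\<close>

lemma finite_R: "finite R"
proof -
  have fin: "finite_extension F E" using extension by (simp add: finite_galois_extension_def)
  let ?h = "\<lambda>r. (restrict r E, WF.wdeg r mod int c)"
  have "inj_on ?h R"
  proof (rule inj_onI)
    fix r1 r2 assume r: "r1 \<in> R" "r2 \<in> R" and e: "?h r1 = ?h r2"
    note w = R_WF[OF r(1)] R_WF[OF r(2)]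
    note gal = WF_galois[OF w(1)] WF_galois[OF w(2)]
    have "r1 x = r2 x" if "x \<in> E" for x using e that by (metis Pair_inject restrict_apply')
    then have "(r1 \<circ> inv_into UNIV r2) x = x" if "x \<in> E" for x
      using that galois_E[OF galois_set_closed(3)[OF gal(2)]] galois_inv(1)[OF gal(2)] by simp
    moreover have gF: "r1 \<circ> inv_into UNIV r2 \<in> galois_set F"
      using gal by (intro galois_set_closed)
    ultimately have gE: "r1 \<circ> inv_into UNIV r2 \<in> galois_set E" by (auto simp: galois_set_def)
    have "WF.wdeg (r1 \<circ> inv_into UNIV r2) = WF.wdeg r1 - WF.wdeg r2"
      using w by (simp add: WF.wdeg_comp WF.weil_set_inv WF.wdeg_inv)
    then have "int c dvd WF.wdeg (r1 \<circ> inv_into UNIV r2)" using e by (simp add: mod_eq_dvd_iff)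
    then have "r1 \<circ> inv_into UNIV r2 \<in> weil_set E v"
      using w by (intro weil_set_extensionI[OF WF.weil_axioms WE.weil_axioms _ gE]
          WF.weil_set_comp WF.weil_set_inv) auto
    then show "r1 = r2" using R_eqI r by blast
  qed
  moreover have "?h ` R \<subseteq> ((\<lambda>\<sigma>. restrict \<sigma> E) ` galois_set F) \<times> {0..<int c}"
    using R_WF WF_galois WE.b_pos by auto
  moreover have "finite (((\<lambda>\<sigma>. restrict \<sigma> E) ` galois_set F) \<times> {0..<int c})"
    using finite_galois_restrictions[OF fin] by simp
  ultimately show ?thesis by (meson finite_imageD finite_subset)
qed

text \<open>If \<open>r1 w\<close> and \<open>r2 w\<close> lie in the same coset, then
  \<open>w\<close> cancels and \<open>r1\<close>, \<open>r2\<close> represent the same coset. As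
  \<open>R\<close> is finite, injectivity is enough.\<close>

lemma rep_bij:
  assumes w: "w \<in> weil_set F v" shows "bij_betw (\<lambda>r. rep (r \<circ> w)) R R"
proof -
  have "inj_on (\<lambda>r. rep (r \<circ> w)) R"
  proof (rule inj_onI)
    fix r1 r2 assume r: "r1 \<in> R" "r2 \<in> R" and e: "rep (r1 \<circ> w) = rep (r2 \<circ> w)"
    have W: "r1 \<circ> w \<in> weil_set F v" "r2 \<circ> w \<in> weil_set F v" using r w R_WF WF.weil_set_comp by auto
    note gal = WF_galois[OF W(1)] WF_galois[OF W(2)] WF_galois[OF R_WF[OF rep(1)[OF W(2)]]]
    have "((r1 \<circ> w) \<circ> inv_into UNIV (rep (r2 \<circ> w))) \<circ> inv_into UNIV ((r2 \<circ> w) \<circ> inv_into UNIV (rep (r2 \<circ> w))) \<in> weil_set E v"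
      using WE.weil_set_comp[OF rep(2)[OF W(1)] WE.weil_set_inv[OF rep(2)[OF W(2)]]] unfolding e .
    then have "(r1 \<circ> w) \<circ> inv_into UNIV (r2 \<circ> w) \<in> weil_set E v"
      unfolding inv_comp_cancel[OF gal] .
    moreover have "(r1 \<circ> w) \<circ> inv_into UNIV (r2 \<circ> w) = r1 \<circ> inv_into UNIV r2"
      using inv_comp_cancel[OF WF_galois[OF R_WF[OF r(1)]] WF_galois[OF R_WF[OF r(2)]]
          galois_set_closed(3)[OF WF_galois[OF w]]]
      by (simp add: galois_inv(5)[OF WF_galois[OF w]])
    ultimately show "r1 = r2" using R_eqI r by metis
  qed
  moreover have "(\<lambda>r. rep (r \<circ> w)) ` R \<subseteq> R"
    using rep(1) R_WF WF.weil_set_comp w by auto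
  ultimately show ?thesis using endo_inj_surj[OF finite_R] by (auto simp: bij_betw_def)
qed

lemma WF_stable: "w \<in> weil_set F v \<Longrightarrow> \<mu> \<in> carrier (cochar_group S) \<Longrightarrow>
    cochar_act w \<mu> \<in> carrier (cochar_group S)"
  using WF_galois stable by (intro cochar_act_closed) auto

text \<open>\<open>g\<close> is its representative preceded on the left by an element of the Weil
  group of \<open>E\<close>, which acts trivially on cocharacters.\<close>

lemma cochar_act_rep:
  assumes g: "g \<in> weil_set F v" and \<mu>: "\<mu> \<in> carrier (cochar_group S)"
  shows "cochar_act (rep g) \<mu> = cochar_act g \<mu>"
proof -
  have gal: "rep g \<in> galois_set F" using rep(1)[OF g] R_WF WF_galois by blast
  have "g = (g \<circ> inv_into UNIV (rep g)) \<circ> rep g" using galois_inv(2)[OF gal] by (auto simp: fun_eq_iff)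
  then have "cochar_act g \<mu> = cochar_act (g \<circ> inv_into UNIV (rep g)) (cochar_act (rep g) \<mu>)"
    using cochar_act_comp[OF galois_set_EF[OF WE_galois[OF rep(2)[OF g]]] gal, of \<mu>] by simp
  also have "\<dots> = cochar_act (rep g) \<mu>"
    using WF_stable[OF R_WF[OF rep(1)[OF g]] \<mu>] by (intro cochar_act_trivial WE_galois rep(2)[OF g])
  finally show ?thesis ..
qed

definition Fr :: "'a \<Rightarrow> 'a" where "Fr = (SOME w. w \<in> weil_set F v \<and> WF.wdeg w = 1)"

lemma Fr: "Fr \<in> weil_set F v" "WF.wdeg Fr = 1"
  using someI_ex[of "\<lambda>w. w \<in> weil_set F v \<and> WF.wdeg w = 1"] frobenius_exists unfolding Fr_def by blast+

sublocale lat: lattice_with_degree "cochar_group S" "weil_group F v" cochar_act WF.wdeg Fr R rep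
proof (intro lattice_with_degree.intro cochar_comm_group WF.weil_group lattice_with_degree_axioms.intro)
  show "cochar_act g \<in> hom (cochar_group S) (cochar_group S)" if "g \<in> carrier (weil_group F v)" for g
    using that WF_stable cochar_act_mult[OF WF_galois] by (auto simp: hom_def)
  show "cochar_act \<one>\<^bsub>weil_group F v\<^esub> x = x" if "x \<in> carrier (cochar_group S)" for x
    using cochar_act_id[OF that] by simp
  show "cochar_act (g \<otimes>\<^bsub>weil_group F v\<^esub> h) x = cochar_act g (cochar_act h x)"
    if "g \<in> carrier (weil_group F v)" "h \<in> carrier (weil_group F v)" "x \<in> carrier (cochar_group S)" for g h x
    using that cochar_act_comp[OF WF_galois WF_galois] by simp
  show "WF.wdeg (g \<otimes>\<^bsub>weil_group F v\<^esub> h) = WF.wdeg g + WF.wdeg h"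
    if "g \<in> carrier (weil_group F v)" "h \<in> carrier (weil_group F v)" for g h
    using that WF.wdeg_comp by simp
  show "Fr \<in> carrier (weil_group F v)" "WF.wdeg Fr = 1" using Fr by auto
  show "finite R" by (rule finite_R)
  show "R \<noteq> {}" using R_unique[OF WF.weil_set_id] by blast
  show "R \<subseteq> carrier (weil_group F v)" using R_WF by auto
  show "rep g \<in> R" if "g \<in> carrier (weil_group F v)" for g using that rep(1) by simp
  show "cochar_act (rep g) x = cochar_act g x"
    if "g \<in> carrier (weil_group F v)" "x \<in> carrier (cochar_group S)" for g x
    using that cochar_act_rep by simp
  show "bij_betw (\<lambda>r. rep (r \<otimes>\<^bsub>weil_group F v\<^esub> w)) R R" if "w \<in> carrier (weil_group F v)" for w
    using that rep_bij by simp
  show "\<exists>f. (\<forall>x\<in>carrier (cochar_group S). \<forall>y\<in>carrier (cochar_group S).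
      f (x \<otimes>\<^bsub>cochar_group S\<^esub> y) = f x + f y) \<and> (\<forall>x\<in>carrier (cochar_group S). u x = exp (f x))"
    if "u \<in> hom (cochar_group S) complex_units" for u
    using character_logarithm[OF that] .
qed

end

section \<open>Classes of cocycles in the dual torus\<close>

lemma finprod_swap:
  assumes "comm_monoid G" "finite A" "\<And>i j. i \<in> A \<Longrightarrow> j \<in> B \<Longrightarrow> g i j \<in> carrier G"
  shows "finprod G (\<lambda>i. finprod G (g i) B) A = finprod G (\<lambda>j. finprod G (\<lambda>i. g i j) A) B"
proof -
  interpret comm_monoid G by fact
  show ?thesis using assms(2,3)
  proof (induction A rule: finite_induct)
    case empty then show ?case by simp
  next
    case (insert a A)
    have c: "(\<lambda>i. finprod G (g i) B) \<in> A \<rightarrow> carrier G" "finprod G (g a) B \<in> carrier G"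
      using insert by (auto intro!: finprod_closed)
    have c2: "(\<lambda>j. finprod G (\<lambda>i. g i j) A) \<in> B \<rightarrow> carrier G" "g a \<in> B \<rightarrow> carrier G"
      using insert by (auto intro!: finprod_closed)
    have "finprod G (\<lambda>i. finprod G (g i) B) (insert a A) =
        finprod G (g a) B \<otimes>\<^bsub>G\<^esub> finprod G (\<lambda>j. finprod G (\<lambda>i. g i j) A) B"
      using insert c by simp
    also have "\<dots> = finprod G (\<lambda>j. g a j \<otimes>\<^bsub>G\<^esub> finprod G (\<lambda>i. g i j) A) B"
      using c2 by (intro finprod_multf[symmetric])
    also have "\<dots> = finprod G (\<lambda>j. finprod G (\<lambda>i. g i j) (insert a A)) B"
      using insert c2 by (intro finprod_cong') (auto simp: Pi_def)
    finally show ?case .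
  qed
qed

lemma powi_sum: "(x::'a::field) \<noteq> 0 \<Longrightarrow> (\<Prod>i\<in>A. x powi f i) = x powi (\<Sum>i\<in>A. f i)"
  by (induction A rule: infinite_finite_induct) (auto simp: power_int_add)

context torus_over_local_field
begin

abbreviation cochars :: "('a \<Rightarrow> 'a^'n^'n) monoid" where "cochars \<equiv> cochar_group S"

lemma dual_torus_simps:
  "s \<in> carrier (dual_torus S) \<longleftrightarrow> s \<in> hom cochars complex_units \<and> s \<in> extensional (carrier cochars)"
  "s \<otimes>\<^bsub>dual_torus S\<^esub> t = (\<lambda>\<mu>\<in>carrier cochars. s \<mu> * t \<mu>)"
  "\<one>\<^bsub>dual_torus S\<^esub> = (\<lambda>\<mu>\<in>carrier cochars. 1)"
  by (simp_all add: dual_torus_def hom_group_def)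

lemma dual_torusD:
  assumes "s \<in> carrier (dual_torus S)"
  shows "\<mu> \<in> carrier cochars \<Longrightarrow> s \<mu> \<noteq> 0" "s \<in> extensional (carrier cochars)"
    "\<mu> \<in> carrier cochars \<Longrightarrow> \<nu> \<in> carrier cochars \<Longrightarrow> s (\<mu> \<otimes>\<^bsub>cochars\<^esub> \<nu>) = s \<mu> * s \<nu>"
    "s \<in> hom cochars complex_units"
  using assms by (auto simp: dual_torus_simps hom_def)

lemma dual_torusI:
  assumes "\<And>\<mu>. \<mu> \<in> carrier cochars \<Longrightarrow> s \<mu> \<noteq> 0" "s \<in> extensional (carrier cochars)"
    "\<And>\<mu> \<nu>. \<mu> \<in> carrier cochars \<Longrightarrow> \<nu> \<in> carrier cochars \<Longrightarrow> s (\<mu> \<otimes>\<^bsub>cochars\<^esub> \<nu>) = s \<mu> * s \<nu>"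
  shows "s \<in> carrier (dual_torus S)"
  using assms by (auto simp: dual_torus_simps hom_def)

lemma dual_restrictI:
  assumes "m \<in> hom cochars complex_units" shows "restrict m (carrier cochars) \<in> carrier (dual_torus S)"
  using assms by (intro dual_torusI) (auto simp: hom_def)

definition dual_inverse :: "(('a \<Rightarrow> 'a^'n^'n) \<Rightarrow> complex) \<Rightarrow> (('a \<Rightarrow> 'a^'n^'n) \<Rightarrow> complex)"
  where "dual_inverse s = (\<lambda>\<mu>\<in>carrier cochars. inverse (s \<mu>))"

lemma dual_inverse_closed: "s \<in> carrier (dual_torus S) \<Longrightarrow> dual_inverse s \<in> carrier (dual_torus S)"
  by (rule dual_torusI) (auto simp: dual_inverse_def dual_torusD)

lemma dual_mult_closed:
  "s \<in> carrier (dual_torus S) \<Longrightarrow> t \<in> carrier (dual_torus S) \<Longrightarrow> s \<otimes>\<^bsub>dual_torus S\<^esub> t \<in> carrier (dual_torus S)"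
  by (rule dual_torusI) (auto simp: dual_torus_simps(2) dual_torusD)

lemma dual_one_closed: "\<one>\<^bsub>dual_torus S\<^esub> \<in> carrier (dual_torus S)"
  by (rule dual_torusI) (auto simp: dual_torus_simps(3))

text \<open>Stated for a subset \<open>D\<close>, since inverses in a submonoid are defined by a description there.\<close>

lemma dual_inverse_eq:
  assumes D: "D \<subseteq> carrier (dual_torus S)" "s \<in> D" "dual_inverse s \<in> D"
  shows "inv\<^bsub>(dual_torus S)\<lparr>carrier := D\<rparr>\<^esub> s = dual_inverse s"
proof -
  have sD: "s \<in> carrier (dual_torus S)" using D by auto
  have "(THE t. t \<in> D \<and> s \<otimes>\<^bsub>dual_torus S\<^esub> t = \<one>\<^bsub>dual_torus S\<^esub> \<and> t \<otimes>\<^bsub>dual_torus S\<^esub> s = \<one>\<^bsub>dual_torus S\<^esub>) = dual_inverse s"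
  proof (rule the_equality)
    show "dual_inverse s \<in> D \<and> s \<otimes>\<^bsub>dual_torus S\<^esub> dual_inverse s = \<one>\<^bsub>dual_torus S\<^esub> \<and>
        dual_inverse s \<otimes>\<^bsub>dual_torus S\<^esub> s = \<one>\<^bsub>dual_torus S\<^esub>"
      using D dual_torusD(1)[OF sD] by (auto simp: dual_torus_simps(2,3) dual_inverse_def restrict_def)
    fix t assume t: "t \<in> D \<and> s \<otimes>\<^bsub>dual_torus S\<^esub> t = \<one>\<^bsub>dual_torus S\<^esub> \<and> t \<otimes>\<^bsub>dual_torus S\<^esub> s = \<one>\<^bsub>dual_torus S\<^esub>"
    show "t = dual_inverse s"
    proof (rule extensionalityI[of _ "carrier cochars"])
      show "t \<in> extensional (carrier cochars)" using t D dual_torusD(2) by blast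
      fix \<mu> assume \<mu>: "\<mu> \<in> carrier cochars"
      have "(s \<otimes>\<^bsub>dual_torus S\<^esub> t) \<mu> = (\<one>\<^bsub>dual_torus S\<^esub>) \<mu>" using t by simp
      then have "s \<mu> * t \<mu> = 1" using \<mu> by (simp add: dual_torus_simps(2,3))
      then have "inverse (s \<mu>) = t \<mu>" by (rule inverse_unique)
      then show "t \<mu> = dual_inverse s \<mu>" using \<mu> by (simp add: dual_inverse_def)
    qed (simp add: dual_inverse_def)
  qed
  then show ?thesis by (simp add: m_inv_def)
qed

lemma dual_inv: "s \<in> carrier (dual_torus S) \<Longrightarrow> inv\<^bsub>dual_torus S\<^esub> s = dual_inverse s"
  using dual_inverse_eq[of "carrier (dual_torus S)" s] dual_inverse_closed by simp

lemma dual_act_apply: "\<mu> \<in> carrier cochars \<Longrightarrow> dual_act S \<sigma> s \<mu> = s (cochar_act (inv_into UNIV \<sigma>) \<mu>)"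
  by (simp add: dual_act_def)

lemma WF_inv_stable: "w \<in> weil_set F v \<Longrightarrow> \<mu> \<in> carrier cochars \<Longrightarrow> cochar_act (inv_into UNIV w) \<mu> \<in> carrier cochars"
  using WF_stable WF.weil_set_inv by blast

lemma weil_cocycles_carrier:
  "z \<in> carrier (weil_cocycles F v S) \<longleftrightarrow> z \<in> weil_set F v \<rightarrow>\<^sub>E carrier (dual_torus S) \<and>
    continuous_map (weil_topology F v) (dual_topology S) z \<and>
    (\<forall>g\<in>weil_set F v. \<forall>h\<in>weil_set F v. z (g \<circ> h) = z g \<otimes>\<^bsub>dual_torus S\<^esub> dual_act S g (z h))"
  by (simp add: weil_cocycles_def cocycle_group_def)

lemma weil_cocycles_mult:
  "z \<otimes>\<^bsub>weil_cocycles F v S\<^esub> z' = (\<lambda>g\<in>weil_set F v. z g \<otimes>\<^bsub>dual_torus S\<^esub> z' g)"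
  by (simp add: weil_cocycles_def cocycle_group_def)

lemma cocycleI:
  assumes "\<And>g. g \<in> weil_set F v \<Longrightarrow> z g \<in> carrier (dual_torus S)"
    and "\<And>g h. g \<in> weil_set F v \<Longrightarrow> h \<in> weil_set F v \<Longrightarrow>
      z (g \<circ> h) = z g \<otimes>\<^bsub>dual_torus S\<^esub> dual_act S g (z h)"
  shows "lat.cocycle z"
  using assms by (auto simp: lat.cocycle_def dual_torus_simps dual_act_apply)

lemma weil_cocycle: "z \<in> carrier (weil_cocycles F v S) \<Longrightarrow> lat.cocycle z"
  by (rule cocycleI) (auto simp: weil_cocycles_carrier)

text \<open>Translation of \<open>z\<close> by the coboundary of \<open>m\<close>. Classes are
  treated as orbits of this operation, which makes do without the group axioms for cocycles.\<close>

definition twist :: "(('a \<Rightarrow> 'a^'n^'n) \<Rightarrow> complex) \<Rightarrow> (('a \<Rightarrow> 'a) \<Rightarrow> ('a \<Rightarrow> 'a^'n^'n) \<Rightarrow> complex) \<Rightarrow>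
    (('a \<Rightarrow> 'a) \<Rightarrow> ('a \<Rightarrow> 'a^'n^'n) \<Rightarrow> complex)"
  where "twist m z = (\<lambda>g\<in>weil_set F v. \<lambda>\<mu>\<in>carrier cochars.
    m (cochar_act (inv_into UNIV g) \<mu>) / m \<mu> * z g \<mu>)"

lemma weil_class_eq: "weil_class F v S z = (\<lambda>m. twist m z) ` carrier (dual_torus S)"
proof -
  have "(\<lambda>g\<in>weil_set F v. (inv\<^bsub>dual_torus S\<^esub> m \<otimes>\<^bsub>dual_torus S\<^esub> dual_act S g m) \<otimes>\<^bsub>dual_torus S\<^esub> z g) = twist m z"
    if "m \<in> carrier (dual_torus S)" for m
    using that
    by (intro ext) (simp add: twist_def restrict_def dual_inv dual_inverse_def dual_torus_simps(2) dual_act_apply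
        divide_inverse mult_ac)
  then have "coboundaries (weil_group F v) (dual_torus S) (dual_act S) #>\<^bsub>weil_cocycles F v S\<^esub> z =
    (\<lambda>m. twist m z) ` carrier (dual_torus S)"
    by (force simp: r_coset_def coboundaries_def weil_cocycles_mult cong: restrict_cong)
  then show ?thesis by (simp add: weil_class_def)
qed

lemma twist_twist:
  assumes "m \<in> carrier (dual_torus S)" "m' \<in> carrier (dual_torus S)"
  shows "twist m (twist m' z) = twist (m \<otimes>\<^bsub>dual_torus S\<^esub> m') z"
  using WF_inv_stable
  by (intro ext) (simp add: twist_def restrict_def dual_torus_simps(2) mult_ac)

lemma twist_one:
  assumes "z \<in> weil_set F v \<rightarrow>\<^sub>E extensional (carrier cochars)"
  shows "twist \<one>\<^bsub>dual_torus S\<^esub> z = z"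
proof (rule extensionalityI[of _ "weil_set F v"])
  fix g assume g: "g \<in> weil_set F v"
  show "twist \<one>\<^bsub>dual_torus S\<^esub> z g = z g"
  proof (rule extensionalityI[of _ "carrier cochars"])
    fix \<mu> assume "\<mu> \<in> carrier cochars"
    then show "twist \<one>\<^bsub>dual_torus S\<^esub> z g \<mu> = z g \<mu>"
      using g WF_inv_stable by (simp add: twist_def dual_torus_simps(3))
  qed (use assms g in \<open>auto simp: twist_def PiE_iff\<close>)
qed (use assms in \<open>auto simp: twist_def PiE_iff\<close>)

text \<open>One inclusion holds for every twist; the other is the same inclusion for the inverse of
  \<open>m\<close>, which undoes the twist.\<close>

lemma class_twist:
  assumes m: "m \<in> carrier (dual_torus S)" and z: "z \<in> weil_set F v \<rightarrow>\<^sub>E extensional (carrier cochars)"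
  shows "weil_class F v S (twist m z) = weil_class F v S z"
proof -
  have sub: "weil_class F v S (twist m y) \<subseteq> weil_class F v S y" if "m \<in> carrier (dual_torus S)" for m y
    using that dual_mult_closed by (auto simp: weil_class_eq twist_twist)
  have "dual_inverse m \<otimes>\<^bsub>dual_torus S\<^esub> m = \<one>\<^bsub>dual_torus S\<^esub>"
    using dual_torusD(1)[OF m] by (auto simp: dual_torus_simps(2,3) dual_inverse_def restrict_def)
  then have "twist (dual_inverse m) (twist m z) = z"
    using twist_twist[OF dual_inverse_closed[OF m] m] twist_one[OF z] by simp
  then have "weil_class F v S z \<subseteq> weil_class F v S (twist m z)"
    using sub[OF dual_inverse_closed[OF m], of "twist m z"] by simp
  then show ?thesis using sub[OF m] by blast
qed

lemma class_self: "z \<in> weil_set F v \<rightarrow>\<^sub>E extensional (carrier cochars) \<Longrightarrow> z \<in> weil_class F v S z"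
  unfolding weil_class_eq using twist_one dual_one_closed by (metis imageI)

lemma weil_cocycles_PiE:
  "z \<in> carrier (weil_cocycles F v S) \<Longrightarrow> z \<in> weil_set F v \<rightarrow>\<^sub>E extensional (carrier cochars)"
  using dual_torusD(2) by (auto simp: weil_cocycles_carrier PiE_iff)

lemma weil_H1_carrier: "carrier (weil_H1 F v S) = weil_class F v S ` carrier (weil_cocycles F v S)"
  by (auto simp: weil_H1_def H1_def FactGroup_def RCOSETS_def weil_class_def weil_cocycles_def)

lemma weil_class_mult:
  "weil_class F v S z \<otimes>\<^bsub>weil_H1 F v S\<^esub> weil_class F v S z' = weil_class F v S (z \<otimes>\<^bsub>weil_cocycles F v S\<^esub> z')"
proof -
  have e: "twist m z \<otimes>\<^bsub>weil_cocycles F v S\<^esub> twist m' z' =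
      twist (m \<otimes>\<^bsub>dual_torus S\<^esub> m') (z \<otimes>\<^bsub>weil_cocycles F v S\<^esub> z')" for m m'
    using WF_inv_stable
    by (intro ext) (simp add: twist_def restrict_def dual_torus_simps(2) weil_cocycles_mult)
  have one: "m \<otimes>\<^bsub>dual_torus S\<^esub> \<one>\<^bsub>dual_torus S\<^esub> = m" if "m \<in> carrier (dual_torus S)" for m
    using dual_torusD(2)[OF that] by (auto simp: dual_torus_simps(2,3) restrict_def extensional_def)
  have "weil_class F v S z \<otimes>\<^bsub>weil_H1 F v S\<^esub> weil_class F v S z' =
      {x \<otimes>\<^bsub>weil_cocycles F v S\<^esub> y | x y. x \<in> weil_class F v S z \<and> y \<in> weil_class F v S z'}"
    by (auto simp: weil_H1_def H1_def FactGroup_def set_mult_def weil_cocycles_def)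
  also have "\<dots> = weil_class F v S (z \<otimes>\<^bsub>weil_cocycles F v S\<^esub> z')"
  proof
    show "{x \<otimes>\<^bsub>weil_cocycles F v S\<^esub> y | x y. x \<in> weil_class F v S z \<and> y \<in> weil_class F v S z'} \<subseteq>
        weil_class F v S (z \<otimes>\<^bsub>weil_cocycles F v S\<^esub> z')"
      by (auto simp: weil_class_eq e dual_mult_closed)
    show "weil_class F v S (z \<otimes>\<^bsub>weil_cocycles F v S\<^esub> z') \<subseteq>
        {x \<otimes>\<^bsub>weil_cocycles F v S\<^esub> y | x y. x \<in> weil_class F v S z \<and> y \<in> weil_class F v S z'}"
    proof
      fix y assume "y \<in> weil_class F v S (z \<otimes>\<^bsub>weil_cocycles F v S\<^esub> z')"
      then obtain m where m: "m \<in> carrier (dual_torus S)" "y = twist m (z \<otimes>\<^bsub>weil_cocycles F v S\<^esub> z')"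
        by (auto simp: weil_class_eq)
      then have "y = twist m z \<otimes>\<^bsub>weil_cocycles F v S\<^esub> twist \<one>\<^bsub>dual_torus S\<^esub> z'" by (simp add: e one)
      then show "y \<in> {x \<otimes>\<^bsub>weil_cocycles F v S\<^esub> y | x y. x \<in> weil_class F v S z \<and> y \<in> weil_class F v S z'}"
        using m(1) dual_one_closed unfolding weil_class_eq by blast
    qed
  qed
  finally show ?thesis .
qed

section \<open>Unramified cocycles\<close>

definition additive :: "(('a \<Rightarrow> 'a^'n^'n) \<Rightarrow> complex) \<Rightarrow> bool"
  where "additive g \<longleftrightarrow> (\<forall>\<mu>\<in>carrier cochars. \<forall>\<nu>\<in>carrier cochars. g (\<mu> \<otimes>\<^bsub>cochars\<^esub> \<nu>) = g \<mu> + g \<nu>)"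

text \<open>The complex parameter \<open>t\<close> serves twice: as the degree of a Weil group
  element, and as the position on a path to the trivial character.\<close>

definition norm_character :: "(('a \<Rightarrow> 'a^'n^'n) \<Rightarrow> complex) \<Rightarrow> complex \<Rightarrow> ('a \<Rightarrow> 'a^'n^'n) \<Rightarrow> complex"
  where "norm_character g t = (\<lambda>\<mu>\<in>carrier cochars. exp (t * g (lat.Nm \<mu>)))"

lemma norm_character_closed: "additive g \<Longrightarrow> norm_character g t \<in> carrier (dual_torus S)"
  by (rule dual_torusI) (auto simp: norm_character_def additive_def lat.Nm_mult distrib_left exp_add)

lemma norm_character_act:
  assumes "w \<in> weil_set F v" shows "dual_act S w (norm_character g t) = norm_character g t"
proof (rule extensionalityI[of _ "carrier cochars"])
  fix \<mu> assume \<mu>: "\<mu> \<in> carrier cochars"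
  have "lat.Nm (cochar_act (inv_into UNIV w) \<mu>) = lat.Nm \<mu>"
    using lat.Nm_act[of "inv_into UNIV w" \<mu>] WF.weil_set_inv[OF assms] \<mu> by simp
  then show "dual_act S w (norm_character g t) \<mu> = norm_character g t \<mu>"
    using \<mu> WF_inv_stable[OF assms \<mu>] by (simp add: dual_act_apply norm_character_def)
qed (auto simp: dual_act_def norm_character_def)

lemma norm_character_mult:
  "norm_character g t \<otimes>\<^bsub>dual_torus S\<^esub> norm_character g t' = norm_character g (t + t')"
  by (auto simp: dual_torus_simps(2) norm_character_def restrict_def distrib_right exp_add)

lemma norm_character_zero: "norm_character g 0 = \<one>\<^bsub>dual_torus S\<^esub>"
  by (auto simp: dual_torus_simps(3) norm_character_def)

definition unramified_cocycle :: "(('a \<Rightarrow> 'a^'n^'n) \<Rightarrow> complex) \<Rightarrow> ('a \<Rightarrow> 'a) \<Rightarrow> ('a \<Rightarrow> 'a^'n^'n) \<Rightarrow> complex"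
  where "unramified_cocycle g = (\<lambda>w\<in>weil_set F v. norm_character g (of_int (WF.wdeg w)))"

lemma topspace_dual: "topspace (dual_topology S) = carrier (dual_torus S)"
  by (auto simp: dual_topology_def topspace_subtopology dual_torus_simps PiE_iff extensional_def)

lemma unramified_cocycle_closed:
  assumes g: "additive g" shows "unramified_cocycle g \<in> carrier (weil_cocycles F v S)"
  unfolding weil_cocycles_carrier
proof (intro conjI ballI)
  show "unramified_cocycle g \<in> weil_set F v \<rightarrow>\<^sub>E carrier (dual_torus S)"
    using norm_character_closed[OF g] by (auto simp: unramified_cocycle_def)
  show "unramified_cocycle g (w \<circ> w') = unramified_cocycle g w \<otimes>\<^bsub>dual_torus S\<^esub> dual_act S w (unramified_cocycle g w')"
    if "w \<in> weil_set F v" "w' \<in> weil_set F v" for w w'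
    using that
    by (simp add: unramified_cocycle_def WF.weil_set_comp WF.wdeg_comp norm_character_act norm_character_mult)
  show "continuous_map (weil_topology F v) (dual_topology S) (unramified_cocycle g)"
    unfolding continuous_map_def
  proof (intro conjI allI impI)
    show "unramified_cocycle g \<in> topspace (weil_topology F v) \<rightarrow> topspace (dual_topology S)"
      using norm_character_closed[OF g] by (auto simp: unramified_cocycle_def topspace_dual)
    fix U assume "openin (dual_topology S) U"
    show "openin (weil_topology F v) {w \<in> topspace (weil_topology F v). unramified_cocycle g w \<in> U}"
    proof (subst openin_subopen, intro ballI)
      fix w assume w: "w \<in> {w \<in> topspace (weil_topology F v). unramified_cocycle g w \<in> U}"
      then have wW: "w \<in> weil_set F v" by simp
      \<comment> \<open>The cocycle depends on the degree alone, so it is constant on the coset of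
        inertia through \<open>w\<close>, an open neighbourhood of \<open>w\<close>.\<close>
      let ?T = "(\<lambda>u. w \<circ> u) ` inertia F v"
      have "w \<in> ?T" using WF.inertia_iff by (intro image_eqI[of _ _ id]) auto
      moreover have "unramified_cocycle g (w \<circ> u) = unramified_cocycle g w \<and> w \<circ> u \<in> weil_set F v" if "u \<in> inertia F v" for u
        using that wW by (simp add: WF.inertia_iff unramified_cocycle_def WF.weil_set_comp WF.wdeg_comp)
      ultimately show "\<exists>T. openin (weil_topology F v) T \<and> w \<in> T \<and>
          T \<subseteq> {w \<in> topspace (weil_topology F v). unramified_cocycle g w \<in> U}"
        using WF.inertia_open[OF wW] w by (intro exI[of _ ?T]) auto
    qed
  qed
qed

lemma class_unramified:
  assumes z: "z \<in> weil_set F v \<rightarrow>\<^sub>E carrier (dual_torus S)" and coc: "lat.cocycle z"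
    and \<Gamma>: "lat.trivializing_graph z \<Gamma>"
  shows "\<exists>g. additive g \<and> weil_class F v S z = weil_class F v S (unramified_cocycle g)"
proof -
  obtain m g where m: "m \<in> hom cochars complex_units" and g: "additive g"
    and e: "\<And>w \<mu>. w \<in> weil_set F v \<Longrightarrow> \<mu> \<in> carrier cochars \<Longrightarrow>
      z w \<mu> = exp (of_int (WF.wdeg w) * g (lat.Nm \<mu>)) * m (cochar_act (inv\<^bsub>weil_group F v\<^esub> w) \<mu>) / m \<mu>"
    using lat.cocycle_cohomologous_unramified[OF coc \<Gamma>] unfolding additive_def WF.weil_group_simps(1) by metis
  let ?m = "restrict m (carrier cochars)"
  have "z = twist ?m (unramified_cocycle g)"
  proof (rule extensionalityI[of _ "weil_set F v"])
    fix w assume w: "w \<in> weil_set F v"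
    show "z w = twist ?m (unramified_cocycle g) w"
    proof (rule extensionalityI[of _ "carrier cochars"])
      show "z w \<in> extensional (carrier cochars)" using z w dual_torusD(2) by blast
      fix \<mu> assume "\<mu> \<in> carrier cochars"
      then show "z w \<mu> = twist ?m (unramified_cocycle g) w \<mu>"
        using e[of w \<mu>] w WF_inv_stable[OF w]
        by (simp add: twist_def unramified_cocycle_def norm_character_def)
    qed (use w in \<open>simp add: twist_def\<close>)
  qed (use z in \<open>auto simp: twist_def PiE_iff\<close>)
  then show ?thesis
    using class_twist[OF dual_restrictI[OF m] weil_cocycles_PiE[OF unramified_cocycle_closed[OF g]]] g by auto
qed

section \<open>The image of inflation\<close>

abbreviation fixed_component :: "(('a \<Rightarrow> 'a^'n^'n) \<Rightarrow> complex) set"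
  where "fixed_component \<equiv> dual_inertia_fixed_component F v S"

abbreviation fixed_topology :: "(('a \<Rightarrow> 'a^'n^'n) \<Rightarrow> complex) topology"
  where "fixed_topology \<equiv> subtopology (dual_topology S) (dual_inertia_fixed F v S)"

lemma inertia_fixedD:
  assumes "s \<in> dual_inertia_fixed F v S"
  shows "s \<in> carrier (dual_torus S)" "w \<in> weil_set F v \<Longrightarrow> WF.wdeg w = 0 \<Longrightarrow> dual_act S w s = s"
    "w \<in> weil_set F v \<Longrightarrow> WF.wdeg w = 0 \<Longrightarrow> \<mu> \<in> carrier cochars \<Longrightarrow>
      s (cochar_act w \<mu>) = s \<mu>"
proof -
  show s: "s \<in> carrier (dual_torus S)" using assms by (auto simp: dual_inertia_fixed_def)
  show act: "dual_act S w s = s" if "w \<in> weil_set F v" "WF.wdeg w = 0" for w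
    using assms that WF.inertia_iff by (auto simp: dual_inertia_fixed_def)
  show "s (cochar_act w \<mu>) = s \<mu>" if w: "w \<in> weil_set F v" "WF.wdeg w = 0" and \<mu>: "\<mu> \<in> carrier cochars"
  proof -
    have "dual_act S (inv_into UNIV w) s = s"
      using w by (intro act) (auto simp: WF.weil_set_inv WF.wdeg_inv)
    then have "dual_act S (inv_into UNIV w) s \<mu> = s \<mu>" by simp
    then show ?thesis using \<mu> by (simp add: dual_act_apply galois_inv(5)[OF WF_galois[OF w(1)]])
  qed
qed

lemma inertia_fixed_topspace: "topspace fixed_topology = dual_inertia_fixed F v S"
  using inertia_fixedD(1) by (auto simp: topspace_subtopology topspace_dual)

lemma fixed_component_eq: "s \<in> fixed_component \<longleftrightarrow>
    (\<exists>T. connectedin fixed_topology T \<and> \<one>\<^bsub>dual_torus S\<^esub> \<in> T \<and> s \<in> T)"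
  by (simp add: dual_inertia_fixed_component_def connected_component_of_def)

lemma fixed_component_fixed: "s \<in> fixed_component \<Longrightarrow> s \<in> dual_inertia_fixed F v S"
  unfolding fixed_component_eq using connectedin_subset_topspace inertia_fixed_topspace by blast

lemma eval_continuous:
  assumes "\<mu> \<in> carrier cochars" shows "continuous_map fixed_topology euclidean (\<lambda>s. s \<mu>)"
  unfolding dual_topology_def
  by (intro continuous_map_from_subtopology continuous_map_product_projection assms)

lemma into_fixed_topology:
  assumes "\<And>x. x \<in> topspace T \<Longrightarrow> h x \<in> dual_inertia_fixed F v S"
    and "\<And>\<mu>. \<mu> \<in> carrier cochars \<Longrightarrow> continuous_map T euclidean (\<lambda>x. h x \<mu>)"
  shows "continuous_map T fixed_topology h"
proof -
  have "h ` topspace T \<subseteq> carrier (dual_torus S)" using assms(1) inertia_fixedD(1) by auto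
  then have "h ` topspace T \<subseteq> extensional (carrier cochars)" using dual_torusD(2) by blast
  then show ?thesis
    using assms \<open>h ` topspace T \<subseteq> carrier (dual_torus S)\<close>
    by (auto simp: dual_topology_def continuous_map_in_subtopology continuous_map_componentwise)
qed

text \<open>Inversion is a continuous map of the fixed points into themselves that preserves the
  identity, so it preserves the component. With \<open>dual_inverse_eq\<close> it shows that the
  inverse used in \<open>unramified_coboundaries\<close> is the true one.\<close>

lemma fixed_component_inverse: "s \<in> fixed_component \<Longrightarrow> dual_inverse s \<in> fixed_component"
proof -
  assume "s \<in> fixed_component"
  then obtain T where T: "connectedin fixed_topology T" "\<one>\<^bsub>dual_torus S\<^esub> \<in> T" "s \<in> T"
    unfolding fixed_component_eq by blast
  have fixed: "dual_inverse t \<in> dual_inertia_fixed F v S" if t: "t \<in> dual_inertia_fixed F v S" for t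
  proof -
    have "dual_act S w (dual_inverse t) = dual_inverse t" if w: "w \<in> inertia F v" for w
    proof (rule extensionalityI[of _ "carrier cochars"])
      fix \<mu> assume \<mu>: "\<mu> \<in> carrier cochars"
      have W: "w \<in> weil_set F v" "WF.wdeg w = 0" using w WF.inertia_iff by auto
      have "t (cochar_act (inv_into UNIV w) \<mu>) = t \<mu>"
        using W \<mu> by (intro inertia_fixedD(3)[OF t]) (auto simp: WF.weil_set_inv WF.wdeg_inv)
      then show "dual_act S w (dual_inverse t) \<mu> = dual_inverse t \<mu>"
        using \<mu> WF_inv_stable[OF W(1) \<mu>] by (simp add: dual_act_apply dual_inverse_def)
    qed (auto simp: dual_act_def dual_inverse_def)
    then show ?thesis
      using dual_inverse_closed[OF inertia_fixedD(1)[OF t]] by (simp add: dual_inertia_fixed_def)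
  qed
  have "continuous_map fixed_topology fixed_topology dual_inverse"
  proof (rule into_fixed_topology)
    show "dual_inverse t \<in> dual_inertia_fixed F v S" if "t \<in> topspace fixed_topology" for t
      using that fixed inertia_fixed_topspace by blast
    fix \<mu> assume \<mu>: "\<mu> \<in> carrier cochars"
    have "(\<lambda>t. t \<mu>) \<in> topspace fixed_topology \<rightarrow> - {0}"
      using inertia_fixed_topspace inertia_fixedD(1) dual_torusD(1)[OF _ \<mu>] by blast
    then have "continuous_map fixed_topology (top_of_set (- {0})) (\<lambda>t. t \<mu>)"
      using eval_continuous[OF \<mu>] by (simp add: continuous_map_in_subtopology image_subset_iff_funcset)
    moreover have "continuous_map (top_of_set (- {0})) euclidean (inverse :: complex \<Rightarrow> complex)"
      by (simp add: continuous_on_inverse)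
    ultimately have "continuous_map fixed_topology euclidean (inverse \<circ> (\<lambda>t. t \<mu>))"
      by (rule continuous_map_compose)
    then have "continuous_map fixed_topology euclidean (\<lambda>t. inverse (t \<mu>))" by (simp only: o_def)
    then show "continuous_map fixed_topology euclidean (\<lambda>t. dual_inverse t \<mu>)"
      using \<mu> by (simp add: dual_inverse_def)
  qed
  from connectedin_continuous_map_image[OF this T(1)]
  have "connectedin fixed_topology (dual_inverse ` T)" .
  moreover have "dual_inverse \<one>\<^bsub>dual_torus S\<^esub> = \<one>\<^bsub>dual_torus S\<^esub>"
    by (auto simp: dual_inverse_def dual_torus_simps(3))
  then have "\<one>\<^bsub>dual_torus S\<^esub> \<in> dual_inverse ` T" using T(2) by force
  ultimately show ?thesis unfolding fixed_component_eq using T(3) by blast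
qed

text \<open>The path \<open>t \<mapsto> exp (t * g (Nm \<mu>))\<close> joins a norm character to the trivial character.\<close>

lemma norm_character_component:
  assumes g: "additive g" shows "norm_character g t \<in> fixed_component"
proof -
  let ?h = "\<lambda>x::real. norm_character g (of_real x * t)"
  have fixed: "norm_character g t' \<in> dual_inertia_fixed F v S" for t'
    using norm_character_closed[OF g] norm_character_act WF.inertia_iff by (auto simp: dual_inertia_fixed_def)
  have "continuous_map euclidean fixed_topology ?h"
  proof (rule into_fixed_topology)
    fix \<mu> assume \<mu>: "\<mu> \<in> carrier cochars"
    have "continuous_on UNIV (\<lambda>x. exp (complex_of_real x * t * g (lat.Nm \<mu>)))"
      by (intro continuous_intros)
    then show "continuous_map euclidean euclidean (\<lambda>x. ?h x \<mu>)" using \<mu> by (simp add: norm_character_def)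
  qed (rule fixed)
  then have "connectedin fixed_topology (?h ` UNIV)"
    by (rule connectedin_continuous_map_image) simp
  moreover have "?h 0 = \<one>\<^bsub>dual_torus S\<^esub>" "?h 1 = norm_character g t" by (simp_all add: norm_character_zero)
  ultimately show ?thesis unfolding fixed_component_eq by (metis rangeI)
qed

text \<open>On a cocharacter with a multiple in the augmentation subgroup, an inertia-fixed element takes
  a root of unity as value, which is constant on connected sets.\<close>

lemma fixed_component_torsion:
  assumes s: "s \<in> fixed_component" and \<mu>: "\<mu> \<in> carrier cochars"
    and n: "n > 0" "\<mu> [^]\<^bsub>cochars\<^esub> (n::nat) \<in> lat.augmentation"
  shows "s \<mu> = 1"
proof -
  obtain T where T: "connectedin fixed_topology T" "\<one>\<^bsub>dual_torus S\<^esub> \<in> T" "s \<in> T"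
    using s unfolding fixed_component_eq by blast
  have Tf: "t \<in> dual_inertia_fixed F v S" if "t \<in> T" for t
    using connectedin_subset_topspace[OF T(1)] inertia_fixed_topspace that by blast
  have root: "t \<mu> ^ n = 1" if "t \<in> T" for t
  proof -
    have tf: "t \<in> dual_inertia_fixed F v S" using Tf[OF that] .
    have td: "t \<in> carrier (dual_torus S)" using inertia_fixedD(1)[OF tf] .
    interpret t: group_hom cochars complex_units t
      using dual_torusD(4)[OF td] by (simp add: group_hom_def group_hom_axioms_def lat.L.is_group units.is_group)
    have disp: "t (lat.displacement w \<nu>) = 1" if w: "w \<in> weil_set F v" "WF.wdeg w = 0" and \<nu>: "\<nu> \<in> carrier cochars" for w \<nu>
    proof -
      have "t (cochar_act (inv_into UNIV w) \<nu>) = t \<nu>"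
        using w \<nu> by (intro inertia_fixedD(3)[OF tf]) (auto simp: WF.weil_set_inv WF.wdeg_inv)
      then show ?thesis
        using w \<nu> WF_inv_stable[OF w(1) \<nu>] dual_torusD(1)[OF td \<nu>] by (simp add: lat.displacement_def)
    qed
    have "\<nu> \<in> carrier cochars \<and> t \<nu> = 1" if "\<nu> \<in> lat.augmentation" for \<nu>
      using that unfolding lat.augmentation_def
    proof (induction rule: generate.induct)
      case one then show ?case using t.hom_one by simp
    next
      case (incl \<nu>) then show ?case using disp by auto
    next
      case (inv \<nu>)
      then have "\<nu> \<in> carrier cochars" "t \<nu> = 1" using disp by auto
      then show ?case by simp
    next
      case (eng \<nu> \<nu>') then show ?case by simp
    qed
    then have "t (\<mu> [^]\<^bsub>cochars\<^esub> n) = 1" using n(2) by blast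
    moreover have "t (\<mu> [^]\<^bsub>cochars\<^esub> k) = t \<mu> ^ k" for k :: nat
      using \<mu> by (induction k) (use t.hom_one in auto)
    ultimately show ?thesis by simp
  qed
  have "connectedin euclidean ((\<lambda>t. t \<mu>) ` T)"
    by (rule connectedin_continuous_map_image[OF eval_continuous[OF \<mu>] T(1)])
  moreover have "finite ((\<lambda>t. t \<mu>) ` T)"
  proof (rule finite_subset)
    show "finite {z::complex. z ^ n = 1}" using n(1) by (intro finite_roots_unity) simp
  qed (use root in auto)
  ultimately have "(\<lambda>t. t \<mu>) ` T = {} \<or> (\<exists>x. (\<lambda>t. t \<mu>) ` T = {x})"
    using connected_finite_iff_sing[of "(\<lambda>t. t \<mu>) ` T"] by simp
  moreover have "1 \<in> (\<lambda>t. t \<mu>) ` T" using T(2) by (rule image_eqI[rotated]) (simp add: dual_torus_simps(3) \<mu>)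
  ultimately obtain x where x: "(\<lambda>t. t \<mu>) ` T = {x}" "1 \<in> (\<lambda>t. t \<mu>) ` T" by (metis empty_iff)
  then have "t' \<mu> = 1" if "t' \<in> T" for t'
    using that by (metis image_eqI singletonD)
  then show ?thesis using T(3) by blast
qed

section \<open>The quotient by inertia and the inflation of classes\<close>

abbreviation weil_quotient :: "('a \<Rightarrow> 'a) set monoid"
  where "weil_quotient \<equiv> weil_group F v Mod inertia F v"

definition inertia_coset :: "('a \<Rightarrow> 'a) \<Rightarrow> ('a \<Rightarrow> 'a) set"
  where "inertia_coset w = inertia F v #>\<^bsub>weil_group F v\<^esub> w"

lemma inertia_coset_eq: "w \<in> weil_set F v \<Longrightarrow> inertia_coset w = {w' \<in> weil_set F v. WF.wdeg w' = WF.wdeg w}"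
proof -
  assume w: "w \<in> weil_set F v"
  have "w' \<in> inertia_coset w" if w': "w' \<in> weil_set F v" "WF.wdeg w' = WF.wdeg w" for w'
  proof -
    have "w' \<circ> inv_into UNIV w \<in> inertia F v"
      using w w' by (simp add: WF.inertia_iff WF.weil_set_comp WF.weil_set_inv WF.wdeg_comp WF.wdeg_inv)
    moreover have "w' = (w' \<circ> inv_into UNIV w) \<circ> w"
      using galois_inv(2)[OF WF_galois[OF w]] by (auto simp: fun_eq_iff)
    ultimately show ?thesis by (auto simp: inertia_coset_def r_coset_def)
  qed
  then show ?thesis
    using w by (auto simp: inertia_coset_def r_coset_def WF.inertia_iff WF.weil_set_comp WF.wdeg_comp)
qed

lemma weil_quotient_simps:
  "carrier weil_quotient = inertia_coset ` weil_set F v"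
  "w \<in> weil_set F v \<Longrightarrow> w' \<in> weil_set F v \<Longrightarrow>
    inertia_coset w <#>\<^bsub>weil_group F v\<^esub> inertia_coset w' = inertia_coset (w \<circ> w')"
proof -
  show "carrier weil_quotient = inertia_coset ` weil_set F v"
    by (auto simp: FactGroup_def RCOSETS_def inertia_coset_def)
  assume w: "w \<in> weil_set F v" "w' \<in> weil_set F v"
  have e: "inertia_coset w <#>\<^bsub>weil_group F v\<^esub> inertia_coset w' =
      {g \<circ> h | g h. g \<in> inertia_coset w \<and> h \<in> inertia_coset w'}"
    by (auto simp: set_mult_def)
  have "x \<in> {g \<circ> h | g h. g \<in> inertia_coset w \<and> h \<in> inertia_coset w'}"
    if x: "x \<in> weil_set F v" "WF.wdeg x = WF.wdeg w + WF.wdeg w'" for x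
  proof -
    have "x = w \<circ> (inv_into UNIV w \<circ> x)" using galois_inv(1)[OF WF_galois[OF w(1)]] by (auto simp: fun_eq_iff)
    moreover have "inv_into UNIV w \<circ> x \<in> inertia_coset w'" "w \<in> inertia_coset w"
      using w x by (auto simp: inertia_coset_eq WF.weil_set_comp WF.weil_set_inv WF.wdeg_comp WF.wdeg_inv)
    ultimately show ?thesis by blast
  qed
  then show "inertia_coset w <#>\<^bsub>weil_group F v\<^esub> inertia_coset w' = inertia_coset (w \<circ> w')"
    unfolding e using w by (auto simp: inertia_coset_eq WF.weil_set_comp WF.wdeg_comp)
qed

lemma inertia_coset_rep:
  "w \<in> weil_set F v \<Longrightarrow> (SOME x. x \<in> inertia_coset w) \<in> weil_set F v \<and>
    WF.wdeg (SOME x. x \<in> inertia_coset w) = WF.wdeg w"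
  using someI[of "\<lambda>x. x \<in> inertia_coset w" w] by (auto simp: inertia_coset_eq)

text \<open>The chosen representative differs from \<open>w\<close> by an inertia element, which
  acts trivially on fixed points. The choice in \<open>unramified_H1\<close> is thereby
  harmless.\<close>

lemma dual_act_fixed:
  assumes s: "s \<in> dual_inertia_fixed F v S" and w: "w \<in> weil_set F v"
  shows "dual_act S (SOME x. x \<in> inertia_coset w) s = dual_act S w s"
proof (rule extensionalityI[of _ "carrier cochars"])
  define x where "x = (SOME x. x \<in> inertia_coset w)"
  have x: "x \<in> weil_set F v" "WF.wdeg x = WF.wdeg w" using inertia_coset_rep[OF w] by (auto simp: x_def)
  fix \<mu> assume \<mu>: "\<mu> \<in> carrier cochars"
  have "inv_into UNIV x = (inv_into UNIV x \<circ> w) \<circ> inv_into UNIV w"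
    using galois_inv(1)[OF WF_galois[OF w]] by (auto simp: fun_eq_iff)
  then have 1: "cochar_act (inv_into UNIV x) \<mu> = cochar_act (inv_into UNIV x \<circ> w) (cochar_act (inv_into UNIV w) \<mu>)"
    using cochar_act_comp[of "inv_into UNIV x \<circ> w" F "inv_into UNIV w" \<mu>] WF_galois x w
    by (simp add: galois_set_closed)
  have "s (cochar_act (inv_into UNIV x \<circ> w) (cochar_act (inv_into UNIV w) \<mu>)) = s (cochar_act (inv_into UNIV w) \<mu>)"
    using x w \<mu> by (intro inertia_fixedD(3)[OF s])
      (auto simp: WF.weil_set_comp WF.weil_set_inv WF.wdeg_comp WF.wdeg_inv WF_inv_stable)
  then show "dual_act S (SOME x. x \<in> inertia_coset w) s \<mu> = dual_act S w s \<mu>"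
    unfolding x_def[symmetric] using \<mu> 1 by (simp add: dual_act_apply)
qed (auto simp: dual_act_def)

definition inflate :: "(('a \<Rightarrow> 'a) set \<Rightarrow> ('a \<Rightarrow> 'a^'n^'n) \<Rightarrow> complex) \<Rightarrow> ('a \<Rightarrow> 'a) \<Rightarrow> ('a \<Rightarrow> 'a^'n^'n) \<Rightarrow> complex"
  where "inflate z = (\<lambda>w\<in>weil_set F v. z (inertia_coset w))"

lemma inflation_map_eq: "inflation_map F v S C = (\<Union>z\<in>C. weil_class F v S (inflate z))"
  by (simp add: inflation_map_def inflate_def inertia_coset_def)

abbreviation unramified_cocycles :: "(('a \<Rightarrow> 'a) set \<Rightarrow> ('a \<Rightarrow> 'a^'n^'n) \<Rightarrow> complex) monoid"
  where "unramified_cocycles \<equiv> cocycle_group weil_quotient (discrete_topology (carrier weil_quotient))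
    ((dual_torus S)\<lparr>carrier := fixed_component\<rparr>) (subtopology (dual_topology S) fixed_component)
    (\<lambda>C. dual_act S (SOME w. w \<in> C))"

abbreviation unramified_coboundaries :: "(('a \<Rightarrow> 'a) set \<Rightarrow> ('a \<Rightarrow> 'a^'n^'n) \<Rightarrow> complex) set"
  where "unramified_coboundaries \<equiv> coboundaries weil_quotient ((dual_torus S)\<lparr>carrier := fixed_component\<rparr>)
    (\<lambda>C. dual_act S (SOME w. w \<in> C))"

lemma unramified_H1_carrier:
  "carrier (unramified_H1 F v S) =
    (\<lambda>z. unramified_coboundaries #>\<^bsub>unramified_cocycles\<^esub> z) ` carrier unramified_cocycles"
  by (auto simp: unramified_H1_def H1_def FactGroup_def RCOSETS_def)

lemma fixed_component_subset: "fixed_component \<subseteq> carrier (dual_torus S)"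
  using fixed_component_fixed inertia_fixedD(1) by blast

lemma one_in_component: "\<one>\<^bsub>dual_torus S\<^esub> \<in> fixed_component"
  using norm_character_component[of "\<lambda>_. 0" 0] norm_character_zero by (metis additive_def add_0)

lemma unramified_cocycles_carrier:
  "z \<in> carrier unramified_cocycles \<longleftrightarrow> z \<in> inertia_coset ` weil_set F v \<rightarrow>\<^sub>E fixed_component \<and>
    (\<forall>g\<in>weil_set F v. \<forall>h\<in>weil_set F v. z (inertia_coset (g \<circ> h)) =
      z (inertia_coset g) \<otimes>\<^bsub>dual_torus S\<^esub> dual_act S (SOME w. w \<in> inertia_coset g) (z (inertia_coset h)))"
  using fixed_component_subset
  by (auto simp: cocycle_group_def weil_quotient_simps topspace_subtopology topspace_dual PiE_iff)

text \<open>Inflating a coboundary with values in the component gives a coboundary over the Weil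
  group. So all members of a class inflate into one class, and the union in
  \<open>inflation_map\<close> is that class.\<close>

lemma inflated_class:
  assumes z: "z \<in> carrier unramified_cocycles" and y: "y \<in> unramified_coboundaries #>\<^bsub>unramified_cocycles\<^esub> z"
  shows "\<exists>m\<in>carrier (dual_torus S). inflate y = twist m (inflate z)"
proof -
  obtain m where m: "m \<in> fixed_component"
    and ye: "y = (\<lambda>C\<in>carrier weil_quotient. ((\<lambda>C\<in>carrier weil_quotient.
       inv\<^bsub>(dual_torus S)\<lparr>carrier := fixed_component\<rparr>\<^esub> m \<otimes>\<^bsub>dual_torus S\<^esub> dual_act S (SOME w. w \<in> C) m) C)
         \<otimes>\<^bsub>dual_torus S\<^esub> z C)"
    using y by (auto simp: r_coset_def coboundaries_def cocycle_group_def)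
  have md: "m \<in> carrier (dual_torus S)" using m fixed_component_subset by blast
  have inv: "inv\<^bsub>(dual_torus S)\<lparr>carrier := fixed_component\<rparr>\<^esub> m = dual_inverse m"
    using dual_inverse_eq[OF fixed_component_subset m fixed_component_inverse[OF m]] .
  have "inflate y w = twist m (inflate z) w" if w: "w \<in> weil_set F v" for w
  proof -
    have "inflate y w = (dual_inverse m \<otimes>\<^bsub>dual_torus S\<^esub> dual_act S w m) \<otimes>\<^bsub>dual_torus S\<^esub> z (inertia_coset w)"
      using w by (simp add: inflate_def ye inv weil_quotient_simps(1) dual_act_fixed[OF fixed_component_fixed[OF m]])
    also have "\<dots> = twist m (inflate z) w"
      using w by (auto simp: twist_def inflate_def dual_torus_simps(2) dual_inverse_def dual_act_apply
          restrict_def divide_inverse mult_ac)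
    finally show ?thesis .
  qed
  then have "inflate y = twist m (inflate z)"
    by (intro extensionalityI[of _ "weil_set F v"]) (auto simp: inflate_def twist_def)
  then show ?thesis using md by blast
qed

text \<open>The coboundary of the identity is trivial. This makes the union in
  \<open>inflation_map\<close> range over a non-empty set.\<close>

lemma cocycle_in_own_class:
  assumes z: "z \<in> carrier unramified_cocycles"
  shows "z \<in> unramified_coboundaries #>\<^bsub>unramified_cocycles\<^esub> z"
proof -
  let ?M = "(dual_torus S)\<lparr>carrier := fixed_component\<rparr>"
  let ?b = "\<lambda>C\<in>carrier weil_quotient. inv\<^bsub>?M\<^esub> \<one>\<^bsub>dual_torus S\<^esub> \<otimes>\<^bsub>dual_torus S\<^esub> dual_act S (SOME w. w \<in> C) \<one>\<^bsub>dual_torus S\<^esub>"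
  have b: "?b \<in> unramified_coboundaries"
    using one_in_component by (auto simp: coboundaries_def)
  have inv: "inv\<^bsub>?M\<^esub> \<one>\<^bsub>dual_torus S\<^esub> = \<one>\<^bsub>dual_torus S\<^esub>"
    using dual_inverse_eq[OF fixed_component_subset one_in_component fixed_component_inverse[OF one_in_component]]
    by (auto simp: dual_inverse_def dual_torus_simps(3))
  have "?b \<otimes>\<^bsub>unramified_cocycles\<^esub> z = z"
  proof (rule extensionalityI[of _ "carrier weil_quotient"])
    show "z \<in> extensional (carrier weil_quotient)"
      using z by (auto simp: cocycle_group_def PiE_iff)
    fix C assume C: "C \<in> carrier weil_quotient"
    then obtain w where w: "w \<in> weil_set F v" "C = inertia_coset w" by (auto simp: weil_quotient_simps)
    have "z C \<in> carrier (dual_torus S)"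
      using z C fixed_component_subset by (auto simp: cocycle_group_def PiE_iff)
    then have ext: "z C \<in> extensional (carrier cochars)" by (rule dual_torusD(2))
    have "dual_act S (SOME x. x \<in> inertia_coset w) \<one>\<^bsub>dual_torus S\<^esub> = \<one>\<^bsub>dual_torus S\<^esub>"
      using inertia_coset_rep[OF w(1)] WF_inv_stable
      by (auto simp: dual_act_def dual_torus_simps(3) restrict_def)
    then show "(?b \<otimes>\<^bsub>unramified_cocycles\<^esub> z) C = z C"
      using C w inv ext
      by (auto simp: cocycle_group_def dual_torus_simps(2,3) restrict_def extensional_def fun_eq_iff)
  qed (simp add: cocycle_group_def)
  then show ?thesis using b by (force simp: r_coset_def)
qed

lemma unramified_class_inflated:
  assumes g: "additive g"
  shows "weil_class F v S (unramified_cocycle g) \<in> inflation_map F v S ` carrier (unramified_H1 F v S)"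
proof -
  define z where "z = (\<lambda>C\<in>inertia_coset ` weil_set F v. norm_character g (of_int (WF.wdeg (SOME w. w \<in> C))))"
  have zw: "z (inertia_coset w) = norm_character g (of_int (WF.wdeg w))" if "w \<in> weil_set F v" for w
    using that inertia_coset_rep[OF that] by (simp add: z_def)
  have z: "z \<in> carrier unramified_cocycles"
    unfolding unramified_cocycles_carrier
  proof (intro conjI ballI)
    show "z \<in> inertia_coset ` weil_set F v \<rightarrow>\<^sub>E fixed_component"
      using norm_character_component[OF g] by (auto simp: z_def)
    fix w w' assume w: "w \<in> weil_set F v" "w' \<in> weil_set F v"
    show "z (inertia_coset (w \<circ> w')) =
        z (inertia_coset w) \<otimes>\<^bsub>dual_torus S\<^esub> dual_act S (SOME x. x \<in> inertia_coset w) (z (inertia_coset w'))"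
      using w inertia_coset_rep[OF w(1)]
      by (simp add: zw WF.weil_set_comp WF.wdeg_comp norm_character_act norm_character_mult)
  qed
  have infl: "inflate z = unramified_cocycle g"
    by (intro extensionalityI[of _ "weil_set F v"]) (auto simp: inflate_def unramified_cocycle_def zw)
  let ?C = "unramified_coboundaries #>\<^bsub>unramified_cocycles\<^esub> z"
  have "weil_class F v S (inflate y) = weil_class F v S (unramified_cocycle g)" if "y \<in> ?C" for y
    using inflated_class[OF z that] class_twist[OF _ weil_cocycles_PiE[OF unramified_cocycle_closed[OF g]]] infl by auto
  then have "inflation_map F v S ?C = weil_class F v S (unramified_cocycle g)"
    unfolding inflation_map_eq using cocycle_in_own_class[OF z] by blast
  moreover have "?C \<in> carrier (unramified_H1 F v S)" unfolding unramified_H1_carrier using z by blast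
  ultimately show ?thesis by blast
qed

lemma inflated_class_unramified:
  assumes z: "z \<in> carrier (weil_cocycles F v S)"
    and infl: "weil_class F v S z \<in> inflation_map F v S ` carrier (unramified_H1 F v S)"
  shows "\<exists>g. additive g \<and> weil_class F v S z = weil_class F v S (unramified_cocycle g)"
proof -
  obtain y where y: "y \<in> carrier unramified_cocycles"
    and e: "weil_class F v S z = inflation_map F v S (unramified_coboundaries #>\<^bsub>unramified_cocycles\<^esub> y)"
    using infl unfolding unramified_H1_carrier by blast
  have yf: "y (inertia_coset w) \<in> fixed_component" if "w \<in> weil_set F v" for w
    using y that by (auto simp: unramified_cocycles_carrier PiE_iff)
  have PiE: "inflate y \<in> weil_set F v \<rightarrow>\<^sub>E carrier (dual_torus S)"
    using yf fixed_component_subset by (auto simp: inflate_def)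
  then have ext: "inflate y \<in> weil_set F v \<rightarrow>\<^sub>E extensional (carrier cochars)"
    using dual_torusD(2) by (auto simp: PiE_iff)
  \<comment> \<open>The equality of classes is used only through membership:
    \<open>inflate y\<close> is a twist of \<open>z\<close>, and its continuity does not have to be
    checked.\<close>
  have "inflate y \<in> weil_class F v S z"
    unfolding e inflation_map_eq using class_self[OF ext] cocycle_in_own_class[OF y] by blast
  then obtain m where "m \<in> carrier (dual_torus S)" "inflate y = twist m z" by (auto simp: weil_class_eq)
  then have same: "weil_class F v S (inflate y) = weil_class F v S z"
    using class_twist weil_cocycles_PiE[OF z] by metis
  have coc: "lat.cocycle (inflate y)"
  proof (rule cocycleI)
    show "inflate y w \<in> carrier (dual_torus S)" if "w \<in> weil_set F v" for w using PiE that by blast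
    show "inflate y (w \<circ> w') = inflate y w \<otimes>\<^bsub>dual_torus S\<^esub> dual_act S w (inflate y w')"
      if w: "w \<in> weil_set F v" "w' \<in> weil_set F v" for w w'
      using y w dual_act_fixed[OF fixed_component_fixed[OF yf[OF w(2)]] w(1)]
      by (simp add: unramified_cocycles_carrier inflate_def WF.weil_set_comp)
  qed
  \<comment> \<open>An inertia element lies in the coset of \<open>id\<close>. There the cocycle
    identity makes the value equal to its own square, hence 1.\<close>
  have one: "inflate y w \<mu> = 1" if w: "w \<in> weil_set F v" "WF.wdeg w = 0" and \<mu>: "\<mu> \<in> carrier cochars" for w \<mu>
  proof -
    have "inertia_coset w = inertia_coset id" using w by (simp add: inertia_coset_eq)
    then have "inflate y w \<mu> = inflate y id \<mu>" using w by (simp add: inflate_def)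
    moreover have "inflate y (id \<circ> id) \<mu> = inflate y id \<mu> * inflate y id (cochar_act (inv\<^bsub>weil_group F v\<^esub> id) \<mu>)"
      using coc \<mu> WF.weil_set_id unfolding lat.cocycle_def WF.weil_group_simps by blast
    then have "inflate y id \<mu> = inflate y id \<mu> * inflate y id \<mu>"
      using cochar_act_id[OF \<mu>] by (simp add: inv_id)
    then have "inflate y id \<mu> = 1" using lat.cocycle_nonzero[OF coc, of id \<mu>] \<mu> by simp
    ultimately show ?thesis by simp
  qed
  have "\<exists>\<Gamma>. lat.trivializing_graph (inflate y) \<Gamma>"
  proof (rule lat.trivializing_graph_if_torsion[OF coc])
    show "inflate y w \<mu> = 1" if "w \<in> carrier (weil_group F v)" "WF.wdeg w = 0" "\<mu> \<in> carrier cochars" for w \<mu>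
      using that one by simp
    show "inflate y Fr \<mu> = 1"
      if "\<mu> \<in> carrier cochars" "n > 0" "\<mu> [^]\<^bsub>cochars\<^esub> (n::nat) \<in> lat.augmentation" for n \<mu>
      using fixed_component_torsion[OF yf[OF Fr(1)] that] Fr(1) by (simp add: inflate_def)
  qed
  then show ?thesis using class_unramified[OF PiE coc] same by metis
qed

end

section \<open>Characters under the Langlands correspondence\<close>

text \<open>\<open>E\<close> and \<open>R\<close> are the witnesses in
  \<open>langlands_correspondence\<close>, so \<open>LLC_cycle\<close> is available for this one
  choice only. \<open>rec_galois\<close> already incorporates that \<open>E\<close> is stable under
  the Galois group.\<close>

locale langlands_for_torus = torus_over_local_field S E rk \<iota> v p F b c R
  for S :: "('a::field^'n^'n) set" and E rk \<iota> and v :: "'a \<Rightarrow> real" and p F b c R +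
  fixes rec :: "'a set \<Rightarrow> 'a \<Rightarrow> ('a \<Rightarrow> 'a) set"
    and LLC :: "(('a \<Rightarrow> 'a) \<Rightarrow> ('a \<Rightarrow> 'a^'n^'n) \<Rightarrow> complex) set \<Rightarrow> 'a^'n^'n \<Rightarrow> complex"
  assumes rec_iso: "rec E \<in> iso (mult_group E) (weil_ab E v)"
    and rec_uniformizer: "uniformizer E v u \<Longrightarrow> g \<in> rec E u \<Longrightarrow> frobenius_power E v g 1"
    and rec_galois: "\<sigma> \<in> galois_set F \<Longrightarrow> x \<in> E - {0} \<Longrightarrow>
      rec E (\<sigma> x) = (\<lambda>w. \<sigma> \<circ> w \<circ> inv_into UNIV \<sigma>) ` rec E x"
    and uniformizer_E: "\<exists>u. uniformizer E v u"
    and LLC_iso: "LLC \<in> iso (weil_H1 F v S) (continuous_characters v S F)"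
    and LLC_cycle: "z \<in> carrier (weil_cocycles F v S) \<Longrightarrow> one_cycle F v S m w l \<Longrightarrow>
      (\<And>i r. i < m \<Longrightarrow> r \<in> R \<Longrightarrow> a i r \<in> E - {0} \<and> transfer_part E v R (r \<circ> w i) \<in> rec E (a i r)) \<Longrightarrow>
      LLC (weil_class F v S z)
        (finprod (torus_points S E) (\<lambda>i.
          finprod (torus_points S E) (\<lambda>r. cochar_act r (l i) (a i r)) R) {..<m}) =
      (\<Prod>i<m. z (w i) (l i))"
begin

lemma rec_coset: "a \<in> E - {0} \<Longrightarrow> rec E a \<noteq> {}" "a \<in> E - {0} \<Longrightarrow> rec E a \<subseteq> weil_set E v"
proof -
  have "a \<in> E - {0} \<Longrightarrow> rec E a \<in> carrier (weil_ab E v)"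
    using rec_iso by (auto simp: iso_def hom_def)
  then show "a \<in> E - {0} \<Longrightarrow> rec E a \<noteq> {}" "a \<in> E - {0} \<Longrightarrow> rec E a \<subseteq> weil_set E v"
    using WE.weil_ab_coset by blast+
qed

lemma rec_surj: "w \<in> weil_set E v \<Longrightarrow> \<exists>a\<in>E - {0}. w \<in> rec E a"
proof -
  assume "w \<in> weil_set E v"
  then obtain C where C: "C \<in> carrier (weil_ab E v)" "w \<in> C" using WE.weil_ab_cover by blast
  have "rec E ` carrier (mult_group E) = carrier (weil_ab E v)"
    using rec_iso by (auto simp: iso_def bij_betw_def)
  then obtain a where "a \<in> carrier (mult_group E)" "C = rec E a" using C(1) by blast
  then show ?thesis using C by auto
qed

definition \<pi> :: 'a where "\<pi> = (SOME x. uniformizer E v x)"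

lemma \<pi>: "uniformizer E v \<pi>" "0 < v \<pi>" "v \<pi> < 1" "\<pi> \<noteq> 0"
proof -
  show u: "uniformizer E v \<pi>" unfolding \<pi>_def using uniformizer_E by (rule someI_ex)
  then show "0 < v \<pi>" "v \<pi> < 1" unfolding uniformizer_def by auto
  then show "\<pi> \<noteq> 0" by auto
qed

lemma rec_valuation: "a \<in> E - {0} \<Longrightarrow> w \<in> rec E a \<Longrightarrow> v a = v \<pi> powi WE.wdeg w"
  using WE.reciprocity_valuation[OF rec_iso _ \<pi>(1), of a w] rec_uniformizer by auto

lemma subfield_F: "subfield F field_of_type"
  by (rule WF.subfield_K)

lemma weil_class_in_H1: "z \<in> carrier (weil_cocycles F v S) \<Longrightarrow> weil_class F v S z \<in> carrier (weil_H1 F v S)"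
  unfolding weil_H1_carrier by blast

lemma LLC_character:
  assumes "C \<in> carrier (weil_H1 F v S)"
  shows "LLC C \<in> hom (torus_points S F) complex_units" "LLC C \<in> extensional (carrier (torus_points S F))"
proof -
  have "LLC C \<in> carrier (continuous_characters v S F)"
    using LLC_iso assms unfolding iso_def hom_def by blast
  then show "LLC C \<in> hom (torus_points S F) complex_units" "LLC C \<in> extensional (carrier (torus_points S F))"
    unfolding continuous_characters_def hom_group_def by auto
qed

lemma LLC_mult:
  assumes "z \<in> carrier (weil_cocycles F v S)" "z' \<in> carrier (weil_cocycles F v S)"
    and "s \<in> carrier (torus_points S F)"
  shows "LLC (weil_class F v S (z \<otimes>\<^bsub>weil_cocycles F v S\<^esub> z')) s =
    LLC (weil_class F v S z) s * LLC (weil_class F v S z') s"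
proof -
  have "LLC (weil_class F v S z \<otimes>\<^bsub>weil_H1 F v S\<^esub> weil_class F v S z') =
      LLC (weil_class F v S z) \<otimes>\<^bsub>continuous_characters v S F\<^esub> LLC (weil_class F v S z')"
    using LLC_iso weil_class_in_H1[OF assms(1)] weil_class_in_H1[OF assms(2)] unfolding iso_def hom_def by blast
  then show ?thesis
    using assms(3) by (simp add: weil_class_mult continuous_characters_def hom_group_def del: torus_points_simps(1))
qed

lemma unramified_cocycle_add:
  assumes "additive g" "additive h"
  shows "unramified_cocycle (\<lambda>\<mu>. g \<mu> + h \<mu>) =
    unramified_cocycle g \<otimes>\<^bsub>weil_cocycles F v S\<^esub> unramified_cocycle h"
  by (rule ext) (simp add: weil_cocycles_mult unramified_cocycle_def norm_character_def dual_torus_simps(2)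
      restrict_def distrib_left exp_add cong: if_cong)

text \<open>\<open>LLC\<close> is a homomorphism and the unramified cocycle turns sums of logarithms
  into products. Applied to a fraction of \<open>g\<close>, the lemma extracts roots of
  characters.\<close>

lemma LLC_unramified_multiple:
  assumes g: "additive g" and s: "s \<in> carrier (torus_points S F)"
  shows "n > 0 \<Longrightarrow> LLC (weil_class F v S (unramified_cocycle (\<lambda>\<mu>. of_nat n * g \<mu>))) s =
    LLC (weil_class F v S (unramified_cocycle g)) s ^ n"
proof (induction n rule: nat_induct_non_zero)
  case 1 then show ?case by simp
next
  case (Suc n)
  have gn: "additive (\<lambda>\<mu>. of_nat n * g \<mu>)" using g by (simp add: additive_def distrib_left)
  have "(\<lambda>\<mu>. of_nat (Suc n) * g \<mu>) = (\<lambda>\<mu>. of_nat n * g \<mu> + g \<mu>)" by (auto simp: algebra_simps)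
  then show ?case
    using Suc LLC_mult[OF unramified_cocycle_closed[OF gn] unramified_cocycle_closed[OF g] s]
    by (simp add: unramified_cocycle_add[OF gn g])
qed

lemma one_cycle_eq:
  assumes "\<And>i. i < m \<Longrightarrow> w i \<in> weil_set F v" "\<And>i. i < m \<Longrightarrow> l i \<in> carrier cochars"
  shows "one_cycle F v S m w l \<longleftrightarrow>
    finprod cochars (\<lambda>i. lat.displacement (w i) (l i)) {..<m} = \<one>\<^bsub>cochars\<^esub>"
proof -
  have "finprod cochars (\<lambda>i. cochar_act (inv_into UNIV (w i)) (l i) \<otimes>\<^bsub>cochars\<^esub> inv\<^bsub>cochars\<^esub> l i) {..<m} =
    finprod cochars (\<lambda>i. lat.displacement (w i) (l i)) {..<m}"
    using assms WF_inv_stable by (intro lat.L.finprod_cong') (auto simp: lat.displacement_def)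
  then show ?thesis using assms by (simp add: one_cycle_def)
qed

text \<open>The values on elements of \<open>S(E)\<close> with absolute values of the coordinates equal to 1 that are
  not fixed by the Galois group are irrelevant: all characters of \<open>S(F)\<close> have the same value there.\<close>

lemma cycle_pairing_trivial:
  assumes z: "z \<in> carrier (weil_cocycles F v S)"
    and triv: "\<And>s. s \<in> maximal_bounded_subgroup v S F \<Longrightarrow> LLC (weil_class F v S z) s = 1"
    and adm: "lat.admissible_cycle n w l"
    and cyc: "finprod cochars (\<lambda>i. lat.displacement (w i) (l i)) {..<n} = \<one>\<^bsub>cochars\<^esub>"
  shows "(\<Prod>i<n. z (w i) (l i)) = 1"
proof -
  have w: "w i \<in> weil_set F v" and l: "l i \<in> carrier cochars"
    and deg: "WF.wdeg (w i) = 0 \<or> lat.Nm (l i) = \<one>\<^bsub>cochars\<^esub>" if "i < n" for i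
    using adm that by (auto simp: lat.admissible_cycle_def)
  have oc: "one_cycle F v S n w l" using one_cycle_eq[of n w l] w l cyc by blast
  define part where "part i r = (r \<circ> w i) \<circ> inv_into UNIV (rep (r \<circ> w i))" for i r
  have rw: "r \<circ> w i \<in> weil_set F v" if "i < n" "r \<in> R" for i r
    using that w R_WF WF.weil_set_comp by blast
  have partE: "part i r \<in> weil_set E v" if "i < n" "r \<in> R" for i r
    unfolding part_def using rep(2)[OF rw[OF that]] .
  \<comment> \<open>Reciprocity for \<open>E\<close> maps onto the abelianized Weil group, so each
    transfer part lies in the class of some unit of \<open>E\<close>; any choice will do.\<close>
  define a where "a i r = (SOME a. a \<in> E - {0} \<and> part i r \<in> rec E a)" for i r
  have a: "a i r \<in> E - {0}" "part i r \<in> rec E (a i r)" if "i < n" "r \<in> R" for i r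
  proof -
    have "\<exists>a. a \<in> E - {0} \<and> part i r \<in> rec E a" using rec_surj[OF partE[OF that]] by blast
    from someI_ex[OF this] show "a i r \<in> E - {0}" "part i r \<in> rec E (a i r)" by (auto simp: a_def)
  qed
  define s where "s = finprod (torus_points S E) (\<lambda>i.
    finprod (torus_points S E) (\<lambda>r. cochar_act r (l i) (a i r)) R) {..<n}"
  have eval: "LLC (weil_class F v S y) s = (\<Prod>i<n. y (w i) (l i))" if "y \<in> carrier (weil_cocycles F v S)" for y
    unfolding s_def using that oc by (rule LLC_cycle) (use a in \<open>simp add: transfer_part_eq part_def\<close>)
  interpret TE: comm_group "torus_points S E" using subfield_E by (rule torus_points_comm_group)
  have act: "cochar_act r (l i) \<in> carrier cochars" if "i < n" "r \<in> R" for i r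
    using that l R_WF WF_stable by blast
  have pt: "cochar_act r (l i) (a i r) \<in> carrier (torus_points S E)" if "i < n" "r \<in> R" for i r
    using cochar_torus_points[OF act[OF that]] a(1)[OF that] by blast
  have pts: "(\<lambda>r. cochar_act r (l i) (a i r)) \<in> R \<rightarrow> carrier (torus_points S E)" if "i < n" for i
    using pt that by blast
  have inner: "(\<lambda>i. finprod (torus_points S E) (\<lambda>r. cochar_act r (l i) (a i r)) R) \<in> {..<n} \<rightarrow> carrier (torus_points S E)"
    using TE.finprod_closed[OF pts] by blast
  have sE: "s \<in> carrier (torus_points S E)" unfolding s_def by (rule TE.finprod_closed[OF inner])
  have unit: "v (coord s k) = 1" if k: "k < rk" for k
  proof -
    \<comment> \<open>The exponent of \<open>v \<pi>\<close> that the term for \<open>i\<close> and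
      \<open>r\<close> contributes to the \<open>k\<close>-th coordinate: the degree over
      \<open>E\<close> gives the valuation of \<open>a i r\<close>, and the cocharacter raises it to
      its \<open>k\<close>-th exponent.\<close>
    define d where "d i r = WE.wdeg (part i r) * expo (cochar_act r (l i)) k" for i r
    have "coord s k = (\<Prod>i<n. coord (finprod (torus_points S E) (\<lambda>r. cochar_act r (l i) (a i r)) R) k)"
      unfolding s_def by (rule coord_finprod[OF subfield_E inner])
    also have "\<dots> = (\<Prod>i<n. \<Prod>r\<in>R. coord (cochar_act r (l i) (a i r)) k)"
      by (intro prod.cong refl coord_finprod[OF subfield_E pts]) simp
    finally have "v (coord s k) = (\<Prod>i<n. \<Prod>r\<in>R. v (coord (cochar_act r (l i) (a i r)) k))"
      by (simp add: v_prod)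
    also have "\<dots> = (\<Prod>i<n. \<Prod>r\<in>R. v \<pi> powi d i r)"
    proof (intro prod.cong refl)
      fix i r assume ir: "i \<in> {..<n}" "r \<in> R"
      then have i: "i < n" by simp
      have "coord (cochar_act r (l i) (a i r)) k = a i r powi expo (cochar_act r (l i)) k"
        using a(1)[OF i ir(2)] by (intro coord_expo[OF act[OF i ir(2)] _ k]) simp
      then show "v (coord (cochar_act r (l i) (a i r)) k) = v \<pi> powi d i r"
        using rec_valuation[OF a[OF i ir(2)]] by (simp add: v_powi d_def power_int_mult)
    qed
    also have "\<dots> = v \<pi> powi (\<Sum>i<n. \<Sum>r\<in>R. d i r)"
      using \<pi>(4) by (simp add: powi_sum)
    also have "(\<Sum>i<n. \<Sum>r\<in>R. d i r) = 0"
    proof -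
      \<comment> \<open>On the Weil group of \<open>E\<close>, \<open>c\<close> times the degree
        over \<open>E\<close> is \<open>b\<close> times the degree over \<open>F\<close>.
        Multiplying by \<open>c\<close> thus leads to the sum in \<open>transfer_degree\<close>, and
        the positive factor \<open>c\<close> is cancelled at the end.\<close>
      have cd: "int c * d i r = int b * ((WF.wdeg (r \<circ> w i) - WF.wdeg (rep (r \<circ> w i))) * expo (cochar_act r (l i)) k)"
        if "i < n" "r \<in> R" for i r
      proof -
        have W: "rep (r \<circ> w i) \<in> weil_set F v" using rep(1)[OF rw[OF that]] R_WF by blast
        have "part i r \<in> weil_set F v" "WF.wdeg (part i r) = WF.wdeg (r \<circ> w i) - WF.wdeg (rep (r \<circ> w i))"
          using rw[OF that] W by (simp_all only: part_def WF.weil_set_comp WF.weil_set_inv WF.wdeg_comp WF.wdeg_inv)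
        then show ?thesis
          using wdeg_extension[OF WF.weil_axioms WE.weil_axioms _ partE[OF that]] by (simp add: d_def flip: mult.assoc)
      qed
      have "int c * (\<Sum>i<n. \<Sum>r\<in>R. d i r) =
        int b * (\<Sum>i<n. \<Sum>r\<in>R. (WF.wdeg (r \<circ> w i) - WF.wdeg (rep (r \<circ> w i))) * expo (cochar_act r (l i)) k)"
        using cd by (simp add: sum_distrib_left)
      also have "(\<Sum>i<n. \<Sum>r\<in>R. (WF.wdeg (r \<circ> w i) - WF.wdeg (rep (r \<circ> w i))) * expo (cochar_act r (l i)) k) =
          (\<Sum>i<n. WF.wdeg (w i) * expo (lat.Nm (l i)) k)"
        using lat.transfer_degree[of "\<lambda>\<mu>. expo \<mu> k" n w l, OF expo_mult _ _ cyc] k w l by simp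
      also have "\<dots> = 0"
      proof (rule sum.neutral, intro ballI)
        fix i assume "i \<in> {..<n}"
        moreover have "expo \<one>\<^bsub>cochars\<^esub> k = 0" using expo_cochar[OF k, of "\<lambda>_. 0"] by (simp add: cochar_zero)
        ultimately show "WF.wdeg (w i) * expo (lat.Nm (l i)) k = 0" using deg[of i] by auto
      qed
      finally show ?thesis using WE.b_pos by simp
    qed
    finally show ?thesis by simp
  qed
  show ?thesis
  proof (cases "s \<in> carrier (torus_points S F)")
    case True
    then have "s \<in> maximal_bounded_subgroup v S F"
      unfolding maximal_bounded_subgroup_eq[OF subfield_F] integral_points_def using unit by blast
    then show ?thesis using triv eval[OF z] by simp
  next
    case False
    \<comment> \<open>The comparison is with the trivial cocycle, whose pairing with the cycle is 1.
      Outside \<open>S(F)\<close> both characters, being extensional, take the value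
      \<open>undefined\<close>.\<close>
    have zero: "additive (\<lambda>_. 0)" by (simp add: additive_def)
    note z0 = unramified_cocycle_closed[OF zero]
    have undef: "LLC C s = undefined" if "C \<in> carrier (weil_H1 F v S)" for C
      using LLC_character(2)[OF that] False by (rule extensional_arb)
    have "(\<Prod>i<n. unramified_cocycle (\<lambda>_. 0) (w i) (l i)) = 1"
      using w l by (intro prod.neutral) (simp add: unramified_cocycle_def norm_character_def)
    then show ?thesis
      using eval[OF z] eval[OF z0] undef[OF weil_class_in_H1[OF z]] undef[OF weil_class_in_H1[OF z0]] by simp
  qed
qed

lemma trivial_on_bounded_unramified:
  assumes z: "z \<in> carrier (weil_cocycles F v S)"
    and triv: "\<And>s. s \<in> maximal_bounded_subgroup v S F \<Longrightarrow> LLC (weil_class F v S z) s = 1"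
  shows "\<exists>g. additive g \<and> weil_class F v S z = weil_class F v S (unramified_cocycle g)"
proof -
  obtain \<Gamma> where "lat.trivializing_graph z \<Gamma>"
    using lat.trivializing_graph_if_cycles[OF weil_cocycle[OF z]] cycle_pairing_trivial[OF z triv] by blast
  moreover have "z \<in> weil_set F v \<rightarrow>\<^sub>E carrier (dual_torus S)" using z by (simp add: weil_cocycles_carrier)
  ultimately show ?thesis using class_unramified weil_cocycle[OF z] by blast
qed

text \<open>A power of a bounded element of \<open>S(F)\<close> is a norm from \<open>S(E)\<close>, hence the transfer of a cycle
  supported on inertia elements.\<close>

lemma LLC_unramified_power:
  assumes g: "additive g" and s: "s \<in> maximal_bounded_subgroup v S F"
  shows "LLC (weil_class F v S (unramified_cocycle g)) s ^ card R = 1"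
proof -
  have sF: "s \<in> carrier (torus_points S F)" and unit: "\<And>k. k < rk \<Longrightarrow> v (coord s k) = 1"
    using s unfolding maximal_bounded_subgroup_eq[OF subfield_F] integral_points_def by auto
  have sE: "s \<in> carrier (torus_points S E)" and sS: "s \<in> S" using sF F_subset_E by auto
  interpret TE: comm_group "torus_points S E" using subfield_E by (rule torus_points_comm_group)
  define a where "a j = coord s j" for j
  have a: "a j \<in> E - {0}" for j using coord_in_subfield[OF sE] coord_nonzero[OF sS] by (simp add: a_def)
  define w where "w j = (SOME w. w \<in> rec E (a j))" for j
  have w: "w j \<in> rec E (a j)" for j using rec_coset(1)[OF a] by (simp add: w_def some_in_eq)
  have wE: "w j \<in> weil_set E v" for j using rec_coset(2)[OF a] w by blast
  \<comment> \<open>Since \<open>v \<pi>\<close> lies strictly between 0 and 1, only its power with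
    exponent 0 equals 1: unit coordinates correspond to inertia elements.\<close>
  have w0: "WE.wdeg (w j) = 0" if j: "j < rk" for j
  proof -
    have e: "v \<pi> powi WE.wdeg (w j) = 1" using rec_valuation[OF a w] unit[OF j] by (simp add: a_def)
    show ?thesis
    proof (rule ccontr)
      assume ne: "WE.wdeg (w j) \<noteq> 0"
      have "v \<pi> ^ nat \<bar>WE.wdeg (w j)\<bar> = 1"
      proof (cases "WE.wdeg (w j) \<ge> 0")
        case True then show ?thesis using e by (simp add: power_int_def)
      next
        case False
        then have "inverse (v \<pi> ^ nat \<bar>WE.wdeg (w j)\<bar>) = 1" using e by (simp add: power_int_def power_inverse)
        then show ?thesis by (metis inverse_inverse_eq inverse_1)
      qed
      moreover have "v \<pi> ^ nat \<bar>WE.wdeg (w j)\<bar> < 1" using \<pi>(2,3) ne by (simp add: power_less_one_iff)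
      ultimately show False by simp
    qed
  qed
  have wF: "w j \<in> weil_set F v" "WF.wdeg (w j) = 0" if "j < rk" for j
    using inertia_EF[OF wE w0[OF that]] by auto
  \<comment> \<open>Each \<open>w j\<close> comes from the Weil group of \<open>E\<close> and acts
    trivially on cocharacters, so this chain is a cycle term by term.\<close>
  have disp: "lat.displacement (w j) (basic_cochar j) = \<one>\<^bsub>cochars\<^esub>" if j: "j < rk" for j
  proof -
    have "cochar_act (inv_into UNIV (w j)) (basic_cochar j) = basic_cochar j"
      using WE_galois[OF WE.weil_set_inv[OF wE]] basic_cochar_closed by (rule cochar_act_trivial)
    then show ?thesis using wF[OF j] basic_cochar_closed by (simp add: lat.displacement_def)
  qed
  have "finprod cochars (\<lambda>j. lat.displacement (w j) (basic_cochar j)) {..<rk} = \<one>\<^bsub>cochars\<^esub>"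
    using disp by (intro lat.L.finprod_one_eqI) simp
  then have oc: "one_cycle F v S rk w basic_cochar"
    using one_cycle_eq[of rk w basic_cochar] wF(1) basic_cochar_closed by blast
  have transfer: "r (a j) \<in> E - {0} \<and> transfer_part E v R (r \<circ> w j) \<in> rec E (r (a j))" if j: "j < rk" and r: "r \<in> R" for j r
  proof -
    have gal: "r \<in> galois_set F" using R_WF[OF r] by (rule WF_galois)
    have ra: "r (a j) \<in> E - {0}" using galois_E[OF gal] galois_set_hom(9)[OF gal] a by simp
    \<comment> \<open>By Galois equivariance of reciprocity, conjugating \<open>w j\<close> by
      \<open>r\<close> gives an element of the class of \<open>r (a j)\<close>. As it lies in the
      Weil group of \<open>E\<close>, the coset of \<open>r w j\<close> is represented by
      \<open>r\<close> itself.\<close>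
    have mem: "r \<circ> w j \<circ> inv_into UNIV r \<in> rec E (r (a j))"
      unfolding rec_galois[OF gal a] using w by blast
    then have "r \<circ> w j \<circ> inv_into UNIV r \<in> weil_set E v" using rec_coset(2)[OF ra] by blast
    then have "rep (r \<circ> w j) = r"
      using rep_eqI[OF WF.weil_set_comp[OF R_WF[OF r] wF(1)[OF j]] r] by simp
    then show ?thesis using ra mem by (simp add: transfer_part_eq)
  qed
  define t where "t = finprod (torus_points S E) (\<lambda>j.
    finprod (torus_points S E) (\<lambda>r. cochar_act r (basic_cochar j) (r (a j))) R) {..<rk}"
  have "LLC (weil_class F v S (unramified_cocycle g)) t = (\<Prod>j<rk. unramified_cocycle g (w j) (basic_cochar j))"
    unfolding t_def using unramified_cocycle_closed[OF g] oc by (rule LLC_cycle) (use transfer in blast)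
  also have "\<dots> = 1"
    using wF basic_cochar_closed by (intro prod.neutral) (simp add: unramified_cocycle_def norm_character_def)
  finally have t1: "LLC (weil_class F v S (unramified_cocycle g)) t = 1" .
  have val: "cochar_act r (basic_cochar j) (r (a j)) = map_matrix r (basic_cochar j (a j))" if "r \<in> R" for r j
  proof -
    have gal: "r \<in> galois_set F" using R_WF[OF that] by (rule WF_galois)
    then have "r (a j) \<noteq> 0" using galois_set_hom(9)[OF gal] a by simp
    then show ?thesis using galois_inv(2)[OF gal] by (simp add: cochar_act_apply)
  qed
  have bpt: "basic_cochar j (a j) \<in> carrier (torus_points S E)" for j
    using cochar_torus_points[OF basic_cochar_closed] a by blast
  have mpt: "map_matrix r A \<in> carrier (torus_points S E)" if "r \<in> R" "A \<in> carrier (torus_points S E)" for r A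
    using that stable[OF WF_galois[OF R_WF]] galois_E[OF WF_galois[OF R_WF]] by auto
  have "t = finprod (torus_points S E) (\<lambda>j. finprod (torus_points S E) (\<lambda>r. map_matrix r (basic_cochar j (a j))) R) {..<rk}"
    unfolding t_def
    using val mpt[OF _ bpt]
    by (intro TE.finprod_cong' refl) (auto intro!: TE.finprod_cong' TE.finprod_closed simp del: torus_points_simps(1))
  \<comment> \<open>After the swap the inner product is the decomposition of \<open>s\<close> along
    the basis, moved by \<open>r\<close>. It equals \<open>s\<close> because \<open>s\<close> has
    entries in \<open>F\<close>, so the transfer is the norm of \<open>s\<close>.\<close>
  also have "\<dots> = finprod (torus_points S E) (\<lambda>r. finprod (torus_points S E) (\<lambda>j. map_matrix r (basic_cochar j (a j))) {..<rk}) R"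
    using mpt[OF _ bpt] by (intro finprod_swap TE.comm_monoid_axioms) auto
  also have "\<dots> = finprod (torus_points S E) (\<lambda>r. s) R"
  proof (intro TE.finprod_cong' refl)
    fix r assume r: "r \<in> R"
    have gal: "r \<in> galois_set F" using R_WF[OF r] by (rule WF_galois)
    have hom: "map_matrix r \<in> hom (torus_points S E) (torus_points S E)"
      using mpt[OF r] map_matrix_mult[OF gal] by (auto simp: hom_def simp del: torus_points_simps(1))
    have "finprod (torus_points S E) (\<lambda>j. map_matrix r (basic_cochar j (a j))) {..<rk} =
        map_matrix r (finprod (torus_points S E) (\<lambda>j. basic_cochar j (a j)) {..<rk})"
      using bpt map_matrix_one[OF gal]
      by (intro comm_monoid_hom_finprod[OF TE.comm_monoid_axioms TE.comm_monoid_axioms hom, symmetric])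
        (auto simp del: torus_points_simps(1))
    also have "\<dots> = map_matrix r s" using torus_point_decomposition[OF sE] by (simp add: a_def)
    also have "\<dots> = s"
      using sF galois_set_hom(4)[OF gal] by (simp add: vec_eq_iff map_matrix_def)
    finally show "finprod (torus_points S E) (\<lambda>j. map_matrix r (basic_cochar j (a j))) {..<rk} = s" .
  qed (use sE in auto)
  also have "\<dots> = s [^]\<^bsub>torus_points S E\<^esub> card R"
    using TE.finprod_const[OF sE] .
  finally have t: "t = s [^]\<^bsub>torus_points S E\<^esub> card R" .
  let ?\<theta> = "LLC (weil_class F v S (unramified_cocycle g))"
  have hom: "?\<theta> \<in> hom (torus_points S F) complex_units"
    using LLC_character(1) weil_class_in_H1 unramified_cocycle_closed[OF g] by blast
  interpret TF: comm_group "torus_points S F" using subfield_F by (rule torus_points_comm_group)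
  interpret \<theta>: group_hom "torus_points S F" complex_units ?\<theta>
    using hom by (simp add: group_hom_def group_hom_axioms_def TF.is_group units.is_group)
  have "s [^]\<^bsub>torus_points S E\<^esub> k \<in> carrier (torus_points S F) \<and>
      ?\<theta> (s [^]\<^bsub>torus_points S E\<^esub> k) = ?\<theta> s ^ k" for k :: nat
  proof (induction k)
    case 0 then show ?case using \<theta>.hom_one TF.one_closed by simp
  next
    case (Suc k)
    have "s [^]\<^bsub>torus_points S E\<^esub> Suc k = s [^]\<^bsub>torus_points S E\<^esub> k \<otimes>\<^bsub>torus_points S F\<^esub> s" by simp
    then show ?case using Suc sF TF.m_closed \<theta>.hom_mult by (simp del: torus_points_simps(1))
  qed
  then show ?thesis using t t1 by metis
qed

lemma LLC_unramified_trivial_on_bounded: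
  assumes g: "additive g" and s: "s \<in> maximal_bounded_subgroup v S F"
  shows "LLC (weil_class F v S (unramified_cocycle g)) s = 1"
proof -
  have sF: "s \<in> carrier (torus_points S F)"
    using s unfolding maximal_bounded_subgroup_eq[OF subfield_F] integral_points_def by auto
  have R: "card R > 0" using finite_R lat.R(2) by (simp add: card_gt_0_iff)
  define h where "h \<mu> = g \<mu> / of_nat (card R)" for \<mu>
  have h: "additive h" using g by (simp add: additive_def h_def add_divide_distrib)
  have "(\<lambda>\<mu>. of_nat (card R) * h \<mu>) = g" using R by (auto simp: h_def)
  then show ?thesis
    using LLC_unramified_multiple[OF h sF R] LLC_unramified_power[OF h s] by simp
qed

theorem trivial_on_bounded_iff_inflated:
  assumes z: "z \<in> carrier (weil_cocycles F v S)"
  shows "(\<forall>s\<in>maximal_bounded_subgroup v S F. LLC (weil_class F v S z) s = 1) \<longleftrightarrow>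
    weil_class F v S z \<in> inflation_map F v S ` carrier (unramified_H1 F v S)"
proof
  assume "\<forall>s\<in>maximal_bounded_subgroup v S F. LLC (weil_class F v S z) s = 1"
  then obtain g where "additive g" "weil_class F v S z = weil_class F v S (unramified_cocycle g)"
    using trivial_on_bounded_unramified[OF z] by blast
  then show "weil_class F v S z \<in> inflation_map F v S ` carrier (unramified_H1 F v S)"
    using unramified_class_inflated by simp
next
  assume "weil_class F v S z \<in> inflation_map F v S ` carrier (unramified_H1 F v S)"
  then obtain g where "additive g" "weil_class F v S z = weil_class F v S (unramified_cocycle g)"
    using inflated_class_unramified[OF z] by blast
  then show "\<forall>s\<in>maximal_bounded_subgroup v S F. LLC (weil_class F v S z) s = 1"
    using LLC_unramified_trivial_on_bounded by simp
qed

end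

text \<open>If the residue field were infinite, its cardinality would be the junk value 0, and an
  arithmetic Frobenius element would have to map 0 to \<open>0 ^ 0 = 1\<close> modulo the maximal ideal.\<close>

lemma residue_card_pos_if_frobenius:
  assumes v: "nonarch_abs v" and K: "subfield K field_of_type" and C: "C \<in> carrier (weil_ab K v)"
    and frob: "\<And>w. w \<in> C \<Longrightarrow> frobenius_power K v w 1"
  shows "residue_card K v > 0"
proof (rule ccontr)
  interpret nonarch v by unfold_locales (rule v)
  assume "\<not> residue_card K v > 0"
  then have q: "residue_card K v = 0" by simp
  have id_gal: "id \<in> galois_set L" for L by (simp add: galois_set_def)
  have id_inertia: "id \<in> inertia K v" using id_gal by (simp add: inertia_def)
  have "frobenius_power K v id 0" by (simp add: frobenius_power_def)
  then have id_weil: "id \<in> weil_set K v" using id_gal by (auto simp: weil_set_def)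
  define D where "D = derived (weil_group K v) (weil_set K v)"
  have top: "topspace (weil_topology K v) =
      \<Union> {(\<lambda>u. w \<circ> u) ` (inertia K v \<inter> galois_set L) |w L. w \<in> weil_set K v \<and> finite_extension K L}"
    by (simp add: weil_topology_def topology_generated_by_topspace)
  have "id \<in> (\<lambda>u. id \<circ> u) ` (inertia K v \<inter> galois_set K)" using id_inertia id_gal by force
  then have "id \<in> topspace (weil_topology K v)"
    unfolding top using id_weil finite_extension_self[OF K] by blast
  moreover have "\<one>\<^bsub>weil_group K v\<^esub> \<in> D" unfolding D_def derived_def by (rule generate.one)
  ultimately have id_closure: "id \<in> weil_topology K v closure_of D"
    using closure_of_subset_Int[of "weil_topology K v" D] by (auto simp: weil_group_def)
  obtain g where g: "g \<in> weil_set K v" "C = (weil_topology K v closure_of D) #>\<^bsub>weil_group K v\<^esub> g"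
    using C by (auto simp: weil_ab_def FactGroup_def RCOSETS_def D_def weil_group_def)
  have "g \<in> C" unfolding g(2) r_coset_def by (rule UN_I[OF id_closure]) (simp add: weil_group_def)
  from frob[OF this] have "v (g 0 - 0 ^ (residue_card K v ^ nat 1)) < 1"
    unfolding frobenius_power_def by (elim allE[of _ 0]) simp
  moreover have "g 0 = 0" using g(1) galois_set_hom(5) by (auto simp: weil_set_def)
  ultimately show False by (simp add: q)
qed

section \<open>Assembling the local data from the hypotheses\<close>

theorem lemma3p1p6:
  fixes F :: "'a::field set"
    and v :: "'a \<Rightarrow> real"
    and S :: "('a^'n^'n) set"
    and rec :: "'a set \<Rightarrow> 'a \<Rightarrow> ('a \<Rightarrow> 'a) set"
    and LLC :: "(('a \<Rightarrow> 'a) \<Rightarrow> ('a \<Rightarrow> 'a^'n^'n) \<Rightarrow> complex) set \<Rightarrow> 'a^'n^'n \<Rightarrow> complex"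
    and \<theta> :: "'a^'n^'n \<Rightarrow> complex"
    and \<phi> :: "(('a \<Rightarrow> 'a) \<Rightarrow> ('a \<Rightarrow> 'a^'n^'n) \<Rightarrow> complex) set"
  assumes "nonarch_local_field F v"
    and "is_separable_closure_of TYPE('a) F"
    and "local_reciprocity F v rec"
    and "torus_over F S"
    and "\<exists>E. finite_extension F E \<and> tamely_ramified F E v \<and> splits_over S E"
    and "langlands_correspondence F v rec S LLC"
    and "\<theta> \<in> carrier (continuous_characters v S F)"
    and "\<phi> \<in> carrier (weil_H1 F v S)"
    and "LLC \<phi> = \<theta>"
  shows "(\<forall>s\<in>maximal_bounded_subgroup v S F. \<theta> s = 1) \<longleftrightarrow>
    \<phi> \<in> inflation_map F v S ` carrier (unramified_H1 F v S)"
proof -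
  have F: "subfield F field_of_type" and nv: "nonarch_abs v" and "\<exists>\<pi>. uniformizer F v \<pi>"
    and fin: "finite (residue_field F v)"
    using assms(1) by (auto simp: nonarch_local_field_def)
  then obtain \<pi> where \<pi>: "uniformizer F v \<pi>" by blast
  interpret nonarch v by unfold_locales (rule nv)
  note lr = assms(3)[unfolded local_reciprocity_def, rule_format]
  obtain E R where E: "finite_galois_extension F E" "splits_over S E" and R: "coset_representatives F E v R"
    and LLC_cycle: "\<forall>z\<in>carrier (weil_cocycles F v S). \<forall>m w l a.
      one_cycle F v S m w l \<and>
      (\<forall>i<m. \<forall>r\<in>R. a i r \<in> E - {0} \<and> transfer_part E v R (r \<circ> w i) \<in> rec E (a i r)) \<longrightarrow>
      LLC (weil_class F v S z) (finprod (torus_points S E) (\<lambda>i.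
          finprod (torus_points S E) (\<lambda>r. cochar_act r (l i) (a i r)) R) {..<m}) =
      (\<Prod>i<m. z (w i) (l i))"
    using assms(6) unfolding langlands_correspondence_def by (elim conjE exE) (rule that)
  have LLC_iso: "LLC \<in> iso (weil_H1 F v S) (continuous_characters v S F)"
    using assms(6) unfolding langlands_correspondence_def by (rule conjunct1)
  have ext: "finite_extension F E" using E(1) by (simp add: finite_galois_extension_def)
  have Esub: "subfield E field_of_type" using ext by (simp add: finite_extension_def)
  have extF: "finite_extension F F" using F by (rule finite_extension_self)
  \<comment> \<open>The class of 0 shows that the residue field is not empty, so its finiteness
    makes the cardinality positive.\<close>
  have "{y. (0, y) \<in> {(x, y). x \<in> F \<and> y \<in> F \<and> v x \<le> 1 \<and> v y \<le> 1 \<and> v (x - y) < 1}} \<in> residue_field F v"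
    unfolding residue_field_def quotient_def Image_def using subfield_facts(1)[OF F] by force
  then have "residue_card F v > 0" using fin by (auto simp: card_gt_0_iff)
  then obtain p b where p: "normalization_semidom_class.prime (p::nat)" "v (of_nat p) < 1"
    and b: "b > 0" "residue_card F v = p ^ b"
    using residue_card_prime_power[OF F] by blast
  interpret sep_closed_residue_char v p
    using p assms(2) by unfold_locales (auto simp: is_separable_closure_of_def)
  interpret WF: weil v p F b
    using sep_closed_residue_char_axioms F b by (simp add: weil_def weil_axioms_def)
  have rec_iso: "rec K \<in> iso (mult_group K) (weil_ab K v)"
    and rec_uniformizer: "\<And>u w. uniformizer K v u \<Longrightarrow> w \<in> rec K u \<Longrightarrow> frobenius_power K v w 1"
    and rec_galois: "\<And>\<sigma> x. \<sigma> \<in> galois_set F \<Longrightarrow> x \<in> K - {0} \<Longrightarrow>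
      rec (\<sigma> ` K) (\<sigma> x) = (\<lambda>w. \<sigma> \<circ> w \<circ> inv_into UNIV \<sigma>) ` rec K x"
    if "finite_extension F K" for K
    using lr[OF that] by blast+
  have rec_unif_closed: "rec K u \<in> carrier (weil_ab K v)" if "finite_extension F K" "uniformizer K v u" for K u
    using rec_iso[OF that(1)] that(2) by (auto simp: iso_def hom_def uniformizer_def)
  obtain \<pi>' where \<pi>': "uniformizer E v \<pi>'" using uniformizer_exists[OF ext \<pi>] by blast
  \<comment> \<open>That the residue field of \<open>E\<close> is finite is read off from
    reciprocity for \<open>E\<close>, which provides an arithmetic Frobenius, instead of being
    derived from the degree of \<open>E\<close> over \<open>F\<close>.\<close>
  have "residue_card E v > 0"
    using nv Esub rec_unif_closed[OF ext \<pi>'] rec_uniformizer[OF ext \<pi>'] by (rule residue_card_pos_if_frobenius)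
  then obtain p' c where p': "normalization_semidom_class.prime (p'::nat)" "v (of_nat p') < 1"
    and c: "c > 0" "residue_card E v = p' ^ c"
    using residue_card_prime_power[OF Esub] by blast
  have "p' = p" using p'(1) p(1) p'(2) p(2) by (rule residue_characteristic_unique)
  then interpret WE: weil v p E c
    using sep_closed_residue_char_axioms Esub c by (simp add: weil_def weil_axioms_def)
  \<comment> \<open>Any member of the reciprocity class of a uniformizer of \<open>F\<close> has
    degree 1.\<close>
  have frobenius_exists: "\<exists>w\<in>weil_set F v. WF.wdeg w = 1"
    using WF.weil_ab_coset[OF rec_unif_closed[OF extF \<pi>]] WF.wdeg_eq[OF rec_uniformizer[OF extF \<pi>]] by blast
  obtain rk and \<iota> :: "(nat \<Rightarrow> 'a) \<Rightarrow> 'a^'n^'n" where inv: "S \<subseteq> {A. invertible A}" and \<iota>: "bij_betw \<iota> (Gm_pow rk) S"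
      "\<forall>s\<in>Gm_pow rk. \<forall>t\<in>Gm_pow rk. \<iota> (\<lambda>i. s i * t i) = \<iota> s ** \<iota> t"
      "\<forall>i j. \<exists>h\<in>regular_on_Gm_pow E rk. \<forall>t\<in>Gm_pow rk. \<iota> t $ i $ j = h t"
      "\<forall>k<rk. \<exists>h\<in>regular_on_GL E. \<forall>t\<in>Gm_pow rk. h (\<iota> t) = t k"
    using E(2) unfolding splits_over_def by (elim conjE exE) (rule that)
  \<comment> \<open>The powers of a uniformizer have distinct absolute values, so the ambient field
    is infinite.\<close>
  have "inj (\<lambda>n. v (\<pi> ^ n))"
    using \<pi> by (intro injI) (auto simp: v_power uniformizer_def power_inject_exp')
  then have "infinite (range (\<lambda>n. \<pi> ^ n))"
    by (intro range_inj_infinite) (metis injI injD)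
  then have infinite: "infinite (UNIV :: 'a set)" using finite_subset[OF subset_UNIV] by blast
  have "split_torus S E rk \<iota>"
  proof (intro split_torus.intro Esub infinite \<iota>(1))
    show "invertible A" if "A \<in> S" for A using inv that by (auto dest: subsetD)
  qed (use \<iota> in simp_all)
  then have split: "nonarch_split_torus S E rk \<iota> v"
    using nonarch_axioms by (rule nonarch_split_torus.intro)
  have stable: "\<forall>\<sigma>\<in>galois_set F. \<forall>A\<in>S. map_matrix \<sigma> A \<in> S"
    using assms(4) unfolding torus_over_def by (rule conjunct2)
  have "torus_over_local_field S E rk \<iota> v p F b c R"
  proof (intro torus_over_local_field.intro torus_over_local_field_axioms.intro split
      sep_closed_residue_char_axioms WF.weil_axioms WE.weil_axioms E(1) R frobenius_exists)
  qed (use stable in blast)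
  then interpret langlands_for_torus S E rk \<iota> v p F b c R rec LLC
  proof (intro langlands_for_torus.intro langlands_for_torus_axioms.intro rec_iso[OF ext] LLC_iso exI[of _ \<pi>'] \<pi>')
    show "rec E (\<sigma> x) = (\<lambda>w. \<sigma> \<circ> w \<circ> inv_into UNIV \<sigma>) ` rec E x" if "\<sigma> \<in> galois_set F" "x \<in> E - {0}" for \<sigma> x
      using rec_galois[OF ext that] E(1) that(1) by (simp add: finite_galois_extension_def)
    show "LLC (weil_class F v S z) (finprod (torus_points S E) (\<lambda>i.
          finprod (torus_points S E) (\<lambda>r. cochar_act r (l i) (a i r)) R) {..<m}) = (\<Prod>i<m. z (w i) (l i))"
      if "z \<in> carrier (weil_cocycles F v S)" "one_cycle F v S m w l"
        "\<And>i r. i < m \<Longrightarrow> r \<in> R \<Longrightarrow> a i r \<in> E - {0} \<and> transfer_part E v R (r \<circ> w i) \<in> rec E (a i r)"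
      for z m w l a
      using LLC_cycle[rule_format, of z m w l a] that by blast
  qed (assumption, rule rec_uniformizer[OF ext])
  obtain z where z: "z \<in> carrier (weil_cocycles F v S)" "\<phi> = weil_class F v S z"
    using assms(8) unfolding weil_H1_carrier by blast
  show ?thesis
    unfolding assms(9)[symmetric] z(2) by (rule trivial_on_bounded_iff_inflated[OF z(1)])
qed

end
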